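(* Let $\lambda/\mu$ be a skew shape with $n$ cells which is not a connected ribbon. Then all coefficients in the (unique) expansion of the skew Schur function $s_{\lambda/\mu}$ in the basis $\{\hat F^{\mathrm{cyc}}_{n,A}: A \text{ a cyclic orbit of nonempty subsets of } [n]\}$ of $\mathrm{cQSym}_n$ are nonnegative integers.
   Context: A ribbon is a skew shape containing no $2\times2$ square. For $n\ge1$ and $J\subseteq[n]$, let $P^{\mathrm{cyc}}_{n,J}$ be the set of pairs $(w,k)$ with $w\in\{1,2,\dots\}^n$, $k\in[n]$, such that (i) $w_k\le w_{k+1}\le\cdots\le w_n\le w_1\le\cdots\le w_{k-1}$, and (ii) $w_j<w_{j+1}$ for every $j\in J\setminus\{k-1\}$, indices modulo $n$. Define $F^{\mathrm{cyc}}_{n,J}:=\sum_{(w,k)\in P^{\mathrm{cyc}}_{n,J}}x_{w_1}\cdots x_{w_n}$. The group $\mathbb{Z}/n\mathbb{Z}$ acts on subsets of $[n]$ by cyclic shifts $J\mapsto J+i=\{j+i \bmod n: j\in J\}$; let $d_J$ be the order of the stabilizer of $J$. The normalized function $\hat F^{\mathrm{cyc}}_{n,J}:=F^{\mathrm{cyc}}_{n,J}/d_J$ depends only on the orbit $A$ of $J$ and is denoted $\hat F^{\mathrm{cyc}}_{n,A}$. $\mathrm{cQSym}_n$ is the abelian group of homogeneous degree-$n$ formal power series $f\in\mathbb{Z}[[x_1,x_2,\dots]]$ such that for any $t\ge1$, any $i_1<\dots<i_t$ and $i'_1<\dots<i'_t$, any positive integers $m=(m_1,\dots,m_t)$ and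 any cyclic shift $m'$ of $m$, the coefficients of $x_{i_1}^{m_1}\cdots x_{i_t}^{m_t}$ and $x_{i'_1}^{m'_1}\cdots x_{i'_t}^{m'_t}$ in $f$ agree. The set $\{\hat F^{\mathrm{cyc}}_{n,A}\}$ over nonempty orbits $A$ is a $\mathbb{Z}$-basis of $\mathrm{cQSym}_n$, which contains all symmetric functions of degree $n$. *)

theory Defs
  imports Complex_Main "HOL-Library.Multiset" "HOL-Library.FuncSet"
begin

section \<open>Formal power series\<close>

text \<open>
  A monomial in the variables \<open>x\<^sub>1, x\<^sub>2, \<dots>\<close> is the multiset of the indices of its variables, so
  \<open>x\<^bsub>w\<^sub>1\<^esub> \<cdots> x\<^bsub>w\<^sub>n\<^esub>\<close> is \<open>mset w\<close>. A power series is its coefficient function. Coefficients are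
  rational because the normalized functions below are defined by a division; series with
  integer coefficients are singled out by \<open>\<int>\<close> where needed. The index \<open>0\<close> is not a variable:
  all series considered here vanish on monomials containing it.
\<close>

type_synonym monomial = "nat multiset"
type_synonym series = "monomial \<Rightarrow> rat"

text \<open>\<open>x\<^bsub>i\<^sub>1\<^esub>\<^bsup>m\<^sub>1\<^esup> \<cdots> x\<^bsub>i\<^sub>t\<^esub>\<^bsup>m\<^sub>t\<^esup>\<close> for lists \<open>i\<close>, \<open>m\<close> of the same length \<open>t\<close>:\<close>

definition power_monomial :: "nat list \<Rightarrow> nat list \<Rightarrow> monomial" where
  "power_monomial is ms = (\<Sum>l<length is. replicate_mset (ms ! l) (is ! l))"

definition var_indices :: "nat list \<Rightarrow> bool" where
  "var_indices is \<longleftrightarrow> sorted_wrt (<) is \<and> (\<forall>i\<in>set is. 1 \<le> i)"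

definition cQSym :: "nat \<Rightarrow> series set" where
  "cQSym n = {f.
     (\<forall>M. f M \<in> \<int>) \<and>
     (\<forall>M. f M \<noteq> 0 \<longrightarrow> size M = n \<and> (\<forall>i\<in>#M. 1 \<le> i)) \<and>
     (\<forall>is is' ms ms'.
        1 \<le> length ms \<and> length is = length ms \<and> length is' = length ms \<and>
        var_indices is \<and> var_indices is' \<and> (\<forall>m\<in>set ms. 0 < m) \<and> (\<exists>r. ms' = rotate r ms)
        \<longrightarrow> f (power_monomial is ms) = f (power_monomial is' ms'))}"


section \<open>Cyclic shifts of subsets of \<open>[n]\<close>\<close>

text \<open>The representative in \<open>{1..n}\<close> of an integer modulo \<open>n\<close>:\<close>

definition cyc_rep :: "nat \<Rightarrow> int \<Rightarrow> nat" where
  "cyc_rep n i = nat ((i - 1) mod int n) + 1"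

definition cyc_shift :: "nat \<Rightarrow> int \<Rightarrow> nat set \<Rightarrow> nat set" where
  "cyc_shift n i J = (\<lambda>j. cyc_rep n (int j + i)) ` J"

definition cyc_orbit :: "nat \<Rightarrow> nat set \<Rightarrow> nat set set" where
  "cyc_orbit n J = (\<lambda>i. cyc_shift n i J) ` {0..<int n}"

definition cyc_stab_order :: "nat \<Rightarrow> nat set \<Rightarrow> nat" where
  "cyc_stab_order n J = card {i \<in> {0..<int n}. cyc_shift n i J = J}"

definition nonempty_cyc_orbits :: "nat \<Rightarrow> nat set set set" where
  "nonempty_cyc_orbits n = cyc_orbit n ` {J. J \<subseteq> {1..n} \<and> J \<noteq> {}}"


section \<open>Fundamental cyclic quasi-symmetric functions\<close>

text \<open>
  The letter \<open>w\<^sub>j\<close> of a word is \<open>w ! (j - 1)\<close>, and \<open>rotate (k - 1) w\<close> is the word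
  \<open>w\<^sub>k w\<^sub>k\<^sub>+\<^sub>1 \<dots> w\<^sub>n w\<^sub>1 \<dots> w\<^sub>k\<^sub>-\<^sub>1\<close>.
\<close>

definition P_cyc :: "nat \<Rightarrow> nat set \<Rightarrow> (nat list \<times> nat) set" where
  "P_cyc n J = {(w, k).
     length w = n \<and> (\<forall>a\<in>set w. 1 \<le> a) \<and> k \<in> {1..n} \<and>
     sorted (rotate (k - 1) w) \<and>
     (\<forall>j \<in> J - {cyc_rep n (int k - 1)}. w ! (j - 1) < w ! (cyc_rep n (int j + 1) - 1))}"

definition F_cyc :: "nat \<Rightarrow> nat set \<Rightarrow> series" where
  "F_cyc n J M = of_nat (card {(w, k) \<in> P_cyc n J. mset w = M})"

definition F_hat_set :: "nat \<Rightarrow> nat set \<Rightarrow> series" where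
  "F_hat_set n J M = F_cyc n J M / of_nat (cyc_stab_order n J)"

text \<open>Independence of the chosen representative is lemma \<open>F_hat_cyc_orbit\<close> below.\<close>

definition F_hat :: "nat \<Rightarrow> nat set set \<Rightarrow> series" where
  "F_hat n A = F_hat_set n (SOME J. J \<in> A)"

text \<open>
  The integers \<open>c A\<close> are the coefficients of \<open>f\<close> with respect to the functions \<open>F_hat n A\<close>.
  The value of \<open>c\<close> off the index set is fixed to \<open>0\<close> so that uniqueness of the coefficients is
  uniqueness of the function \<open>c\<close>.
\<close>

definition F_hat_expansion :: "nat \<Rightarrow> series \<Rightarrow> (nat set set \<Rightarrow> int) \<Rightarrow> bool" where
  "F_hat_expansion n f c \<longleftrightarrow>
     (\<forall>A. A \<notin> nonempty_cyc_orbits n \<longrightarrow> c A = 0) \<and>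
     f = (\<lambda>M. \<Sum>A\<in>nonempty_cyc_orbits n. of_int (c A) * F_hat n A M)"


section \<open>Skew shapes and skew Schur functions\<close>

text \<open>
  Partitions are weakly decreasing sequences with finitely many nonzero parts. Rows and columns
  are numbered from \<open>0\<close>, rows downwards (English notation).
\<close>

definition is_partition :: "(nat \<Rightarrow> nat) \<Rightarrow> bool" where
  "is_partition lam \<longleftrightarrow> antimono lam \<and> finite {i. lam i \<noteq> 0}"

definition is_skew_shape :: "(nat \<Rightarrow> nat) \<Rightarrow> (nat \<Rightarrow> nat) \<Rightarrow> bool" where
  "is_skew_shape lam mu \<longleftrightarrow> is_partition lam \<and> is_partition mu \<and> (\<forall>i. mu i \<le> lam i)"

definition skew_cells :: "(nat \<Rightarrow> nat) \<Rightarrow> (nat \<Rightarrow> nat) \<Rightarrow> (nat \<times> nat) set" where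
  "skew_cells lam mu = {(i, j). mu i \<le> j \<and> j < lam i}"

definition is_ribbon :: "(nat \<times> nat) set \<Rightarrow> bool" where
  "is_ribbon D \<longleftrightarrow> \<not> (\<exists>i j. {(i, j), (i, Suc j), (Suc i, j), (Suc i, Suc j)} \<subseteq> D)"

definition adjacent_cells :: "nat \<times> nat \<Rightarrow> nat \<times> nat \<Rightarrow> bool" where
  "adjacent_cells c d \<longleftrightarrow>
     (fst c = fst d \<and> (snd d = Suc (snd c) \<or> snd c = Suc (snd d))) \<or>
     (snd c = snd d \<and> (fst d = Suc (fst c) \<or> fst c = Suc (fst d)))"

definition is_connected_shape :: "(nat \<times> nat) set \<Rightarrow> bool" where
  "is_connected_shape D \<longleftrightarrow>
     (\<forall>c\<in>D. \<forall>d\<in>D. (c, d) \<in> {(a, b). a \<in> D \<and> b \<in> D \<and> adjacent_cells a b}\<^sup>*)"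

text \<open>Semistandard tableaux; values outside the shape are fixed by \<open>\<rightarrow>\<^sub>E\<close>.\<close>

definition SSYT :: "(nat \<times> nat) set \<Rightarrow> (nat \<times> nat \<Rightarrow> nat) set" where
  "SSYT D = {T \<in> D \<rightarrow>\<^sub>E {1..}.
     (\<forall>i j j'. (i, j) \<in> D \<and> (i, j') \<in> D \<and> j < j' \<longrightarrow> T (i, j) \<le> T (i, j')) \<and>
     (\<forall>i i' j. (i, j) \<in> D \<and> (i', j) \<in> D \<and> i < i' \<longrightarrow> T (i, j) < T (i', j))}"

definition skew_schur :: "(nat \<Rightarrow> nat) \<Rightarrow> (nat \<Rightarrow> nat) \<Rightarrow> series" where
  "skew_schur lam mu M =
     of_nat (card {T \<in> SSYT (skew_cells lam mu).
                     image_mset T (mset_set (skew_cells lam mu)) = M})"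


section \<open>The normalized functions depend only on the orbit\<close>

lemma cyc_rep_in: "n \<ge> 1 \<Longrightarrow> cyc_rep n i \<in> {1..n}"
proof -
  assume "n \<ge> 1"
  then have "(i - 1) mod int n < int n" "0 \<le> (i - 1) mod int n" by auto
  then show ?thesis unfolding cyc_rep_def by (auto simp: nat_less_iff Suc_le_eq)
qed

lemma int_cyc_rep: "n \<ge> 1 \<Longrightarrow> int (cyc_rep n i) = (i - 1) mod int n + 1"
  unfolding cyc_rep_def by simp

lemma cyc_rep_add: "n \<ge> 1 \<Longrightarrow> cyc_rep n (int (cyc_rep n i) + k) = cyc_rep n (i + k)"
proof -
  assume n: "n \<ge> 1"
  have "(int (cyc_rep n i) + k - 1) mod int n = ((i - 1) mod int n + k) mod int n"
    using int_cyc_rep[OF n] by simp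
  also have "\<dots> = (i + k - 1) mod int n"
    by (simp add: mod_add_left_eq diff_add_eq)
  finally show ?thesis unfolding cyc_rep_def by simp
qed

lemma cyc_rep_diff: "n \<ge> 1 \<Longrightarrow> cyc_rep n (int (cyc_rep n i) - k) = cyc_rep n (i - k)"
  using cyc_rep_add[of n i "- k"] by simp

lemma cyc_rep_id: "j \<in> {1..n} \<Longrightarrow> cyc_rep n (int j) = j"
proof -
  assume j: "j \<in> {1..n}"
  then have "(int j - 1) mod int n = int j - 1" by (intro mod_pos_pos_trivial) auto
  with j show ?thesis unfolding cyc_rep_def by auto
qed

lemma cyc_rep_cong: "i mod int n = i' mod int n \<Longrightarrow> cyc_rep n i = cyc_rep n i'"
  unfolding cyc_rep_def by (metis mod_diff_left_eq)

lemma cyc_shift_shift: "n \<ge> 1 \<Longrightarrow> cyc_shift n a (cyc_shift n b J) = cyc_shift n (a + b) J"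
  unfolding cyc_shift_def by (simp add: image_image cyc_rep_add add.assoc add.commute[of b a])

lemma cyc_shift_0: "J \<subseteq> {1..n} \<Longrightarrow> cyc_shift n 0 J = J"
  unfolding cyc_shift_def using cyc_rep_id by (force simp: image_iff subset_iff)

lemma cyc_shift_subset: "n \<ge> 1 \<Longrightarrow> cyc_shift n i J \<subseteq> {1..n}"
  unfolding cyc_shift_def using cyc_rep_in by blast

lemma cyc_stab_order_shift:
  assumes "n \<ge> 1" "J \<subseteq> {1..n}"
  shows "cyc_stab_order n (cyc_shift n i J) = cyc_stab_order n J"
proof -
  have "cyc_shift n a (cyc_shift n i J) = cyc_shift n i J \<longleftrightarrow> cyc_shift n a J = J" for a
  proof
    assume "cyc_shift n a (cyc_shift n i J) = cyc_shift n i J"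
    then have "cyc_shift n (-i) (cyc_shift n a (cyc_shift n i J)) = cyc_shift n (-i) (cyc_shift n i J)"
      by simp
    then show "cyc_shift n a J = J" using assms by (simp add: cyc_shift_shift cyc_shift_0)
  next
    assume "cyc_shift n a J = J"
    then have "cyc_shift n i (cyc_shift n a J) = cyc_shift n i J" by simp
    then show "cyc_shift n a (cyc_shift n i J) = cyc_shift n i J"
      using assms by (simp add: cyc_shift_shift add.commute)
  qed
  then show ?thesis unfolding cyc_stab_order_def by simp
qed

definition word_shift :: "nat \<Rightarrow> int \<Rightarrow> nat list \<times> nat \<Rightarrow> nat list \<times> nat" where
  "word_shift n i = (\<lambda>(w, k). (map (\<lambda>j. w ! (cyc_rep n (int j + 1 - i) - 1)) [0..<n],
                               cyc_rep n (int k + i)))"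

lemma word_shift_nth:
  assumes "n \<ge> 1"
  shows "map (\<lambda>j. w ! (cyc_rep n (int j + 1 - i) - 1)) [0..<n] ! (cyc_rep n a - 1)
         = w ! (cyc_rep n (a - i) - 1)"
proof -
  from cyc_rep_in[OF assms, of a] have "cyc_rep n a - 1 < n" "int (cyc_rep n a - 1) + 1 = int (cyc_rep n a)"
    by auto
  then show ?thesis using cyc_rep_diff[OF assms, of a i] by simp
qed

lemma rotate_nth_cyc_rep:
  assumes "length w = n" "n \<ge> 1" "m < n" "k \<ge> 1"
  shows "rotate (k - 1) w ! m = w ! (cyc_rep n (int k + int m) - 1)"
proof -
  have "int ((k - 1 + m) mod n) = (int k + int m - 1) mod int n"
    using assms by (simp add: zmod_int of_nat_diff algebra_simps)
  then have "cyc_rep n (int k + int m) - 1 = (k - 1 + m) mod n"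
    unfolding cyc_rep_def by (simp add: nat_eq_iff)
  then show ?thesis using assms by (simp add: nth_rotate)
qed

lemma mset_rotate_word: "mset (rotate m w) = mset w"
proof (induction m)
  case (Suc m)
  have "mset (rotate1 u) = mset u" for u :: "'a list" by (cases u) auto
  with Suc show ?case by simp
qed simp

lemma word_shift_mem:
  assumes n: "n \<ge> 1" and J: "J \<subseteq> {1..n}" and wk: "(w, k) \<in> P_cyc n J"
    and eq: "word_shift n i (w, k) = (w', k')"
  shows "(w', k') \<in> P_cyc n (cyc_shift n i J)" "mset w' = mset w"
    "word_shift n (- i) (w', k') = (w, k)"
proof -
  from wk have len: "length w = n" and pos: "\<forall>a\<in>set w. 1 \<le> a" and k: "k \<in> {1..n}"
    and srt: "sorted (rotate (k - 1) w)"
    and desc: "\<And>j. j \<in> J \<Longrightarrow> j \<noteq> cyc_rep n (int k - 1) \<Longrightarrow>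
                 w ! (j - 1) < w ! (cyc_rep n (int j + 1) - 1)"
    unfolding P_cyc_def by auto
  from eq have w': "w' = map (\<lambda>j. w ! (cyc_rep n (int j + 1 - i) - 1)) [0..<n]"
    and k': "k' = cyc_rep n (int k + i)" unfolding word_shift_def by auto
  have nth: "w' ! (cyc_rep n a - 1) = w ! (cyc_rep n (a - i) - 1)" for a
    unfolding w' by (rule word_shift_nth[OF n])
  have len': "length w' = n" unfolding w' by simp
  have k'_in: "k' \<in> {1..n}" unfolding k' by (rule cyc_rep_in[OF n])
  have rot: "rotate (k' - 1) w' = rotate (k - 1) w"
  proof (rule nth_equalityI)
    show "length (rotate (k' - 1) w') = length (rotate (k - 1) w)" using len len' by simp
    fix m assume "m < length (rotate (k' - 1) w')"
    then have m: "m < n" using len' by simp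
    have "rotate (k' - 1) w' ! m = w' ! (cyc_rep n (int k' + int m) - 1)"
      using rotate_nth_cyc_rep[OF len' n m] k'_in by auto
    also have "\<dots> = w ! (cyc_rep n (int k' + (int m - i)) - 1)" unfolding nth by (simp add: add_diff_eq)
    also have "\<dots> = w ! (cyc_rep n (int k + int m) - 1)"
      unfolding k' cyc_rep_add[OF n] by simp
    also have "\<dots> = rotate (k - 1) w ! m" using rotate_nth_cyc_rep[OF len n m] k by auto
    finally show "rotate (k' - 1) w' ! m = rotate (k - 1) w ! m" .
  qed
  show ms: "mset w' = mset w" using rot by (metis mset_rotate_word)
  have "w' ! (j - 1) < w' ! (cyc_rep n (int j + 1) - 1)"
    if j: "j \<in> cyc_shift n i J" "j \<noteq> cyc_rep n (int k' - 1)" for j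
  proof -
    from j(1) obtain j0 where j0: "j0 \<in> J" and jj: "j = cyc_rep n (int j0 + i)"
      unfolding cyc_shift_def by auto
    have "j0 \<noteq> cyc_rep n (int k - 1)"
    proof
      assume "j0 = cyc_rep n (int k - 1)"
      then have "j = cyc_rep n (int k - 1 + i)" unfolding jj by (simp add: cyc_rep_add[OF n])
      moreover have "cyc_rep n (int k' - 1) = cyc_rep n (int k + i - 1)"
        unfolding k' by (rule cyc_rep_diff[OF n])
      ultimately have "j = cyc_rep n (int k' - 1)" by (simp add: algebra_simps)
      with j(2) show False by simp
    qed
    from desc[OF j0 this] have "w ! (j0 - 1) < w ! (cyc_rep n (int j0 + 1) - 1)" .
    moreover have "w' ! (j - 1) = w ! (j0 - 1)"
      unfolding jj nth using cyc_rep_id[of j0 n] j0 J by auto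
    moreover have "w' ! (cyc_rep n (int j + 1) - 1) = w ! (cyc_rep n (int j0 + 1) - 1)"
      unfolding jj cyc_rep_add[OF n] nth by (simp add: algebra_simps)
    ultimately show ?thesis by simp
  qed
  moreover have "\<forall>a\<in>set w'. 1 \<le> a" using pos ms by (metis set_mset_mset)
  ultimately show "(w', k') \<in> P_cyc n (cyc_shift n i J)"
    unfolding P_cyc_def using len' k'_in srt rot by auto
  have "map (\<lambda>j. w' ! (cyc_rep n (int j + 1 - (- i)) - 1)) [0..<n] = w"
  proof (rule nth_equalityI)
    show "length (map (\<lambda>j. w' ! (cyc_rep n (int j + 1 - (- i)) - 1)) [0..<n]) = length w"
      using len by simp
    fix m assume "m < length (map (\<lambda>j. w' ! (cyc_rep n (int j + 1 - (- i)) - 1)) [0..<n])"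
    then have m: "m < n" by simp
    then have "cyc_rep n (int m + 1) = Suc m" using cyc_rep_id[of "Suc m" n] by (simp add: add.commute)
    with m show "map (\<lambda>j. w' ! (cyc_rep n (int j + 1 - (- i)) - 1)) [0..<n] ! m = w ! m"
      by (simp add: nth[simplified])
  qed
  moreover have "cyc_rep n (int k' + - i) = k"
    unfolding k' cyc_rep_add[OF n] using cyc_rep_id[OF k] by simp
  ultimately show "word_shift n (- i) (w', k') = (w, k)" unfolding word_shift_def by simp
qed

lemma F_cyc_shift:
  assumes n: "n \<ge> 1" and J: "J \<subseteq> {1..n}"
  shows "F_cyc n (cyc_shift n i J) = F_cyc n J"
proof
  fix M
  have J': "cyc_shift n i J \<subseteq> {1..n}" by (rule cyc_shift_subset[OF n])
  have shift_back: "cyc_shift n (- i) (cyc_shift n i J) = J"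
    using n J by (simp add: cyc_shift_shift cyc_shift_0)
  have "bij_betw (word_shift n i) {(w, k) \<in> P_cyc n J. mset w = M}
          {(w, k) \<in> P_cyc n (cyc_shift n i J). mset w = M}"
  proof (rule bij_betw_byWitness[where f' = "word_shift n (- i)"])
    show "\<forall>p\<in>{(w, k) \<in> P_cyc n J. mset w = M}. word_shift n (- i) (word_shift n i p) = p"
      using word_shift_mem(3)[OF n J] by (metis (no_types, lifting) CollectD case_prodE surj_pair)
    show "\<forall>p\<in>{(w, k) \<in> P_cyc n (cyc_shift n i J). mset w = M}.
            word_shift n i (word_shift n (- i) p) = p"
      using word_shift_mem(3)[OF n J', where i = "- i"]
      by (metis (no_types, lifting) CollectD case_prodE surj_pair minus_minus)
    show "word_shift n i ` {(w, k) \<in> P_cyc n J. mset w = M}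
            \<subseteq> {(w, k) \<in> P_cyc n (cyc_shift n i J). mset w = M}"
    proof (rule image_subsetI)
      fix p assume "p \<in> {(w, k) \<in> P_cyc n J. mset w = M}"
      then obtain w k where p: "p = (w, k)" "(w, k) \<in> P_cyc n J" "mset w = M" by auto
      obtain w' k' where "word_shift n i (w, k) = (w', k')" by fastforce
      with word_shift_mem(1,2)[OF n J p(2) this] p
      show "word_shift n i p \<in> {(w, k) \<in> P_cyc n (cyc_shift n i J). mset w = M}" by simp
    qed
    show "word_shift n (- i) ` {(w, k) \<in> P_cyc n (cyc_shift n i J). mset w = M}
            \<subseteq> {(w, k) \<in> P_cyc n J. mset w = M}"
    proof (rule image_subsetI)
      fix p assume "p \<in> {(w, k) \<in> P_cyc n (cyc_shift n i J). mset w = M}"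
      then obtain w k where p: "p = (w, k)" "(w, k) \<in> P_cyc n (cyc_shift n i J)" "mset w = M"
        by auto
      obtain w' k' where "word_shift n (- i) (w, k) = (w', k')" by fastforce
      with word_shift_mem(1,2)[OF n J' p(2) this] p shift_back
      show "word_shift n (- i) p \<in> {(w, k) \<in> P_cyc n J. mset w = M}" by simp
    qed
  qed
  from bij_betw_same_card[OF this] show "F_cyc n (cyc_shift n i J) M = F_cyc n J M"
    unfolding F_cyc_def by simp
qed

lemma F_hat_cyc_orbit:
  assumes n: "n \<ge> 1" and J: "J \<subseteq> {1..n}"
  shows "F_hat n (cyc_orbit n J) = F_hat_set n J"
proof -
  have "J \<in> cyc_orbit n J"
    unfolding cyc_orbit_def using cyc_shift_0[OF J] n by (intro image_eqI[where x = 0]) auto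
  then have "(SOME J'. J' \<in> cyc_orbit n J) \<in> cyc_orbit n J" by (rule someI)
  then obtain i where "(SOME J'. J' \<in> cyc_orbit n J) = cyc_shift n i J"
    unfolding cyc_orbit_def by auto
  then show ?thesis
    unfolding F_hat_def F_hat_set_def
    by (simp add: F_cyc_shift[OF n J] cyc_stab_order_shift[OF n J])
qed

end

theory Submission
  imports Defs "HOL-Library.Function_Algebras"
begin

text \<open>
  Let \<open>D\<close> be the set of cells and colour them by \<open>\<plusminus>1\<close>, constantly on connected components. On the space \<open>V\<close> of
  functions on the linear extensions of \<open>D\<close>, Young's seminormal operators \<open>S\<^sub>1, \<dots>, S\<^bsub>n-1\<^esub>\<close> together with the
  operator \<open>X\<close> multiplying by the colour of the first cell give \<open>\<omega> = X S\<^sub>1 \<cdots> S\<^bsub>n-1\<^esub>\<close>, which permutes cyclically the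
  fixed spaces \<open>U\<^sub>1, \<dots>, U\<^bsub>n-1\<^esub>\<close> of the \<open>S\<^sub>i\<close> and one further space \<open>U\<^sub>n\<close>. For nonempty \<open>I \<subseteq> [n]\<close> let \<open>W(I)\<close> be the intersection of
  the \<open>U\<^sub>i\<close> with \<open>i \<notin> I\<close>. If \<open>n \<in> I\<close>, its dimension is the number of linear extensions with descent set in \<open>I\<close>, which is
  the coefficient of the skew Schur function at a monomial whose exponents have the partial sums \<open>I\<close>; by \<open>\<omega>\<close>
  the dimension is invariant under cyclic shifts of \<open>I\<close>.

  Let \<open>u(J)\<close> be the codimension in \<open>W(J)\<close> of the sum of the \<open>W(J')\<close> over nonempty \<open>J' \<subset> J\<close>. If the sum of \<open>u(J)\<close> over
  nonempty \<open>J \<subseteq> I\<close> is always \<open>dim W(I)\<close>, then the \<open>u(J)\<close> are the coefficients of the expansion, and they are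
  dimensions. The required identity is an exactness property of the subspaces \<open>W(J)\<close>. It holds for the
  \<open>2 \<times> 2\<close> square and for two cells of different colours, one of which is available unless \<open>D\<close> is a connected ribbon.
  It passes from \<open>D\<close> to the poset with an added isolated cell (an induced module), and from there to \<open>D\<close> with an added
  maximal cell, whose module is a direct summand of the induced one. Reversing linear extensions treats
  minimal cells, and \<open>D\<close> is built up from the square or the pair by adding maximal and minimal cells.
\<close>

section \<open>Finite-dimensional spaces of functions\<close>

text \<open>The operators \<open>S i\<close> and \<open>X 1\<close> satisfy the relations of the
  hyperoctahedral group, and \<open>om\<close> is its Coxeter element: conjugation by it takes
  \<open>S i\<close> to \<open>S (i + 1)\<close>, and takes the conjugate of
  \<open>S (n - 1)\<close> on to \<open>S 1\<close>. This is the origin of \<open>U n\<close> and of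
  the cyclic symmetry. Colours matter: two incomparable cells of one colour give
  \<open>U 1 = U 2\<close>, opposite colours make these two lines complementary.

  Moebius inversion of \<open>dim (Inv I)\<close> gives integers of no evident sign, which is why
  they are realized as codimensions. As long as \<open>n \<in> I\<close>, all \<open>Inv I\<close>
  are spanned by subsets of one basis, and sums of them can be counted. This yields a lower bound
  for \<open>new_dim J + new_dim (J - {n})\<close> by the number of linear extensions with descent
  set \<open>J - {n}\<close>. The obstacle is \<open>Inv (J - {n})\<close>, which is not adapted to
  that basis. Equality in the bound is what fails for connected ribbons (a row of two cells has
  \<open>U 1 = U 2 = V\<close>) and what has to be carried from shape to shape.\<close>

instantiation "fun" :: (type, real_vector) real_vector
begin

definition "scaleR r f = (\<lambda>x. scaleR r (f x))"

instance
  by standard (simp_all add: scaleR_fun_def fun_eq_iff algebra_simps)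

end

lemma scaleR_fun_apply [simp]: "(scaleR r f) x = scaleR r (f x)"
  by (simp add: scaleR_fun_def)

lemma sum_fun_apply: "(\<Sum>i\<in>A. f i) x = (\<Sum>i\<in>A. f i x)"
  by (induction A rule: infinite_finite_induct) auto

text \<open>The space of all functions on lists is infinite-dimensional, and \<open>dim\<close> has
  a junk value on sets with an infinite basis. Dimension arguments therefore carry finiteness as a
  hypothesis.\<close>

definition fin_dim :: "'a::real_vector set \<Rightarrow> bool" where
  "fin_dim S \<longleftrightarrow> (\<exists>B. finite B \<and> S \<subseteq> span B)"

lemma fin_dim_mono: "fin_dim T \<Longrightarrow> S \<subseteq> T \<Longrightarrow> fin_dim S"
  unfolding fin_dim_def by blast

lemma fin_dim_independent:
  assumes "fin_dim S" "B \<subseteq> S" "independent B"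
  shows "finite B" "card B \<le> dim S"
proof -
  from assms(1) obtain F where F: "finite F" "S \<subseteq> span F"
    unfolding fin_dim_def by blast
  show fB: "finite B"
    using independent_span_bound[OF F(1) assms(3)] assms(2) F(2) by blast
  obtain C where C: "B \<subseteq> C" "C \<subseteq> S" "independent C" "S \<subseteq> span C"
    using maximal_independent_subset_extend[OF assms(2,3)] by blast
  have "finite C"
    using independent_span_bound[OF F(1) C(3)] C(2) F(2) by blast
  then have "card B \<le> card C"
    using C(1) by (rule card_mono)
  also have "card C = dim S"
    using basis_card_eq_dim C by blast
  finally show "card B \<le> dim S" .
qed

lemma fin_dim_dim_mono:
  assumes "fin_dim T" "S \<subseteq> T"
  shows "dim S \<le> dim T"
proof -
  obtain B where B: "B \<subseteq> S" "independent B" "S \<subseteq> span B" "card B = dim S"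
    using basis_exists by blast
  have "card B \<le> dim T"
    using fin_dim_independent[OF assms(1) _ B(2)] B(1) assms(2) by blast
  with B(4) show ?thesis by simp
qed

lemma fin_dim_subspace_eq:
  assumes "fin_dim T" "S \<subseteq> T" "subspace S" "dim T \<le> dim S"
  shows "S = T"
proof -
  obtain B where B: "B \<subseteq> S" "independent B" "S \<subseteq> span B" "card B = dim S"
    using basis_exists by blast
  obtain C where C: "B \<subseteq> C" "C \<subseteq> T" "independent C" "T \<subseteq> span C"
    using maximal_independent_subset_extend[of B T] B assms(2) by blast
  have fC: "finite C" "card C \<le> dim T"
    using fin_dim_independent[OF assms(1) C(2,3)] by auto
  then have "B = C"
    using C(1) B(4) assms(4) card_mono[OF fC(1) C(1)] by (intro card_subset_eq[OF fC(1)]) auto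
  then have "T \<subseteq> span S"
    using C(4) B(1) span_mono by blast
  then show ?thesis
    using assms(2,3) span_eq_iff by blast
qed

lemma independent_disjoint_Un:
  assumes "independent C" "finite D" "independent D" "span C \<inter> span D \<subseteq> {0}"
  shows "independent (C \<union> D)" "C \<inter> D = {}"
proof -
  have 0: "0 \<notin> D" using assms(3) dependent_zero by blast
  show "C \<inter> D = {}"
    using assms(4) 0 span_base by blast
  have "independent (C \<union> F)" if "F \<subseteq> D" for F
    using finite_subset[OF that assms(2)] that
  proof (induction F rule: finite_induct)
    case (insert d F)
    have "d \<notin> span (C \<union> F)"
    proof
      assume "d \<in> span (C \<union> F)"
      then obtain c f where cf: "d = c + f" "c \<in> span C" "f \<in> span F"
        unfolding span_Un by blast
      have "d \<in> span D" using insert.prems by (intro span_base) simp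
      moreover have "f \<in> span D" using cf(3) insert.prems span_mono[of F D] by auto
      ultimately have "d - f \<in> span D" by (rule span_diff)
      then have "c \<in> span D" using cf(1) by simp
      then have "c = 0" using cf(2) assms(4) by blast
      then have "d = f" using cf(1) by simp
      moreover have "span F \<subseteq> span (D - {d})"
        using insert.hyps(2) insert.prems by (intro span_mono) auto
      ultimately have "d \<in> span (D - {d})" using cf(3) by blast
      then show False
        using assms(3) insert.prems unfolding dependent_def by blast
    qed
    moreover have "independent (C \<union> F)" using insert by blast
    ultimately show ?case
      by (simp add: independent_insert)
  qed (use assms in simp)
  then show "independent (C \<union> D)" by blast
qed

text \<open>Grassmann's formula. A basis \<open>D\<close> of \<open>T\<close> is chosen to extend a
  basis \<open>B\<close> of the intersection; then \<open>D - B\<close> completes a basis of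
  \<open>S\<close> to one of the span of the union.\<close>

lemma dim_span_Un_Int:
  assumes "fin_dim S" "fin_dim T" "subspace S" "subspace T"
  shows "dim (span (S \<union> T)) + dim (S \<inter> T) = dim S + dim T"
proof -
  obtain B where B: "B \<subseteq> S \<inter> T" "independent B" "S \<inter> T \<subseteq> span B" "card B = dim (S \<inter> T)"
    using basis_exists by blast
  obtain D where D: "B \<subseteq> D" "D \<subseteq> T" "independent D" "T \<subseteq> span D"
    using maximal_independent_subset_extend[of B T] B by blast
  obtain C where C: "C \<subseteq> S" "independent C" "S \<subseteq> span C" "card C = dim S"
    using basis_exists by blast
  have fin: "finite D" "finite C"
    using fin_dim_independent(1)[OF assms(2) D(2,3)] fin_dim_independent(1)[OF assms(1) C(1,2)] by auto
  have finB: "finite B" using finite_subset[OF D(1) fin(1)] .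
  have sC: "span C = S"
    using C assms(3) by (metis span_eq_iff span_mono subset_antisym)
  have "span C \<inter> span (D - B) \<subseteq> {0}"
  proof
    fix x assume x: "x \<in> span C \<inter> span (D - B)"
    have "x \<in> T"
      using x D(2) assms(4) by (metis Diff_subset IntD2 span_eq_iff span_mono subsetD subset_trans)
    with x sC B(3) have "x \<in> span B" by blast
    then obtain u where u: "x = (\<Sum>v\<in>B. u v *\<^sub>R v)"
      using span_finite[OF finB] by auto
    obtain w where w: "x = (\<Sum>v\<in>D - B. w v *\<^sub>R v)"
      using x span_finite[of "D - B"] fin by auto
    \<comment> \<open>The two expressions of \<open>x\<close>, over \<open>B\<close> and over
      \<open>D - B\<close>, are joined into one linear relation on the independent set
      \<open>D\<close>.\<close>
    define c where "c v = (if v \<in> B then u v else - w v)" for v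
    have "(\<Sum>v\<in>D. c v *\<^sub>R v) = (\<Sum>v\<in>D - B. c v *\<^sub>R v) + (\<Sum>v\<in>B. c v *\<^sub>R v)"
      using sum.subset_diff[OF D(1) fin(1)] .
    also have "(\<Sum>v\<in>B. c v *\<^sub>R v) = x"
      unfolding u by (intro sum.cong) (auto simp: c_def)
    also have "(\<Sum>v\<in>D - B. c v *\<^sub>R v) = - x"
      unfolding w by (subst sum_negf[symmetric], intro sum.cong) (auto simp: c_def)
    finally have "(\<Sum>v\<in>D. c v *\<^sub>R v) = 0" by simp
    then have "\<forall>v\<in>D. c v = 0"
      using D(3) fin(1) independentD by blast
    then have "\<forall>v\<in>B. u v = 0"
      using D(1) unfolding c_def by (metis subsetD)
    then show "x \<in> {0}" unfolding u by simp
  qed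
  moreover have "independent (D - B)"
    using D(3) by (rule independent_mono) blast
  ultimately have CD: "independent (C \<union> (D - B))" "C \<inter> (D - B) = {}"
    using independent_disjoint_Un[of C "D - B"] C(2) fin by auto
  have "span (S \<union> T) \<subseteq> span (C \<union> (D - B))"
  proof (rule span_minimal)
    have "B \<subseteq> span (C \<union> (D - B))"
      using B(1) sC span_mono[of C "C \<union> (D - B)"] by blast
    then have "D \<subseteq> span (C \<union> (D - B))"
      using span_superset[of "C \<union> (D - B)"] by blast
    then have "T \<subseteq> span (C \<union> (D - B))"
      using D(4) span_minimal[OF _ subspace_span] by blast
    moreover have "S \<subseteq> span (C \<union> (D - B))"
      using sC span_mono[of C "C \<union> (D - B)"] by blast
    ultimately show "S \<union> T \<subseteq> span (C \<union> (D - B))" by blast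
  qed simp
  moreover have "C \<union> (D - B) \<subseteq> span (S \<union> T)"
    using C(1) D(2) span_superset[of "S \<union> T"] by blast
  ultimately have "dim (span (S \<union> T)) = card (C \<union> (D - B))"
    using dim_unique[OF _ _ CD(1) refl] by blast
  also have "\<dots> = card C + (card D - card B)"
    using fin finB CD(2) D(1) by (simp add: card_Un_disjoint card_Diff_subset)
  finally show ?thesis
    using C(4) B(4) basis_card_eq_dim[OF D(2,4,3)] card_mono[OF fin(1) D(1)] by simp
qed

lemma fin_dim_span: "fin_dim S \<Longrightarrow> fin_dim (span S)"
  unfolding fin_dim_def by (meson span_minimal subspace_span)

lemma fin_dim_finite: "finite S \<Longrightarrow> fin_dim S"
  unfolding fin_dim_def using span_superset by blast

lemma fin_dim_Un:
  assumes "fin_dim S" "fin_dim T"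
  shows "fin_dim (S \<union> T)"
proof -
  obtain A B where "finite A" "S \<subseteq> span A" "finite B" "T \<subseteq> span B"
    using assms unfolding fin_dim_def by blast
  moreover have "span A \<subseteq> span (A \<union> B)" "span B \<subseteq> span (A \<union> B)"
    by (simp_all add: span_mono)
  ultimately show ?thesis
    unfolding fin_dim_def by (intro exI[of _ "A \<union> B"]) auto
qed

lemma span_Un_span: "span (span S \<union> span T) = span (S \<union> T)"
  unfolding span_Un span_span ..

lemma dim_span_Un_le:
  assumes "fin_dim S" "fin_dim T"
  shows "dim (span (S \<union> T)) \<le> dim S + dim T"
  using dim_span_Un_Int[OF fin_dim_span[OF assms(1)] fin_dim_span[OF assms(2)]]
  unfolding span_Un_span by simp

lemma dim_zero [simp]: "dim {0::'a::real_vector} = 0"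
  by (rule dim_unique[of "{}"]) (auto simp: span_empty independent_empty)

lemma fin_dim_dim_image_eq:
  assumes "linear f" "fin_dim S" "subspace S" "\<And>x. x \<in> S \<Longrightarrow> f x = 0 \<Longrightarrow> x = 0"
  shows "dim (f ` S) = dim S"
proof -
  obtain B where B: "B \<subseteq> S" "independent B" "S \<subseteq> span B" "card B = dim S"
    using basis_exists by blast
  have sB: "span B = S"
    using B(1,3) assms(3) by (metis span_eq_iff span_mono subset_antisym)
  have inj: "inj_on f S"
    unfolding inj_on_def
    by (metis assms(1,3,4) eq_iff_diff_eq_0 linear_diff subspace_diff)
  have "independent (f ` B)"
    using linear_independent_injective_image[OF assms(1) B(2)] inj sB by simp
  moreover have "f ` S \<subseteq> span (f ` B)" using B(3) linear_span_image[OF assms(1)] by blast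
  ultimately have "dim (f ` S) = card (f ` B)"
    using B(1) by (intro dim_unique) auto
  also have "\<dots> = card B" using inj B(1) by (intro card_image) (rule inj_on_subset)
  finally show ?thesis using B(4) by simp
qed

text \<open>In this form \<open>new_dim X\<close> supplies generators of \<open>Inv X\<close> modulo
  \<open>Merged X\<close>, from which generators for the extended system are built.\<close>

lemma dim_span_complement:
  assumes "fin_dim V" "subspace V" "Z \<subseteq> V"
  obtains R where "R \<subseteq> V" "finite R" "V \<subseteq> span (Z \<union> R)" "card R + dim (span Z) = dim V"
proof -
  obtain B where B: "B \<subseteq> span Z" "independent B" "span Z \<subseteq> span B" "card B = dim (span Z)"
    using basis_exists by blast
  have ZV: "span Z \<subseteq> V" using assms by (simp add: span_minimal)
  obtain C where C: "B \<subseteq> C" "C \<subseteq> V" "independent C" "V \<subseteq> span C"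
    using maximal_independent_subset_extend[of B V] B ZV by blast
  have fC: "finite C" using fin_dim_independent[OF assms(1)] C by blast
  have "C \<subseteq> span (Z \<union> (C - B))"
  proof -
    have "B \<subseteq> span (Z \<union> (C - B))" using B(1) span_mono[of Z "Z \<union> (C - B)"] by blast
    then show ?thesis using span_superset[of "Z \<union> (C - B)"] by blast
  qed
  then have "V \<subseteq> span (Z \<union> (C - B))" using C(4) span_minimal[OF _ subspace_span] by blast
  moreover have "card (C - B) + dim (span Z) = dim V"
    using fC C(1) B(4) basis_card_eq_dim[OF C(2,4,3)] card_mono[OF fC C(1)]
    by (simp add: card_Diff_subset finite_subset)
  ultimately show ?thesis using that[of "C - B"] C(2) fC by blast
qed

section \<open>Seminormal representations with a cyclic rotation\<close>

lemma cyc_shift_nonempty [simp]: "cyc_shift m k I = {} \<longleftrightarrow> I = {}"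
  unfolding cyc_shift_def by simp

definition swp :: "nat \<Rightarrow> 'c list \<Rightarrow> 'c list" where
  "swp i t = t[i - 1 := t ! i, i := t ! (i - 1)]"

lemma swp_append [simp]: "swp (Suc (length u)) (u @ a # b # w) = u @ b # a # w"
  by (simp add: swp_def list_update_append nth_append)

lemma split_at_pair:
  assumes "1 \<le> i" "i < length t"
  obtains u a b w where "t = u @ a # b # w" "i = Suc (length u)"
proof -
  have "t = take (i - 1) t @ t ! (i - 1) # t ! i # drop (Suc i) t"
    using assms by (metis Cons_nth_drop_Suc Suc_diff_1 append_take_drop_id less_imp_diff_less less_le_trans zero_less_one)
  moreover have "i = Suc (length (take (i - 1) t))" using assms by simp
  ultimately show ?thesis using that by blast
qed

text \<open>
  Linear extensions of a poset \<open>D\<close> with order \<open>R\<close> index a basis. In the intended model \<open>rho a b\<close> is the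
  inverse of the difference of contents of \<open>b\<close> and \<open>a\<close>, cut off to \<open>0\<close> when the colours \<open>eps\<close> differ,
  \<open>S i\<close> is then Young's seminormal action of an adjacent transposition on an induced module, and \<open>key\<close>
  is the labelling that defines descents. List positions start at \<open>0\<close>, but \<open>S i\<close> and \<open>X i\<close> count from \<open>1\<close>.
\<close>

locale lsys =
  fixes D :: "'c set"
    and R :: "'c \<Rightarrow> 'c \<Rightarrow> bool"
    and rho :: "'c \<Rightarrow> 'c \<Rightarrow> real"
    and key :: "'c \<Rightarrow> int"
    and eps :: "'c \<Rightarrow> real"
begin

definition L :: "'c list set" where
  "L = {t. distinct t \<and> set t = D \<and> sorted_wrt (\<lambda>a b. \<not> R b a) t}"

abbreviation n :: nat where "n \<equiv> card D"

definition V :: "('c list \<Rightarrow> real) set" where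
  "V = {v. \<forall>t. t \<notin> L \<longrightarrow> v t = 0}"

definition S :: "nat \<Rightarrow> ('c list \<Rightarrow> real) \<Rightarrow> 'c list \<Rightarrow> real" where
  "S i v t = (if t \<in> L
     then rho (t ! (i - 1)) (t ! i) * v t + (1 - rho (t ! (i - 1)) (t ! i)) * v (swp i t)
     else 0)"

definition X :: "nat \<Rightarrow> ('c list \<Rightarrow> real) \<Rightarrow> 'c list \<Rightarrow> real" where
  "X i v t = eps (t ! (i - 1)) * v t"

definition cox :: "('c list \<Rightarrow> real) \<Rightarrow> 'c list \<Rightarrow> real" where
  "cox = foldr S [1..<n]"

definition om :: "('c list \<Rightarrow> real) \<Rightarrow> 'c list \<Rightarrow> real" where
  "om v = X 1 (cox v)"

definition U :: "nat \<Rightarrow> ('c list \<Rightarrow> real) set" where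
  "U i = (if i < n then {v \<in> V. S i v = v} else om ` {v \<in> V. S (n - 1) v = v})"

definition Inv :: "nat set \<Rightarrow> ('c list \<Rightarrow> real) set" where
  "Inv I = {v \<in> V. \<forall>i\<in>{1..n} - I. v \<in> U i}"

end

text \<open>\<open>rho_rel\<close> is \<open>1/x * 1/y = 1/(x + y) * (1/x + 1/y)\<close> for
  differences of contents and gives the braid relation; for mixed colours at least two of the three
  values vanish. \<open>rho_R\<close> treats consecutive comparable cells, whose exchange is not in
  \<open>L\<close>. \<open>rho_less\<close> makes the coefficients of admissible swaps positive, and
  \<open>rho_eps\<close> lets \<open>S i\<close> exchange \<open>X i\<close> and
  \<open>X (Suc i)\<close>.\<close>

locale lin_sys = lsys D R rho key eps
  for D :: "'c set" and R rho key and eps :: "'c \<Rightarrow> real" +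
  assumes finite_D: "finite D"
    and inj_key: "inj_on key D"
    and R_irrefl: "\<not> R a a"
    and rho_R: "u @ a # b # w \<in> L \<Longrightarrow> R a b \<Longrightarrow> rho a b = (if key a < key b then 1 else - 1)"
    and rho_less: "a \<in> D \<Longrightarrow> b \<in> D \<Longrightarrow> \<not> R a b \<Longrightarrow> \<not> R b a \<Longrightarrow> \<bar>rho a b\<bar> < 1"
    and rho_antisym: "rho b a = - rho a b"
    and rho_rel: "u @ a # b # c # w \<in> L \<Longrightarrow> rho a b * rho b c = rho a c * (rho a b + rho b c)"
    and rho_eps: "u @ a # b # w \<in> L \<Longrightarrow> eps a \<noteq> eps b \<Longrightarrow> rho a b = 0"
    and eps_sq: "eps a * eps a = 1"
begin

lemma length_L: "t \<in> L \<Longrightarrow> length t = n"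
  unfolding L_def by (auto simp: distinct_card)

lemma finite_L: "finite L"
  by (rule finite_subset[OF _ finite_lists_length_eq[OF finite_D, of n]])
    (auto simp: length_L, auto simp: L_def)

lemma L_swap: "u @ a # b # w \<in> L \<Longrightarrow> u @ b # a # w \<in> L \<longleftrightarrow> \<not> R a b"
  unfolding L_def by (auto simp: sorted_wrt_append)

lemma L_pair_not_R: "u @ a # b # w \<in> L \<Longrightarrow> \<not> R b a"
  unfolding L_def by (auto simp: sorted_wrt_append)

lemma L_pair_in_D: "u @ a # b # w \<in> L \<Longrightarrow> a \<in> D \<and> b \<in> D \<and> a \<noteq> b"
  unfolding L_def by auto

lemma S_append: "u @ a # b # w \<in> L \<Longrightarrow>
   S (Suc (length u)) v (u @ a # b # w) = rho a b * v (u @ a # b # w) + (1 - rho a b) * v (u @ b # a # w)"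
  unfolding S_def by (simp add: nth_append)

lemma S_outside: "t \<notin> L \<Longrightarrow> S i v t = 0"
  unfolding S_def by simp

lemma V_outside: "v \<in> V \<Longrightarrow> t \<notin> L \<Longrightarrow> v t = 0"
  unfolding V_def by simp

lemma S_in_V [simp]: "S i v \<in> V"
  unfolding V_def S_def by simp

lemma split_L:
  assumes "t \<in> L" "1 \<le> i" "i < n"
  obtains u a b w where "t = u @ a # b # w" "i = Suc (length u)"
  using split_at_pair assms length_L by metis

lemma linear_S: "linear (S i)"
  by (rule linearI) (auto simp: S_def fun_eq_iff algebra_simps)

lemma linear_X: "linear (X i)"
  by (rule linearI) (auto simp: X_def fun_eq_iff algebra_simps)

lemma X_in_V [simp]: "v \<in> V \<Longrightarrow> X i v \<in> V"
  unfolding V_def X_def by simp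

lemma subspace_V: "subspace V"
  unfolding V_def by (intro subspaceI) auto

lemma fin_dim_V: "fin_dim V"
proof -
  have "v \<in> span ((\<lambda>t s. if s = t then 1 else 0) ` L)" if "v \<in> V" for v
  proof -
    have "v = (\<Sum>t\<in>L. v t *\<^sub>R (\<lambda>s. if s = t then 1 else 0))"
      using that finite_L by (auto simp: V_def fun_eq_iff sum_fun_apply if_distrib cong: if_cong)
    also have "\<dots> \<in> span ((\<lambda>t s. if s = t then 1 else 0) ` L)"
      by (intro span_sum span_scale span_base imageI)
    finally show ?thesis .
  qed
  then show ?thesis unfolding fin_dim_def using finite_L by blast
qed

lemma rho_neq_1: "u @ a # b # w \<in> L \<Longrightarrow> u @ b # a # w \<in> L \<Longrightarrow> \<bar>rho a b\<bar> < 1"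
  using L_swap L_pair_not_R L_pair_in_D rho_less by metis

lemma rho_cases: "u @ a # b # w \<in> L \<Longrightarrow> u @ b # a # w \<notin> L \<Longrightarrow> rho a b = 1 \<or> rho a b = - 1"
  using L_swap rho_R by metis

lemma rho_R_cases: "u @ a # b # w \<in> L \<Longrightarrow> R a b \<Longrightarrow> rho a b = 1 \<or> rho a b = - 1"
  by (simp add: rho_R)

lemma S_invol:
  assumes "v \<in> V" "1 \<le> i" "i < n"
  shows "S i (S i v) = v"
proof
  fix t
  show "S i (S i v) t = v t"
  proof (cases "t \<in> L")
    case True
    then obtain u a b w where t: "t = u @ a # b # w" and i: "i = Suc (length u)"
      using split_L assms by metis
    note T = True[unfolded t]
    show ?thesis
    proof (cases "u @ b # a # w \<in> L")
      case True
      show ?thesis unfolding t i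
        by (simp add: S_append[OF T] S_append[OF True] rho_antisym[of b a]) (simp add: algebra_simps)
    next
      case False
      then show ?thesis unfolding t i
        using rho_cases[OF T False] V_outside[OF assms(1) False]
        by (auto simp: S_append[OF T] S_outside)
    qed
  next
    case False
    then show ?thesis by (simp add: S_outside V_outside[OF assms(1)])
  qed
qed

section \<open>Relations among the operators \<open>S i\<close> and \<open>X i\<close>\<close>

lemma S_comm:
  assumes "v \<in> V" "1 \<le> i" "Suc i < j" "j < n"
  shows "S i (S j v) = S j (S i v)"
proof
  fix t
  show "S i (S j v) t = S j (S i v) t"
  proof (cases "t \<in> L")
    case True
    then obtain u a b w where t: "t = u @ a # b # w" and i: "i = Suc (length u)"
      using split_L assms by (metis less_imp_le_nat less_trans Suc_lessD)
    have "1 \<le> j - Suc i" "j - Suc i < length w"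
      using assms length_L[OF True] unfolding t i by auto
    then obtain x c d y where w: "w = x @ c # d # y" and j: "j - Suc i = Suc (length x)"
      using split_at_pair by metis
    define m where "m = (\<lambda>p q. u @ p @ x @ q @ y)"
    have j': "j = Suc (length (u @ p # q # x))" for p q
      using j assms(3) i by simp
    have eq1: "S i f (u @ p # q # x @ z # z' # y) = rho p q * f (u @ p # q # x @ z # z' # y) + (1 - rho p q) * f (u @ q # p # x @ z # z' # y)"
      if "u @ p # q # x @ z # z' # y \<in> L" for f p q z z'
      using S_append[OF that] i by simp
    have eq2: "S j f (u @ p # q # x @ z # z' # y) = rho z z' * f (u @ p # q # x @ z # z' # y) + (1 - rho z z') * f (u @ p # q # x @ z' # z # y)"
      if "u @ p # q # x @ z # z' # y \<in> L" for f p q z z'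
      using S_append[of "u @ p # q # x" z z' y] that j'[of p q] by simp
    have T: "u @ a # b # x @ c # d # y \<in> L" using True unfolding t w by simp
    have s1: "u @ b # a # x @ c # d # y \<in> L \<longleftrightarrow> \<not> R a b" using L_swap[OF T] .
    have s2: "u @ a # b # x @ d # c # y \<in> L \<longleftrightarrow> \<not> R c d"
      using L_swap[of "u @ a # b # x" c d y] T by simp
    have "u @ b # a # x @ d # c # y \<in> L \<Longrightarrow> \<not> R a b \<and> \<not> R c d"
      using T unfolding L_def by (auto simp: sorted_wrt_append)
    then have s3: "v (u @ b # a # x @ d # c # y) = 0" if "R a b \<or> R c d"
      using that V_outside[OF assms(1)] by blast
    show ?thesis unfolding t w
      using V_outside[OF assms(1)] s1 s2 s3
      by (cases "R a b"; cases "R c d") (auto simp: eq1 eq2 T S_outside algebra_simps)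
  qed (simp add: S_outside)
qed

text \<open>At a list with entries \<open>a\<close>, \<open>b\<close>, \<open>c\<close> in the three
  positions this is a polynomial identity in the values of \<open>v\<close> at the six reorderings,
  a consequence of \<open>rho_rel\<close>. The seven cases record which reorderings stay in
  \<open>L\<close>; the others contribute 0, and there \<open>rho\<close> is 1 or -1.\<close>

lemma S_braid:
  assumes "v \<in> V" "1 \<le> i" "Suc i < n"
  shows "S i (S (Suc i) (S i v)) = S (Suc i) (S i (S (Suc i) v))"
proof
  fix t
  show "S i (S (Suc i) (S i v)) t = S (Suc i) (S i (S (Suc i) v)) t"
  proof (cases "t \<in> L")
    case True
    then obtain u a b w' where t: "t = u @ a # b # w'" and i: "i = Suc (length u)"
      using split_L assms by (metis Suc_lessD)
    have "w' \<noteq> []" using assms length_L[OF True] unfolding t i by auto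
    then obtain c w where w: "w' = c # w" by (meson neq_Nil_conv)
    define l where "l p q r = u @ p # q # r # w" for p q r
    have T: "l a b c \<in> L" using True unfolding t w l_def by simp
    have eq1: "S i f (l p q r) = rho p q * f (l p q r) + (1 - rho p q) * f (l q p r)"
      if "l p q r \<in> L" for f p q r
      using S_append[of u p q "r # w"] that i unfolding l_def by simp
    have eq2: "S (Suc i) f (l p q r) = rho q r * f (l p q r) + (1 - rho q r) * f (l p r q)"
      if "l p q r \<in> L" for f p q r
      using S_append[of "u @ [p]" q r w] that i unfolding l_def by simp
    have nR: "\<not> R b a" "\<not> R c b" "\<not> R c a"
      using T unfolding L_def l_def by (auto simp: sorted_wrt_append)
    have mem: "l b a c \<in> L \<longleftrightarrow> \<not> R a b" "l a c b \<in> L \<longleftrightarrow> \<not> R b c"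
      "l b c a \<in> L \<longleftrightarrow> \<not> R a b \<and> \<not> R a c" "l c a b \<in> L \<longleftrightarrow> \<not> R b c \<and> \<not> R a c"
      "l c b a \<in> L \<longleftrightarrow> \<not> R a b \<and> \<not> R b c \<and> \<not> R a c"
      using T unfolding L_def l_def by (auto simp: sorted_wrt_append)
    define P where "P p q r = v (l p q r)" for p q r
    have out: "P b a c = 0" if "R a b" using that mem V_outside[OF assms(1)] unfolding P_def by blast
    have out2: "P a c b = 0" if "R b c" using that mem V_outside[OF assms(1)] unfolding P_def by blast
    have out3: "P b c a = 0" if "R a b \<or> R a c" using that mem V_outside[OF assms(1)] unfolding P_def by blast
    have out4: "P c a b = 0" if "R b c \<or> R a c" using that mem V_outside[OF assms(1)] unfolding P_def by blast
    have out5: "P c b a = 0" if "R a b \<or> R b c \<or> R a c" using that mem V_outside[OF assms(1)] unfolding P_def by blast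
    note outs = out out2 out3 out4 out5
    have r1: "rho a b = 1 \<or> rho a b = - 1" if "R a b"
      using rho_R_cases[of u a b "c # w"] T that unfolding l_def by auto
    have r2: "rho b c = 1 \<or> rho b c = - 1" if "R b c"
      using rho_R_cases[of "u @ [a]" b c w] T that unfolding l_def by auto
    have r3: "rho a c = 1 \<or> rho a c = - 1" if "R a c" "\<not> R a b \<or> \<not> R b c"
      using rho_R_cases[of "u @ [b]" a c w] rho_R_cases[of u a c "b # w"] mem that unfolding l_def by auto
    have rel: "rho a b * rho b c = rho a c * (rho a b + rho b c)"
      using rho_rel[of u a b c w] T unfolding l_def by simp
    have as: "rho b a = - rho a b" "rho c b = - rho b c" "rho c a = - rho a c"
      by (rule rho_antisym)+
    note eqs = eq1 eq2 mem T S_outside P_def[symmetric] as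
    have tl: "t = l a b c" unfolding t w l_def ..
    consider "R a b" "R b c" | "R a b" "\<not> R b c" "R a c" | "R a b" "\<not> R b c" "\<not> R a c"
      | "\<not> R a b" "R b c" "R a c" | "\<not> R a b" "R b c" "\<not> R a c"
      | "\<not> R a b" "\<not> R b c" "R a c" | "\<not> R a b" "\<not> R b c" "\<not> R a c" by blast
    then show ?thesis
    proof cases
      case 1
      then show ?thesis using outs r1 r2 rel unfolding tl
        by (auto simp: eqs)
    next
      case 2
      with outs r1 r3 rel show ?thesis unfolding tl by (simp add: eqs) algebra
    next
      case 3
      with outs r1 rel show ?thesis unfolding tl by (simp add: eqs) algebra
    next
      case 4
      with outs r2 r3 rel show ?thesis unfolding tl by (simp add: eqs) algebra
    next
      case 5
      with outs r2 rel show ?thesis unfolding tl by (simp add: eqs) algebra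
    next
      case 6
      with outs r3 rel show ?thesis unfolding tl by (simp add: eqs) algebra
    next
      case 7
      with rel show ?thesis unfolding tl by (simp add: eqs) algebra
    qed
  qed (simp add: S_outside)
qed

text \<open>Either the two entries have equal colours, and both factors agree on the list and its
  swap, or \<open>rho\<close> vanishes and \<open>S i\<close> is a bare exchange of positions, which
  carries the colour along.\<close>

lemma S_X:
  assumes "v \<in> V" "1 \<le> i" "i < n"
  shows "S i (X (Suc i) v) = X i (S i v)" "S i (X i v) = X (Suc i) (S i v)"
proof -
  have "S i (X (Suc i) v) t = X i (S i v) t \<and> S i (X i v) t = X (Suc i) (S i v) t" for t
  proof (cases "t \<in> L")
    case True
    then obtain u a b w where t: "t = u @ a # b # w" and i: "i = Suc (length u)"
      using split_L assms by metis
    note T = True[unfolded t]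
    have "rho a b = 0 \<or> eps a = eps b" using rho_eps[OF T] by blast
    then show ?thesis unfolding t i
      by (auto simp: S_append[OF T] X_def nth_append algebra_simps)
  qed (simp add: S_outside X_def)
  then show "S i (X (Suc i) v) = X i (S i v)" "S i (X i v) = X (Suc i) (S i v)" by auto
qed

lemma S_X_far:
  assumes "1 \<le> i" "i < n" "1 \<le> j" "j \<noteq> i" "j \<noteq> Suc i"
  shows "S i (X j v) = X j (S i v)"
proof
  fix t
  show "S i (X j v) t = X j (S i v) t"
  proof (cases "t \<in> L")
    case True
    have "swp i t ! (j - 1) = t ! (j - 1)"
      using assms unfolding swp_def by (simp add: nth_list_update)
    then show ?thesis using True by (simp add: S_def X_def algebra_simps)
  qed (simp add: S_outside X_def)
qed

lemma X_X [simp]: "X i (X i v) = v"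
  using eps_sq by (auto simp: X_def fun_eq_iff mult.assoc[symmetric])

lemma foldr_S_in_V: "v \<in> V \<Longrightarrow> foldr S xs v \<in> V"
  by (induction xs) auto

lemma linear_foldr_S: "linear (foldr S xs)"
proof (induction xs)
  case (Cons x xs)
  then show ?case using linear_compose[OF Cons linear_S[of x]] by (simp add: o_def)
qed (simp add: linear_id[unfolded id_def] id_def)

lemma foldr_S_comm:
  assumes "v \<in> V" "1 \<le> i" "i < n" "\<forall>j\<in>set xs. 1 \<le> j \<and> j < n \<and> (Suc i < j \<or> Suc j < i)"
  shows "S i (foldr S xs v) = foldr S xs (S i v)"
  using assms(4)
proof (induction xs)
  case (Cons j xs)
  have "S i (S j (foldr S xs v)) = S j (S i (foldr S xs v))"
    using Cons.prems assms(1-3) foldr_S_in_V[OF assms(1), of xs]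
      S_comm[of "foldr S xs v" i j] S_comm[of "foldr S xs v" j i] by auto
  then show ?case using Cons by simp
qed simp

lemma foldr_S_X:
  assumes "1 \<le> i" "\<forall>j\<in>set xs. 1 \<le> j \<and> j < n \<and> i \<noteq> j \<and> i \<noteq> Suc j"
  shows "foldr S xs (X i v) = X i (foldr S xs v)"
  using assms(2) by (induction xs) (use assms(1) S_X_far in auto)

lemma foldr_S_rev:
  assumes "v \<in> V" "\<forall>j\<in>set xs. 1 \<le> j \<and> j < n"
  shows "foldr S xs (foldr S (rev xs) v) = v"
  using assms
proof (induction xs arbitrary: v)
  case (Cons j xs)
  have "foldr S (j # xs) (foldr S (rev (j # xs)) v) = S j (foldr S xs (foldr S (rev xs) (S j v)))"
    by simp
  also have "\<dots> = S j (S j v)" using Cons by auto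
  also have "\<dots> = v" using Cons S_invol by auto
  finally show ?case .
qed simp

lemma cox_S:
  assumes "v \<in> V" "1 \<le> i" "Suc i < n"
  shows "cox (S i v) = S (Suc i) (cox v)"
proof -
  have split: "[1..<n] = [1..<i] @ i # Suc i # [Suc (Suc i)..<n]"
    using assms upt_add_eq_append[of 1 i "n - i"] by (simp add: upt_conv_Cons)
  define z where "z = foldr S [Suc (Suc i)..<n] v"
  have z: "z \<in> V" unfolding z_def by (rule foldr_S_in_V[OF assms(1)])
  have "foldr S [Suc (Suc i)..<n] (S i v) = S i z"
    unfolding z_def using assms by (intro foldr_S_comm[symmetric]) auto
  then have "cox (S i v) = foldr S [1..<i] (S i (S (Suc i) (S i z)))"
    unfolding cox_def split by simp
  also have "\<dots> = foldr S [1..<i] (S (Suc i) (S i (S (Suc i) z)))"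
    using S_braid[OF z] assms by simp
  also have "\<dots> = S (Suc i) (foldr S [1..<i] (S i (S (Suc i) z)))"
    using assms by (intro foldr_S_comm[symmetric]) auto
  also have "\<dots> = S (Suc i) (cox v)"
    unfolding cox_def split z_def by simp
  finally show ?thesis .
qed

lemma cox_in_V [simp]: "v \<in> V \<Longrightarrow> cox v \<in> V"
  unfolding cox_def by (rule foldr_S_in_V)

lemma cox_foldr:
  assumes "v \<in> V" "\<forall>j\<in>set xs. 1 \<le> j \<and> Suc j < n"
  shows "cox (foldr S xs v) = foldr S (map Suc xs) (cox v)"
  using assms(2)
proof (induction xs)
  case (Cons j xs)
  then show ?case using cox_S[OF foldr_S_in_V[OF assms(1)], of j xs] by simp
qed simp

lemma cox_X1:
  assumes "v \<in> V" "2 \<le> n"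
  shows "cox (X 1 v) = X 2 (cox v)"
proof -
  have split: "[1..<n] = 1 # [2..<n]" using assms by (simp add: upt_conv_Cons numeral_2_eq_2)
  have "foldr S [2..<n] (X 1 v) = X 1 (foldr S [2..<n] v)"
    by (rule foldr_S_X) auto
  then show ?thesis
    unfolding cox_def split using S_X(2)[OF foldr_S_in_V[OF assms(1), of "[2..<n]"], of 1] assms
    by (simp add: numeral_2_eq_2)
qed

lemma om_in_V [simp]: "v \<in> V \<Longrightarrow> om v \<in> V"
  unfolding om_def by simp

lemma linear_om: "linear om"
  using linear_compose[OF linear_foldr_S[of "[1..<n]"] linear_X[of 1]]
  unfolding om_def cox_def o_def by simp

lemma om_S:
  assumes "v \<in> V" "1 \<le> i" "Suc i < n"
  shows "om (S i v) = S (Suc i) (om v)"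
  unfolding om_def cox_S[OF assms] using assms by (subst S_X_far) auto

text \<open>Closes the cycle: \<open>U n\<close> is fixed by the conjugate of
  \<open>S (n - 1)\<close> under \<open>om\<close>, and one more \<open>om\<close> turns this
  conjugate into \<open>S 1\<close>. The input \<open>S (n - 1)\<close> cancels the rightmost factor
  of \<open>cox\<close>; a second \<open>cox\<close> shifts the remaining product to
  \<open>S 2 ... S (n - 1)\<close>, which is \<open>cox\<close> without its leftmost factor.\<close>

lemma om_om_S:
  assumes "v \<in> V" "2 \<le> n"
  shows "om (om (S (n - 1) v)) = S 1 (om (om v))"
proof -
  have om2: "om (om w) = X 1 (X 2 (cox (cox w)))" if "w \<in> V" for w
    unfolding om_def using cox_X1[OF _ assms(2), of "cox w"] that by simp
  have split: "[1..<n] = [1..<n - 1] @ [n - 1]"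
    using assms(2) upt_Suc_append[of 1 "n - 1"] by simp
  have split': "[1..<n] = 1 # [2..<n]" using assms by (simp add: upt_conv_Cons numeral_2_eq_2)
  have "cox (S (n - 1) v) = foldr S [1..<n - 1] v"
    unfolding cox_def split using S_invol[OF assms(1), of "n - 1"] assms(2) by simp
  then have "cox (cox (S (n - 1) v)) = foldr S (map Suc [1..<n - 1]) (cox v)"
    using cox_foldr[OF assms(1), of "[1..<n - 1]"] by (simp add: less_diff_conv)
  also have "map Suc [1..<n - 1] = [2..<n]"
    using assms(2) by (simp add: map_Suc_upt numeral_2_eq_2)
  also have "foldr S [2..<n] (cox v) = S 1 (S 1 (foldr S [2..<n] (cox v)))"
    using assms by (intro S_invol[symmetric]) (auto intro: foldr_S_in_V)
  also have "S 1 (foldr S [2..<n] (cox v)) = cox (cox v)"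
    using fun_cong[OF cox_def, of "cox v"] by (simp only: split' foldr.simps o_apply)
  finally have c: "cox (cox (S (n - 1) v)) = S 1 (cox (cox v))" .
  define w where "w = cox (cox v)"
  have w: "w \<in> V" unfolding w_def using assms by simp
  have "S 1 (X 1 (X 2 w)) = X 2 (X 1 (S 1 w))"
    using S_X(1)[OF w, of 1] S_X(2)[of "X 2 w" 1] w assms(2) by (simp add: numeral_2_eq_2)
  also have "\<dots> = X 1 (X 2 (S 1 w))" by (simp add: X_def fun_eq_iff)
  finally show ?thesis using om2 c assms unfolding w_def by simp
qed

lemma om_inj:
  assumes "v \<in> V" "om v = 0"
  shows "v = 0"
proof -
  have "X 1 (om v) = 0" using assms(2) by (simp add: X_def fun_eq_iff)
  then have 0: "cox v = 0" unfolding om_def by simp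
  have "foldr S (rev [1..<n]) (cox v) = v"
    unfolding cox_def using foldr_S_rev[OF assms(1), of "rev [1..<n]"] by simp
  then show ?thesis using 0 linear_0[OF linear_foldr_S, of "rev [1..<n]"] by simp
qed

lemma om_inj_on: "inj_on om V"
proof (rule inj_onI)
  fix x y assume "x \<in> V" "y \<in> V" "om x = om y"
  then have "om (x - y) = 0" "x - y \<in> V"
    using linear_diff[OF linear_om, of x y] subspace_diff[OF subspace_V] by auto
  then show "x = y" using om_inj by fastforce
qed

lemma om_surj: "om ` V = V"
proof
  show "V \<subseteq> om ` V"
  proof
    fix v assume v: "v \<in> V"
    have "om (foldr S (rev [1..<n]) (X 1 v)) = v"
      unfolding om_def cox_def using foldr_S_rev[of "X 1 v" "[1..<n]"] v by simp
    then show "v \<in> om ` V" using foldr_S_in_V[of "X 1 v"] v by (metis X_in_V image_eqI)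
  qed
qed auto

section \<open>Cyclic action of \<open>om\<close> on the fixed spaces\<close>

lemma U_subset: "U i \<subseteq> V"
  unfolding U_def by auto

lemma om_U_eq:
  assumes "1 \<le> i" "Suc i < n"
  shows "om ` U i = U (Suc i)"
proof
  show "om ` U i \<subseteq> U (Suc i)"
  proof
    fix w assume "w \<in> om ` U i"
    then obtain v where v: "v \<in> V" "S i v = v" "w = om v" using assms by (auto simp: U_def)
    have "S (Suc i) w = w" using om_S[OF v(1) assms] v by simp
    then show "w \<in> U (Suc i)" using v assms by (auto simp: U_def)
  qed
  show "U (Suc i) \<subseteq> om ` U i"
  proof
    fix w assume w: "w \<in> U (Suc i)"
    then obtain v where v: "v \<in> V" "w = om v" using om_surj U_subset by blast
    have "om (S i v) = om v" using om_S[OF v(1) assms] w v(2) assms by (simp add: U_def)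
    then have "S i v = v" using om_inj_on v(1) by (auto simp: inj_on_def)
    then show "w \<in> om ` U i" using v assms by (auto simp: U_def)
  qed
qed

lemma om_U_last: "2 \<le> n \<Longrightarrow> om ` U (n - 1) = U n"
  unfolding U_def by simp

lemma om_U_n:
  assumes "2 \<le> n"
  shows "om ` U n = U 1"
proof
  show "om ` U n \<subseteq> U 1"
  proof
    fix w assume "w \<in> om ` U n"
    then obtain v where v: "v \<in> V" "S (n - 1) v = v" "w = om (om v)" by (auto simp: U_def)
    have "S 1 w = w" using om_om_S[OF v(1) assms] v by simp
    then show "w \<in> U 1" using v assms by (auto simp: U_def)
  qed
  show "U 1 \<subseteq> om ` U n"
  proof
    fix w assume w: "w \<in> U 1"
    then obtain v' where v': "v' \<in> V" "w = om v'" using om_surj U_subset by blast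
    then obtain v where v: "v \<in> V" "v' = om v" using om_surj by blast
    have "om (om (S (n - 1) v)) = om (om v)"
      using om_om_S[OF v(1) assms] w v(2) v'(2) assms by (simp add: U_def)
    then have "S (n - 1) v = v"
      using om_inj_on v(1) by (metis S_in_V inj_on_def om_in_V)
    then have "v' \<in> U n" using v by (auto simp: U_def)
    then show "w \<in> om ` U n" using v' by blast
  qed
qed

lemma om_U:
  assumes "2 \<le> n" "i \<in> {1..n}"
  shows "om ` U i = U (cyc_rep n (int i + 1))"
proof (cases "i = n")
  case True
  have "cyc_rep n (int n + 1) = 1" unfolding cyc_rep_def by simp
  with True show ?thesis using om_U_n assms by simp
next
  case False
  have "cyc_rep n (int i + 1) = Suc i" using cyc_rep_id[of "Suc i" n] False assms by (simp add: add.commute)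
  moreover have "om ` U i = U (Suc i)"
  proof (cases "Suc i = n")
    case True
    then have "i = n - 1" by simp
    with True show ?thesis using om_U_last[OF assms(1)] by simp
  qed (use om_U_eq[of i] assms False in auto)
  ultimately show ?thesis by simp
qed

lemma subspace_U: "subspace (U i)"
proof -
  have s: "subspace {v \<in> V. S j v = v}" for j
  proof -
    have "{v. S j v = v} = {v. S j v - v = 0}" by auto
    moreover have "subspace {v. S j v - v = 0}"
      using linear_subspace_kernel[of "\<lambda>v. S j v - v"] linear_compose_sub[OF linear_S linear_id] by (simp add: id_def)
    ultimately have "subspace (V \<inter> {v. S j v = v})"
      using subspace_inter[OF subspace_V] by simp
    then show ?thesis by (simp add: Int_def)
  qed
  then show ?thesis unfolding U_def using linear_subspace_image[OF linear_om] by simp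
qed

lemma subspace_Inv: "subspace (Inv I)"
proof -
  have "Inv I = V \<inter> (\<Inter>i\<in>{1..n} - I. U i)" unfolding Inv_def by auto
  then show ?thesis
    using subspace_inter[OF subspace_V] subspace_Int[of "{1..n} - I" U] subspace_U by metis
qed

lemma Inv_subset: "Inv I \<subseteq> V"
  unfolding Inv_def by auto

lemma Inv_mono: "I \<subseteq> J \<Longrightarrow> Inv I \<subseteq> Inv J"
  unfolding Inv_def by auto

lemma fin_dim_Inv: "fin_dim (Inv I)"
  by (rule fin_dim_mono[OF fin_dim_V Inv_subset])

lemma om_Inv_step:
  assumes "I \<subseteq> {1..n}" "I \<noteq> {}"
  shows "om ` Inv I = Inv (cyc_shift n 1 I)"
proof (cases "n = 1")
  case True
  then have "I = {1}" "cyc_shift n 1 I = {1}" using assms by (auto simp: cyc_shift_def cyc_rep_def)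
  then show ?thesis using True om_surj by (simp add: Inv_def)
next
  case False
  then have n: "2 \<le> n" using assms by (cases n) (auto simp: Suc_le_eq)
  have compl: "{1..n} - cyc_shift n 1 I = (\<lambda>i. cyc_rep n (int i + 1)) ` ({1..n} - I)"
  proof -
    have "inj_on (\<lambda>i. cyc_rep n (int i + 1)) {1..n}"
    proof (rule inj_on_inverseI[where g = "\<lambda>i. cyc_rep n (int i - 1)"])
      fix i assume "i \<in> {1..n}"
      then show "cyc_rep n (int (cyc_rep n (int i + 1)) - 1) = i"
        using cyc_rep_diff[of n "int i + 1" 1] cyc_rep_id[of i n] n by simp
    qed
    moreover from this have "(\<lambda>i. cyc_rep n (int i + 1)) ` {1..n} = {1..n}"
      using n cyc_rep_in[of n] by (intro endo_inj_surj) auto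
    ultimately show ?thesis
      unfolding cyc_shift_def using assms(1)
      inj_on_image_set_diff[of "\<lambda>i. cyc_rep n (int i + 1)" "{1..n}" "{1..n}" I] by auto
  qed
  have mem: "om v \<in> U (cyc_rep n (int i + 1)) \<longleftrightarrow> v \<in> U i" if "i \<in> {1..n}" "v \<in> V" for i v
    unfolding om_U[OF n that(1), symmetric] by (rule inj_on_image_mem_iff[OF om_inj_on that(2) U_subset])
  have iff: "om v \<in> Inv (cyc_shift n 1 I) \<longleftrightarrow> v \<in> Inv I" if "v \<in> V" for v
    using that mem[OF _ that] unfolding Inv_def compl by auto
  show ?thesis
  proof
    show "om ` Inv I \<subseteq> Inv (cyc_shift n 1 I)" using iff Inv_subset by blast
    show "Inv (cyc_shift n 1 I) \<subseteq> om ` Inv I"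
    proof
      fix w assume w: "w \<in> Inv (cyc_shift n 1 I)"
      then have "w \<in> om ` V" using Inv_subset om_surj by blast
      then obtain v where "v \<in> V" "w = om v" by blast
      then show "w \<in> om ` Inv I" using iff w by blast
    qed
  qed
qed

lemma om_Inv:
  assumes "I \<subseteq> {1..n}" "I \<noteq> {}"
  shows "(om ^^ k) ` Inv I = Inv (cyc_shift n (int k) I)"
proof (induction k)
  case 0
  then show ?case using cyc_shift_0[OF assms(1)] by simp
next
  case (Suc k)
  have n: "n \<ge> 1" using assms by (cases n) auto
  have "(om ^^ Suc k) ` Inv I = om ` (om ^^ k) ` Inv I" by (simp add: image_comp)
  also have "\<dots> = Inv (cyc_shift n 1 (cyc_shift n (int k) I))"
    unfolding Suc using om_Inv_step[OF cyc_shift_subset[OF n]] assms by simp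
  finally show ?case using cyc_shift_shift[OF n] by (simp add: add.commute)
qed

lemma linear_om_pow: "linear (om ^^ k)"
proof (induction k)
  case (Suc k)
  then show ?case using linear_compose[OF Suc linear_om] by (simp only: funpow.simps)
qed (simp add: linear_id[unfolded id_def] id_def)

lemma om_pow_inj: "v \<in> V \<Longrightarrow> (om ^^ k) v = 0 \<Longrightarrow> v = 0"
  by (induction k arbitrary: v) (auto simp: funpow_Suc_right simp del: funpow.simps intro: om_inj)

lemma om_pow_in_V [simp]: "v \<in> V \<Longrightarrow> (om ^^ k) v \<in> V"
  by (induction k) auto

end

section \<open>Bases adapted to descent sets\<close>

lemma sorted_wrt_unique:
  assumes "sorted_wrt P xs" "sorted_wrt P ys" "set xs = set ys" "distinct xs" "distinct ys"
    "\<And>a b. P a b \<Longrightarrow> \<not> P b a"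
  shows "xs = ys"
  using assms(1-5)
proof (induction xs arbitrary: ys)
  case (Cons x xs)
  then obtain y zs where ys: "ys = y # zs" by (cases ys) auto
  have "x = y"
  proof (rule ccontr)
    assume "x \<noteq> y"
    then have "P x y" "P y x" using Cons.prems unfolding ys by auto
    then show False using assms(6) by blast
  qed
  moreover have "set xs = set zs" using Cons.prems \<open>x = y\<close> unfolding ys by auto
  ultimately show ?case using Cons.IH[of zs] Cons.prems unfolding ys by auto
qed simp

text \<open>Pairs a set containing \<open>m\<close> with the same set without it, as
  \<open>lower_exact\<close> does for \<open>m = n\<close>. The singleton \<open>{m}\<close> stands
  alone because its partner would be empty.\<close>

lemma sum_pairs:
  fixes f :: "nat set \<Rightarrow> nat"
  assumes "finite I" "m \<in> I"
  shows "(\<Sum>J | J \<subseteq> I \<and> J \<noteq> {}. f J) = f {m} + (\<Sum>K | K \<subseteq> I - {m} \<and> K \<noteq> {}. f (insert m K) + f K)"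
proof -
  let ?A = "{K. K \<subseteq> I - {m} \<and> K \<noteq> {}}"
  have fA: "finite ?A" using assms by simp
  have "{J. J \<subseteq> I \<and> J \<noteq> {}} = insert {m} (insert m ` ?A \<union> ?A)"
  proof (intro set_eqI iffI)
    fix J assume J: "J \<in> {J. J \<subseteq> I \<and> J \<noteq> {}}"
    show "J \<in> insert {m} (insert m ` ?A \<union> ?A)"
    proof (cases "m \<in> J")
      case True
      then have "J = insert m (J - {m})" by blast
      then show ?thesis using J by (cases "J = {m}") blast+
    qed (use J in blast)
  qed (use assms in auto)
  moreover have "{m} \<notin> insert m ` ?A \<union> ?A" "insert m ` ?A \<inter> ?A = {}" by auto
  moreover have "inj_on (insert m) ?A" by (rule inj_onI) blast
  ultimately show ?thesis
    using fA by (simp add: sum.union_disjoint sum.reindex sum.distrib)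
qed

lemma cyc_shift_diff:
  assumes m: "m \<ge> 1" and "J \<subseteq> {1..m}" "j \<in> {1..m}"
  shows "cyc_shift m k (J - {j}) = cyc_shift m k J - {cyc_rep m (int j + k)}"
proof -
  have "inj_on (\<lambda>i. cyc_rep m (int i + k)) {1..m}"
  proof (rule inj_on_inverseI[where g = "\<lambda>i. cyc_rep m (int i - k)"])
    fix i assume "i \<in> {1..m}"
    then show "cyc_rep m (int (cyc_rep m (int i + k)) - k) = i"
      using cyc_rep_diff[OF m, of "int i + k" k] cyc_rep_id[of i m] by simp
  qed
  then show ?thesis
    unfolding cyc_shift_def using inj_on_image_set_diff[of _ "{1..m}" J "{j}"] assms by auto
qed

lemma shift_to_last:
  assumes "J \<subseteq> {1..n}" "J \<noteq> {}"
  obtains k where "n \<in> cyc_shift n (int k) J"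
proof -
  obtain j where j: "j \<in> J" using assms by blast
  then have "cyc_rep n (int j + int (n - j)) = n" using assms cyc_rep_id[of n n]
    by (auto simp: of_nat_diff subset_iff)
  then show ?thesis using that[of "n - j"] j unfolding cyc_shift_def by force
qed

lemma sum_shift:
  fixes k :: int
  assumes "n \<ge> 1" and I: "I \<subseteq> {1..n}"
  shows "(\<Sum>J | J \<subseteq> cyc_shift n (k) I \<and> J \<noteq> {}. f J) =
         (\<Sum>J | J \<subseteq> I \<and> J \<noteq> {}. f (cyc_shift n (k) J))"
proof (rule sum.reindex_bij_witness[where j = "cyc_shift n (- k)" and i = "cyc_shift n (k)"])
  fix J assume "J \<in> {J. J \<subseteq> I \<and> J \<noteq> {}}"
  then have J: "J \<subseteq> {1..n}" "J \<subseteq> I" "J \<noteq> {}" using I by auto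
  show "cyc_shift n (- k) (cyc_shift n (k) J) = J"
    using cyc_shift_shift[OF assms(1)] cyc_shift_0[OF J(1)] by simp
  show "cyc_shift n (k) J \<in> {J. J \<subseteq> cyc_shift n (k) I \<and> J \<noteq> {}}"
    using J by (auto simp: cyc_shift_def)
next
  fix J assume J: "J \<in> {J. J \<subseteq> cyc_shift n (k) I \<and> J \<noteq> {}}"
  then have sub: "J \<subseteq> {1..n}" using cyc_shift_subset[OF assms(1), of "k" I] by blast
  show eq: "cyc_shift n (k) (cyc_shift n (- k) J) = J"
    using sub cyc_shift_shift[OF assms(1)] cyc_shift_0 by simp
  have "cyc_shift n (- k) J \<subseteq> cyc_shift n (- k) (cyc_shift n (k) I)"
    using J unfolding cyc_shift_def by blast
  then show "cyc_shift n (- k) J \<in> {J. J \<subseteq> I \<and> J \<noteq> {}}"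
    using J I cyc_shift_shift[OF assms(1)] cyc_shift_0[of I n] by simp
  show "f (cyc_shift n (k) (cyc_shift n (- k) J)) = f J" unfolding eq ..
qed

context lsys
begin

definition Des :: "'c list \<Rightarrow> nat set" where
  "Des t = {i. 1 \<le> i \<and> i < length t \<and> key (t ! i) < key (t ! (i - 1))}"

fun inversions :: "'c list \<Rightarrow> nat" where
  "inversions [] = 0"
| "inversions (a # t) = length (filter (\<lambda>b. key b < key a) t) + inversions t"

definition num_des :: "nat set \<Rightarrow> nat" where
  "num_des K = card {t \<in> L. Des t = K}"

text \<open>Indicator of the linear extensions obtained from \<open>t\<close> by rearranging entries
  within the runs between its descents. Among them \<open>t\<close> has the fewest inversions, so
  the family is unitriangular.\<close>

definition block_ind :: "'c list \<Rightarrow> 'c list \<Rightarrow> real" where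
  "block_ind t u = (if u \<in> L \<and> (\<forall>j\<in>Des t. set (take j u) = set (take j t)) then 1 else 0)"

text \<open>
  The sum of the \<open>Inv J'\<close> over the maximal proper subsets \<open>J'\<close> of \<open>J\<close>. The empty \<open>J'\<close> is left out because
  a word has at least one cyclic position where a rise is not required.
\<close>

definition Merged :: "nat set \<Rightarrow> ('c list \<Rightarrow> real) set" where
  "Merged J = span (\<Union>j\<in>{j \<in> J. J - {j} \<noteq> {}}. Inv (J - {j}))"

text \<open>These numbers turn out to be the coefficients of the expansion; truncated subtraction is harmless as \<open>Merged J \<subseteq> Inv J\<close>.\<close>

definition new_dim :: "nat set \<Rightarrow> nat" where
  "new_dim J = dim (Inv J) - dim (Merged J)"

text \<open>
  By \<open>lower_exact_iff\<close> this is the equality case of \<open>new_dim J + new_dim (J - {n}) \<ge> num_des (J - {n})\<close>.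
  The condition \<open>top_exact\<close> is what makes it survive the addition of an isolated cell.
\<close>

definition lower_exact :: bool where
  "lower_exact \<longleftrightarrow> (\<forall>J \<subseteq> {1..n}. n \<in> J \<longrightarrow> J \<noteq> {n} \<longrightarrow>
     Inv (J - {n}) \<inter> span (\<Union>j\<in>J - {n}. Inv (J - {j})) \<subseteq> Merged (J - {n}))"

definition top_exact :: bool where
  "top_exact \<longleftrightarrow> 2 \<le> n \<and> V \<subseteq> Merged {1..n}"

lemma inversions_swap: "key b < key a \<Longrightarrow> inversions (u @ a # b # w) = Suc (inversions (u @ b # a # w))"
  by (induction u) auto

lemma key_le_if_no_descent:
  assumes "p \<le> q" "q < length t" "\<And>j. p < j \<Longrightarrow> j \<le> q \<Longrightarrow> j \<notin> Des t"
  shows "key (t ! p) \<le> key (t ! q)"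
  using assms
proof (induction q)
  case (Suc q)
  show ?case
  proof (cases "p = Suc q")
    case False
    then have "key (t ! p) \<le> key (t ! q)" using Suc by simp
    also have "\<dots> \<le> key (t ! Suc q)"
      using Suc.prems(3)[of "Suc q"] Suc.prems(1,2) False by (auto simp: Des_def)
    finally show ?thesis .
  qed simp
qed simp

lemma Des_subset: "Des t \<subseteq> {1..<length t}"
  unfolding Des_def by auto

end

context lin_sys
begin

lemma U_iff:
  assumes "1 \<le> i" "i < n"
  shows "v \<in> U i \<longleftrightarrow> v \<in> V \<and> (\<forall>u a b w. u @ a # b # w \<in> L \<and> i = Suc (length u) \<longrightarrow>
           rho a b = 1 \<or> v (u @ a # b # w) = v (u @ b # a # w))" (is "_ \<longleftrightarrow> v \<in> V \<and> ?C")
proof -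
  have "S i v = v \<longleftrightarrow> ?C" if v: "v \<in> V"
  proof
    assume *: "S i v = v"
    show ?C
    proof (intro allI impI)
      fix u a b w assume "u @ a # b # w \<in> L \<and> i = Suc (length u)"
      then have "rho a b * v (u @ a # b # w) + (1 - rho a b) * v (u @ b # a # w) = v (u @ a # b # w)"
        using S_append[of u a b w v] * by simp
      then have "(1 - rho a b) * (v (u @ a # b # w) - v (u @ b # a # w)) = 0"
        by (simp add: algebra_simps)
      then show "rho a b = 1 \<or> v (u @ a # b # w) = v (u @ b # a # w)" by auto
    qed
  next
    assume *: ?C
    show "S i v = v"
    proof
      fix t
      show "S i v t = v t"
      proof (cases "t \<in> L")
        case True
        then obtain u a b w where t: "t = u @ a # b # w" and i: "i = Suc (length u)"
          using split_L assms by metis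
        show ?thesis using *[rule_format, of u a b w] True i unfolding t
          by (auto simp: S_append algebra_simps)
      qed (simp add: S_outside V_outside[OF v])
    qed
  qed
  then show ?thesis using assms unfolding U_def by auto
qed

text \<open>A descent of \<open>t\<close> outside \<open>I\<close> can be undone: invariance equates
  the value at \<open>t\<close> with the value at the swapped list, which has fewer inversions. If
  the swap leaves \<open>L\<close>, then \<open>rho\<close> is -1 and the value is 0. Hence
  \<open>dim (Inv I)\<close> is at most the number of linear extensions with descents in
  \<open>I\<close>.\<close>

lemma Inv_eq_0:
  assumes v: "v \<in> Inv I" and 0: "\<And>t. t \<in> L \<Longrightarrow> Des t \<subseteq> I \<Longrightarrow> v t = 0"
  shows "v = 0"
proof -
  have vV: "v \<in> V" using v Inv_subset by blast
  have "v t = 0" if "t \<in> L" for t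
    using that
  proof (induction "inversions t" arbitrary: t rule: less_induct)
    case less
    show ?case
    proof (cases "Des t \<subseteq> I")
      case False
      then obtain i where i: "i \<in> Des t" "i \<notin> I" by blast
      then have in1: "1 \<le> i" "i < n" using Des_subset[of t] length_L[OF less.prems] by auto
      then obtain u a b w where t: "t = u @ a # b # w" and iu: "i = Suc (length u)"
        using split_L less.prems by metis
      have ab: "key b < key a" using i(1) unfolding t iu Des_def by (simp add: nth_append)
      have "v \<in> U i" using v i(2) in1 unfolding Inv_def by auto
      then have c: "rho a b = 1 \<or> v t = v (u @ b # a # w)"
        using U_iff[OF in1] less.prems iu t by blast
      show ?thesis
      proof (cases "u @ b # a # w \<in> L")
        case True
        have "v (u @ b # a # w) = 0"
          using less.hyps[OF _ True] inversions_swap[OF ab] unfolding t by simp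
        moreover have "\<bar>rho a b\<bar> < 1" using rho_neq_1[OF _ True] less.prems unfolding t by blast
        ultimately show ?thesis using c by auto
      next
        case False
        then have "R a b" using L_swap less.prems unfolding t by blast
        then have "rho a b = - 1" using rho_R[of u a b w] less.prems ab unfolding t by simp
        then show ?thesis using c V_outside[OF vV False] by simp
      qed
    qed (use less.prems 0 in simp)
  qed
  then show ?thesis using V_outside[OF vV] by (auto simp: fun_eq_iff)
qed

lemma key_L_less:
  assumes "distinct t" "set t = D" "p < q" "q < length t" "\<And>j. p < j \<Longrightarrow> j \<le> q \<Longrightarrow> j \<notin> Des t"
  shows "key (t ! p) < key (t ! q)"
proof -
  have "key (t ! p) \<le> key (t ! q)" using assms by (intro key_le_if_no_descent) auto
  moreover have "t ! p \<noteq> t ! q" using assms by (simp add: nth_eq_iff_index_eq)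
  moreover have "t ! p \<in> D" "t ! q \<in> D" using assms nth_mem[of _ t] by auto
  ultimately show ?thesis using inj_key by (auto simp: inj_on_def order.order_iff_strict)
qed

lemma mem_take_iff:
  "distinct t \<Longrightarrow> p < length t \<Longrightarrow> t ! p \<in> set (take j t) \<longleftrightarrow> p < j"
  by (auto simp: in_set_conv_nth nth_eq_iff_index_eq intro!: exI[of _ p])

text \<open>The critical case is a pair \<open>a\<close>, \<open>b\<close> at position
  \<open>i\<close> with \<open>R a b\<close> and decreasing keys, where a fixed vector must vanish.
  In \<open>t\<close> the cell \<open>a\<close> comes before \<open>b\<close>, so a descent
  \<open>j\<close> of \<open>t\<close> separates them. A list with the same first \<open>j\<close>
  entries up to order can hold \<open>a\<close> and \<open>b\<close> side by side only across
  \<open>j\<close>, but \<open>i\<close> is not a descent of \<open>t\<close>.\<close>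

lemma block_ind_in_U:
  assumes t: "t \<in> L" and i: "1 \<le> i" "i < n" "i \<notin> Des t"
  shows "block_ind t \<in> U i"
  unfolding U_iff[OF i(1,2)]
proof (intro conjI allI impI)
  show "block_ind t \<in> V" unfolding V_def block_ind_def by auto
  fix u a b w assume "u @ a # b # w \<in> L \<and> i = Suc (length u)"
  then have L: "u @ a # b # w \<in> L" and iu: "i = Suc (length u)" by auto
  have tk: "set (take j (u @ b # a # w)) = set (take j (u @ a # b # w))" if "j \<noteq> i" for j
  proof (cases "j \<le> length u")
    case False
    then have "Suc (Suc (length u)) \<le> j" using that unfolding iu by simp
    then obtain k where "j = Suc (Suc (length u)) + k" using le_Suc_ex by blast
    then show ?thesis by auto
  qed simp
  show "rho a b = 1 \<or> block_ind t (u @ a # b # w) = block_ind t (u @ b # a # w)"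
  proof (cases "u @ b # a # w \<in> L")
    case True
    then show ?thesis using L tk i(3) unfolding block_ind_def by (metis (no_types, lifting))
  next
    case False
    then have R: "R a b" using L_swap L by blast
    show ?thesis
    proof (cases "key a < key b")
      case True
      then show ?thesis using rho_R[OF L R] by simp
    next
      case kab: False
      have "\<exists>j\<in>Des t. set (take j (u @ a # b # w)) \<noteq> set (take j t)"
      proof (rule ccontr)
        assume "\<not> ?thesis"
        then have same: "set (take j (u @ a # b # w)) = set (take j t)" if "j \<in> Des t" for j
          using that by blast
        have ab: "a \<in> D" "b \<in> D" "a \<noteq> b" using L_pair_in_D[OF L] by auto
        have dt: "distinct t" "set t = D" using t unfolding L_def by auto
        obtain p q where p: "p < length t" "t ! p = a" and q: "q < length t" "t ! q = b"
          using ab dt(2) by (metis in_set_conv_nth)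
        have "p < q"
        proof (rule ccontr)
          assume "\<not> p < q"
          then have "q < p" using p q ab(3) by (metis nat_neq_iff)
          then have "\<not> R (t ! p) (t ! q)"
            using t p(1) unfolding L_def by (auto simp: sorted_wrt_iff_nth_less)
          then show False using p q R by simp
        qed
        then obtain j where j: "p < j" "j \<le> q" "j \<in> Des t"
          using key_L_less[OF dt, of p q] q(1) kab p(2) q(2) by auto
        have "a \<in> set (take j t)" "b \<notin> set (take j t)"
          using mem_take_iff[OF dt(1)] p q j by auto
        then have "a \<in> set (take j (u @ a # b # w))" "b \<notin> set (take j (u @ a # b # w))"
          using same[OF j(3)] by auto
        then have "j = i"
        proof -
          have d: "distinct (u @ a # b # w)" using L unfolding L_def by auto
          have "length u < j" "\<not> Suc (length u) < j"
            using mem_take_iff[OF d, of "length u" j] mem_take_iff[OF d, of "Suc (length u)" j]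
              \<open>a \<in> set (take j (u @ a # b # w))\<close> \<open>b \<notin> set (take j (u @ a # b # w))\<close>
            by (auto simp: nth_append)
          then show ?thesis using iu by simp
        qed
        then show False using i(3) j(3) by simp
      qed
      then show ?thesis using False unfolding block_ind_def by auto
    qed
  qed
qed

lemma block_sorted_unique:
  assumes t: "distinct t" "set t = D" and u: "distinct u" "set u = D"
    and blocks: "\<And>j. j \<in> Des t \<Longrightarrow> set (take j u) = set (take j t)" and "Des u \<subseteq> Des t"
  shows "u = t"
proof -
  \<comment> \<open>Earlier blocks of \<open>t\<close> come first, and keys increase inside a block.
    This order depends on \<open>t\<close> only and sorts both lists.\<close>
  define P where "P a b \<longleftrightarrow> (\<exists>j\<in>Des t. a \<in> set (take j t) \<and> b \<notin> set (take j t)) \<or>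
    ((\<forall>j\<in>Des t. a \<in> set (take j t) \<longleftrightarrow> b \<in> set (take j t)) \<and> key a < key b)" for a b
  have srt: "sorted_wrt P s" if s: "distinct s" "set s = D" "Des s \<subseteq> Des t"
    "\<And>j. j \<in> Des t \<Longrightarrow> set (take j s) = set (take j t)" for s
    unfolding sorted_wrt_iff_nth_less
  proof (intro allI impI)
    fix p q assume pq: "p < q" "q < length s"
    show "P (s ! p) (s ! q)"
    proof (cases "\<exists>j\<in>Des t. p < j \<and> j \<le> q")
      case True
      then obtain j where j: "j \<in> Des t" "p < j" "j \<le> q" by blast
      then have "s ! p \<in> set (take j t)" "s ! q \<notin> set (take j t)"
        using mem_take_iff[OF s(1), of p j] mem_take_iff[OF s(1), of q j] s(4)[OF j(1)] pq by auto
      then show ?thesis using j(1) unfolding P_def by blast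
    next
      case False
      then have "key (s ! p) < key (s ! q)" using s(3) by (intro key_L_less[OF s(1,2) pq]) auto
      moreover have "s ! p \<in> set (take j t) \<longleftrightarrow> s ! q \<in> set (take j t)" if "j \<in> Des t" for j
        using False that mem_take_iff[OF s(1), of p j] mem_take_iff[OF s(1), of q j] pq s(4)[OF that]
        by auto
      ultimately show ?thesis unfolding P_def by auto
    qed
  qed
  have asym: "\<not> P b a" if "P a b" for a b
  proof -
    have mono: "set (take i t) \<subseteq> set (take j t) \<or> set (take j t) \<subseteq> set (take i t)" for i j
      using set_take_subset_set_take[of i j t] set_take_subset_set_take[of j i t] by linarith
    show ?thesis
    proof
      assume ba: "P b a"
      from \<open>P a b\<close> consider j where "j \<in> Des t" "a \<in> set (take j t)" "b \<notin> set (take j t)"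
        | "\<forall>j\<in>Des t. a \<in> set (take j t) \<longleftrightarrow> b \<in> set (take j t)" "key a < key b"
        unfolding P_def by blast
      then show False
      proof cases
        case 1
        with ba obtain i where "b \<in> set (take i t)" "a \<notin> set (take i t)"
          unfolding P_def by blast
        then show False using mono[of i j] 1 by blast
      next
        case 2
        then show False using ba unfolding P_def by auto
      qed
    qed
  qed
  show ?thesis
    using sorted_wrt_unique[OF srt[OF u assms(6) blocks] srt[OF t order_refl refl]] t u asym by auto
qed

lemma block_ind_self [simp]: "t \<in> L \<Longrightarrow> block_ind t t = 1"
  unfolding block_ind_def by simp

text \<open>Undoing a descent of \<open>s\<close> inside a block of \<open>t\<close> preserves the
  prefix sets and removes one inversion; by \<open>block_sorted_unique\<close> this can stop only at
  \<open>t\<close>. Intermediate lists may leave \<open>L\<close>, so the induction runs over all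
  arrangements of \<open>D\<close>.\<close>

lemma block_ind_nonzero_inversions:
  assumes "t \<in> L" "block_ind t u \<noteq> 0" "u \<noteq> t"
  shows "inversions t < inversions u"
proof -
  have t: "distinct t" "set t = D" using assms(1) unfolding L_def by auto
  have "inversions t < inversions s" if "distinct s" "set s = D" "s \<noteq> t"
    "\<forall>j\<in>Des t. set (take j s) = set (take j t)" for s
    using that
  proof (induction "inversions s" arbitrary: s rule: less_induct)
    case less
    obtain i where i: "i \<in> Des s" "i \<notin> Des t"
      using block_sorted_unique[OF t less.prems(1,2)] less.prems by blast
    have "1 \<le> i" "i < length s" using i(1) Des_subset[of s] by auto
    then obtain x a b w where s: "s = x @ a # b # w" and ix: "i = Suc (length x)"
      using split_at_pair by metis
    have ab: "key b < key a" using i(1) unfolding s ix Des_def by (simp add: nth_append)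
    let ?s = "x @ b # a # w"
    have "set (take j ?s) = set (take j t)" if "j \<in> Des t" for j
    proof -
      have "j \<noteq> i" using that i(2) by blast
      then have "set (take j ?s) = set (take j s)"
      proof (cases "j \<le> length x")
        case False
        then have "Suc (Suc (length x)) \<le> j" using \<open>j \<noteq> i\<close> unfolding ix by simp
        then obtain k where "j = Suc (Suc (length x)) + k" using le_Suc_ex by blast
        then show ?thesis unfolding s by auto
      qed (simp add: s)
      then show ?thesis using less.prems(4) that by simp
    qed
    then have "?s = t \<or> inversions t < inversions ?s"
      using less.hyps[of ?s] less.prems inversions_swap[OF ab] unfolding s by auto
    then show ?case using inversions_swap[OF ab, of x w] unfolding s by auto
  qed
  moreover have "u \<in> L" "\<forall>j\<in>Des t. set (take j u) = set (take j t)"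
    using assms(2) unfolding block_ind_def by (auto split: if_splits)
  ultimately show ?thesis using assms(3) unfolding L_def by auto
qed

lemma block_ind_inj: "inj_on block_ind L"
proof (rule inj_onI)
  fix s t assume st: "s \<in> L" "t \<in> L" "block_ind s = block_ind t"
  then have "block_ind s t \<noteq> 0" "block_ind t s \<noteq> 0" using block_ind_self[of s] block_ind_self[of t] by auto
  then show "s = t" using block_ind_nonzero_inversions[of s t] block_ind_nonzero_inversions[of t s] st by fastforce
qed

lemma block_ind_independent:
  assumes "T \<subseteq> L"
  shows "independent (block_ind ` T)"
proof -
  have fT: "finite T" using finite_subset[OF assms finite_L] .
  have inj: "inj_on block_ind T" using inj_on_subset[OF block_ind_inj assms] .
  have "c t = 0" if sum0: "(\<Sum>t\<in>T. c t *\<^sub>R block_ind t) = 0" and "t \<in> T" for c t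
  proof (rule ccontr)
    assume "c t \<noteq> 0"
    define X where "X = {t \<in> T. c t \<noteq> 0}"
    have "finite X" "X \<noteq> {}" using fT \<open>t \<in> T\<close> \<open>c t \<noteq> 0\<close> unfolding X_def by auto
    \<comment> \<open>At a list of least inversion number in the support all other summands
      vanish.\<close>
    then obtain s where s: "s \<in> X" "\<And>r. r \<in> X \<Longrightarrow> inversions s \<le> inversions r"
      using arg_min_if_finite(1) arg_min_least by metis
    have z: "c r * block_ind r s = 0" if "r \<in> T" "r \<noteq> s" for r
    proof (cases "r \<in> X")
      case True
      have "block_ind r s = 0"
      proof (rule ccontr)
        assume "block_ind r s \<noteq> 0"
        then have "inversions r < inversions s" using block_ind_nonzero_inversions[of r s] that assms by blast
        then show False using s(2)[OF True] by simp
      qed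
      then show ?thesis by simp
    qed (use that X_def in simp)
    have "0 = (\<Sum>r\<in>T. c r *\<^sub>R block_ind r) s" using sum0 by simp
    also have "\<dots> = (\<Sum>r\<in>T. c r * block_ind r s)" by (simp add: sum_fun_apply)
    also have "\<dots> = (\<Sum>r\<in>{s}. c r * block_ind r s)"
      using s(1) fT z by (intro sum.mono_neutral_right) (auto simp: X_def)
    also have "\<dots> = c s" using s(1) assms by (auto simp: X_def)
    finally show False using s(1) unfolding X_def by simp
  qed
  then have *: "\<And>c. (\<Sum>t\<in>T. c t *\<^sub>R block_ind t) = 0 \<Longrightarrow> \<forall>t\<in>T. c t = 0" by blast
  show ?thesis
  proof
    assume "dependent (block_ind ` T)"
    then obtain c v where c: "v \<in> block_ind ` T" "c v \<noteq> 0" "(\<Sum>v\<in>block_ind ` T. c v *\<^sub>R v) = 0"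
      using dependent_finite[of "block_ind ` T"] fT by auto
    then have "(\<Sum>t\<in>T. c (block_ind t) *\<^sub>R block_ind t) = 0" using sum.reindex[OF inj, of "\<lambda>v. c v *\<^sub>R v"] by (simp add: o_def)
    then show False using *[of "\<lambda>t. c (block_ind t)"] c(1,2) by blast
  qed
qed

text \<open>The vectors on the left are independent, lie in \<open>Inv I\<close> and are as many as
  \<open>Inv_eq_0\<close> allows. The condition \<open>n \<in> I\<close> excludes the constraint by
  \<open>U n\<close>, which is not described by descents.\<close>

lemma block_ind_span:
  assumes "n \<in> I"
  shows "span (block_ind ` {t \<in> L. Des t \<subseteq> I}) = Inv I"
proof -
  let ?T = "{t \<in> L. Des t \<subseteq> I}"
  have sub: "span (block_ind ` ?T) \<subseteq> Inv I"
  proof (rule span_minimal[OF _ subspace_Inv])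
    show "block_ind ` ?T \<subseteq> Inv I"
    proof (clarify)
      fix t assume t: "t \<in> L" "Des t \<subseteq> I"
      have "block_ind t \<in> V" unfolding V_def block_ind_def by auto
      moreover have "block_ind t \<in> U i" if i: "i \<in> {1..n} - I" for i
      proof -
        have "i \<notin> Des t" "i \<noteq> n" using i t(2) assms by auto
        then show ?thesis using block_ind_in_U[OF t(1), of i] i by simp
      qed
      ultimately show "block_ind t \<in> Inv I" unfolding Inv_def by auto
    qed
  qed
  define f where "f v = (\<lambda>t. if t \<in> ?T then v t else 0)" for v :: "'c list \<Rightarrow> real"
  have lf: "linear f" by (rule linearI) (auto simp: f_def fun_eq_iff)
  have "dim (f ` Inv I) = dim (Inv I)"
  proof (rule fin_dim_dim_image_eq[OF lf fin_dim_Inv subspace_Inv])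
    fix v assume "v \<in> Inv I" "f v = 0"
    then show "v = 0" by (intro Inv_eq_0) (auto simp: f_def fun_eq_iff split: if_splits)
  qed
  moreover have "dim (f ` Inv I) \<le> card ?T"
  proof -
    define d :: "'c list \<Rightarrow> 'c list \<Rightarrow> real" where "d t s = (if s = t then 1 else 0)" for t s
    have "f v \<in> span (d ` ?T)" for v
    proof -
      have "f v = (\<Sum>t\<in>?T. v t *\<^sub>R d t)"
        using finite_L by (auto simp: f_def d_def fun_eq_iff sum_fun_apply if_distrib cong: if_cong)
      also have "\<dots> \<in> span (d ` ?T)" by (intro span_sum span_scale span_base imageI)
      finally show ?thesis .
    qed
    then have "dim (f ` Inv I) \<le> card (d ` ?T)"
      using finite_L by (intro dim_le_card) auto
    also have "\<dots> \<le> card ?T" using finite_L by (intro card_image_le) auto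
    finally show ?thesis .
  qed
  moreover have "dim (span (block_ind ` ?T)) = card ?T"
    using block_ind_independent[of ?T] card_image[OF inj_on_subset[OF block_ind_inj, of ?T]]
    by (simp add: dim_span_eq_card_independent del: dim_span)
  ultimately show ?thesis
    using fin_dim_subspace_eq[OF fin_dim_Inv sub subspace_span] by linarith
qed

lemma dim_span_block_ind: "T \<subseteq> L \<Longrightarrow> dim (span (block_ind ` T)) = card T"
  using block_ind_independent[of T] card_image[OF inj_on_subset[OF block_ind_inj, of T]]
  by (simp add: dim_span_eq_card_independent del: dim_span)

lemma dim_Inv: "n \<in> I \<Longrightarrow> dim (Inv I) = card {t \<in> L. Des t \<subseteq> I}"
  using block_ind_span[of I] dim_span_block_ind[of "{t \<in> L. Des t \<subseteq> I}"] by simp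

lemma Des_L: "t \<in> L \<Longrightarrow> n \<notin> Des t"
  using Des_subset[of t] length_L[of t] by auto

text \<open>All index sets involved contain \<open>n\<close>, so the spaces are spanned by subsets
  of one basis and their sum corresponds to the union of these subsets. It misses only the lists
  with descent set exactly \<open>J - {n}\<close>.\<close>

lemma dim_Inv_linear:
  assumes "n \<in> J"
  shows "dim (Inv J) = dim (span (\<Union>j\<in>J - {n}. Inv (J - {j}))) + num_des (J - {n})"
proof -
  let ?K = "J - {n}"
  let ?T = "{t \<in> L. Des t \<subset> ?K}"
  have "span (\<Union>j\<in>?K. Inv (J - {j})) = span (block_ind ` ?T)"
  proof
    show "span (\<Union>j\<in>?K. Inv (J - {j})) \<subseteq> span (block_ind ` ?T)"
    proof (rule span_minimal)
      have "Inv (J - {j}) \<subseteq> span (block_ind ` ?T)" if "j \<in> ?K" for j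
      proof -
        have "{t \<in> L. Des t \<subseteq> J - {j}} \<subseteq> ?T" using that Des_L by blast
        then show ?thesis
          using block_ind_span[of "J - {j}"] assms that span_mono[OF image_mono] by blast
      qed
      then show "(\<Union>j\<in>?K. Inv (J - {j})) \<subseteq> span (block_ind ` ?T)" by blast
    qed simp
    show "span (block_ind ` ?T) \<subseteq> span (\<Union>j\<in>?K. Inv (J - {j}))"
    proof (rule span_mono, rule image_subsetI)
      fix t assume "t \<in> ?T"
      then have t: "t \<in> L" "Des t \<subset> ?K" by auto
      then obtain j where j: "j \<in> ?K" "j \<notin> Des t" by blast
      then have "t \<in> {t \<in> L. Des t \<subseteq> J - {j}}" using t by blast
      then have "block_ind t \<in> Inv (J - {j})"
        using block_ind_span[of "J - {j}"] assms j span_base[of "block_ind t" "block_ind ` {t \<in> L. Des t \<subseteq> J - {j}}"] by blast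
      then show "block_ind t \<in> (\<Union>j\<in>?K. Inv (J - {j}))" using j(1) by blast
    qed
  qed
  then have "dim (span (\<Union>j\<in>?K. Inv (J - {j}))) = card ?T"
    using dim_span_block_ind[of ?T] by simp
  moreover have "card {t \<in> L. Des t \<subseteq> J} = card ?T + num_des ?K"
  proof -
    have "{t \<in> L. Des t \<subseteq> J} = ?T \<union> {t \<in> L. Des t = ?K}" using Des_L by auto
    moreover have "?T \<inter> {t \<in> L. Des t = ?K} = {}" by auto
    ultimately show ?thesis using finite_L by (simp add: num_des_def card_Un_disjoint)
  qed
  ultimately show ?thesis using dim_Inv[OF assms] by simp
qed

section \<open>Codimensions and their sums\<close>

lemma Merged_subset_Inv: "Merged J \<subseteq> Inv J"
  unfolding Merged_def by (rule span_minimal[OF _ subspace_Inv]) (use Inv_mono in blast)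

lemma fin_dim_Merged: "fin_dim (Merged J)"
  by (rule fin_dim_mono[OF fin_dim_Inv Merged_subset_Inv])

lemma subspace_Merged: "subspace (Merged J)"
  unfolding Merged_def by simp

lemma dim_Merged_le: "dim (Merged J) \<le> dim (Inv J)"
  by (rule fin_dim_dim_mono[OF fin_dim_Inv Merged_subset_Inv])

text \<open>\<open>Merged J\<close> is the sum of \<open>A\<close>, whose dimension is known from
  the block basis, and the single space \<open>Inv (J - {n})\<close>, which is not adapted to it. By
  Grassmann's formula the only unknown is their intersection.\<close>

lemma new_dim_pair:
  assumes J: "n \<in> J" "J \<noteq> {n}"
  defines "A \<equiv> span (\<Union>j\<in>J - {n}. Inv (J - {j}))"
  shows "Merged (J - {n}) \<subseteq> Inv (J - {n}) \<inter> A"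
    and "new_dim J + new_dim (J - {n}) + dim (Merged (J - {n})) = num_des (J - {n}) + dim (Inv (J - {n}) \<inter> A)"
proof -
  let ?K = "J - {n}"
  have K: "?K \<noteq> {}" using J by blast
  have MMJ: "Merged J = span (A \<union> Inv ?K)"
  proof -
    have "{j \<in> J. J - {j} \<noteq> {}} = insert n ?K" using J K by auto
    then have "Merged J = span ((\<Union>j\<in>?K. Inv (J - {j})) \<union> Inv ?K)"
      unfolding Merged_def by (simp only: UN_insert Un_commute)
    also have "\<dots> = span (A \<union> span (Inv ?K))" unfolding A_def span_Un_span ..
    also have "span (Inv ?K) = Inv ?K" using span_eq_iff subspace_Inv by blast
    finally show ?thesis .
  qed
  have "A \<subseteq> Inv J" unfolding A_def by (rule span_minimal[OF _ subspace_Inv]) (use Inv_mono in blast)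
  then have fA: "fin_dim A" using fin_dim_mono[OF fin_dim_Inv] by blast
  have "subspace A" unfolding A_def by simp
  then have d: "dim (Merged J) + dim (A \<inter> Inv ?K) = dim A + dim (Inv ?K)"
    unfolding MMJ by (intro dim_span_Un_Int fA fin_dim_Inv subspace_Inv)
  have "Inv (?K - {j}) \<subseteq> Inv (J - {j})" for j using Inv_mono[of "?K - {j}" "J - {j}"] by blast
  then have "Merged ?K \<subseteq> A" unfolding Merged_def A_def by (intro span_mono) blast
  then show "Merged ?K \<subseteq> Inv ?K \<inter> A" using Merged_subset_Inv by blast
  show "new_dim J + new_dim ?K + dim (Merged ?K) = num_des ?K + dim (Inv ?K \<inter> A)"
    using d dim_Inv_linear[OF J(1)] dim_Merged_le[of J] dim_Merged_le[of ?K]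
    unfolding new_dim_def A_def by (simp add: Int_commute)
qed

lemma new_dim_pair_ge:
  assumes "n \<in> J" "J \<noteq> {n}"
  shows "num_des (J - {n}) \<le> new_dim J + new_dim (J - {n})"
  using new_dim_pair[OF assms]
    fin_dim_dim_mono[OF fin_dim_mono[OF fin_dim_Inv] new_dim_pair(1)[OF assms]] by fastforce

lemma lower_exact_iff:
  "lower_exact \<longleftrightarrow> (\<forall>J \<subseteq> {1..n}. n \<in> J \<longrightarrow> J \<noteq> {n} \<longrightarrow> new_dim J + new_dim (J - {n}) = num_des (J - {n}))"
proof -
  have "Inv (J - {n}) \<inter> span (\<Union>j\<in>J - {n}. Inv (J - {j})) \<subseteq> Merged (J - {n}) \<longleftrightarrow>
        new_dim J + new_dim (J - {n}) = num_des (J - {n})" if J: "n \<in> J" "J \<noteq> {n}" for J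
  proof -
    let ?B = "Inv (J - {n}) \<inter> span (\<Union>j\<in>J - {n}. Inv (J - {j}))"
    note p = new_dim_pair[OF J]
    have fB: "fin_dim ?B" by (rule fin_dim_mono[OF fin_dim_Inv]) blast
    show ?thesis
    proof
      assume "?B \<subseteq> Merged (J - {n})"
      then have "?B = Merged (J - {n})" using p(1) by blast
      then show "new_dim J + new_dim (J - {n}) = num_des (J - {n})" using p(2) by simp
    next
      assume "new_dim J + new_dim (J - {n}) = num_des (J - {n})"
      then have "dim ?B \<le> dim (Merged (J - {n}))" using p(2) by simp
      then show "?B \<subseteq> Merged (J - {n})"
        using fin_dim_subspace_eq[OF fB p(1) subspace_Merged] by simp
    qed
  qed
  then show ?thesis unfolding lower_exact_def by simp
qed

lemma new_dim_last: "new_dim {n} = dim (Inv {n})"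
proof -
  have "Merged {n} = {0}" unfolding Merged_def by (simp add: span_empty)
  then show ?thesis unfolding new_dim_def by simp
qed

lemma om_Merged:
  assumes J: "J \<subseteq> {1..n}" "J \<noteq> {}"
  shows "(om ^^ k) ` Merged J = Merged (cyc_shift n (int k) J)"
proof -
  have n: "n \<ge> 1" using J by (cases n) auto
  let ?r = "\<lambda>j. cyc_rep n (int j + int k)"
  have "(om ^^ k) ` Merged J = span (\<Union>j\<in>{j \<in> J. J - {j} \<noteq> {}}. (om ^^ k) ` Inv (J - {j}))"
    unfolding Merged_def linear_span_image[OF linear_om_pow, symmetric] image_UN ..
  also have "(\<Union>j\<in>{j \<in> J. J - {j} \<noteq> {}}. (om ^^ k) ` Inv (J - {j})) =
      (\<Union>j\<in>{j \<in> J. J - {j} \<noteq> {}}. Inv (cyc_shift n (int k) J - {?r j}))"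
  proof (rule SUP_cong[OF refl])
    fix j assume "j \<in> {j \<in> J. J - {j} \<noteq> {}}"
    then have j: "J - {j} \<subseteq> {1..n}" "J - {j} \<noteq> {}" "j \<in> {1..n}" using J by auto
    show "(om ^^ k) ` Inv (J - {j}) = Inv (cyc_shift n (int k) J - {?r j})"
      unfolding om_Inv[OF j(1,2)] cyc_shift_diff[OF n J(1) j(3)] ..
  qed
  also have "\<dots> = (\<Union>j\<in>?r ` {j \<in> J. J - {j} \<noteq> {}}. Inv (cyc_shift n (int k) J - {j}))" by simp
  also have "?r ` {j \<in> J. J - {j} \<noteq> {}} = {j \<in> cyc_shift n (int k) J. cyc_shift n (int k) J - {j} \<noteq> {}}"
  proof -
    have "J - {j} \<noteq> {} \<longleftrightarrow> cyc_shift n (int k) J - {?r j} \<noteq> {}" if "j \<in> J" for j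
      using cyc_shift_diff[OF n J(1), of j "int k"] that J by (metis cyc_shift_nonempty subsetD)
    then show ?thesis unfolding cyc_shift_def[of n "int k" J] by auto
  qed
  finally show ?thesis unfolding Merged_def .
qed

lemma dim_om_pow: "A \<subseteq> V \<Longrightarrow> subspace A \<Longrightarrow> dim ((om ^^ k) ` A) = dim A"
  by (rule fin_dim_dim_image_eq[OF linear_om_pow fin_dim_mono[OF fin_dim_V]])
    (auto intro: om_pow_inj)

lemma dim_Inv_shift:
  assumes "J \<subseteq> {1..n}" "J \<noteq> {}"
  shows "dim (Inv (cyc_shift n (int k) J)) = dim (Inv J)"
  unfolding om_Inv[OF assms, symmetric] by (rule dim_om_pow[OF Inv_subset subspace_Inv])

lemma new_dim_shift:
  assumes "J \<subseteq> {1..n}" "J \<noteq> {}"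
  shows "new_dim (cyc_shift n (int k) J) = new_dim J"
proof -
  have "Merged J \<subseteq> V" using Merged_subset_Inv Inv_subset by blast
  then show ?thesis unfolding new_dim_def
    using dim_Inv_shift[OF assms] dim_om_pow[OF _ subspace_Merged, of J k] om_Merged[OF assms, of k] by simp
qed

lemma sum_num_des: "n \<in> I \<Longrightarrow> finite I \<Longrightarrow> (\<Sum>K | K \<subseteq> I - {n}. num_des K) = dim (Inv I)"
proof -
  assume I: "n \<in> I" "finite I"
  have "(\<Sum>K | K \<subseteq> I - {n}. num_des K) = card (\<Union>K\<in>{K. K \<subseteq> I - {n}}. {t \<in> L. Des t = K})"
    unfolding num_des_def using finite_L I(2) by (intro card_UN_disjoint[symmetric]) auto
  also have "(\<Union>K\<in>{K. K \<subseteq> I - {n}}. {t \<in> L. Des t = K}) = {t \<in> L. Des t \<subseteq> I}"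
    using Des_L by auto
  finally show ?thesis using dim_Inv[OF I(1)] by simp
qed

lemma sum_num_des_nonempty:
  assumes "n \<in> I" "finite I"
  shows "new_dim {n} + (\<Sum>K | K \<subseteq> I - {n} \<and> K \<noteq> {}. num_des K) = dim (Inv I)"
proof -
  have eq: "{K. K \<subseteq> I - {n}} = insert {} {K. K \<subseteq> I - {n} \<and> K \<noteq> {}}" by auto
  have "finite {K. K \<subseteq> I - {n} \<and> K \<noteq> {}}" using assms by simp
  then have "(\<Sum>K | K \<subseteq> I - {n}. num_des K) = num_des {} + (\<Sum>K | K \<subseteq> I - {n} \<and> K \<noteq> {}. num_des K)"
    unfolding eq by (subst sum.insert) auto
  moreover have "num_des {} = new_dim {n}" using sum_num_des[of "{n}"] new_dim_last by simp
  ultimately show ?thesis using sum_num_des[OF assms] by simp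
qed

text \<open>For \<open>n \<in> I\<close> the pairs \<open>J\<close>, \<open>J - {n}\<close>
  contribute the numbers of linear extensions by descent set, which add up to
  \<open>dim (Inv I)\<close>. Any other nonempty \<open>I\<close> is first rotated by
  \<open>om\<close> until it contains \<open>n\<close>.\<close>

theorem sum_new_dim:
  assumes lower_exact and I: "I \<subseteq> {1..n}" "I \<noteq> {}"
  shows "(\<Sum>J | J \<subseteq> I \<and> J \<noteq> {}. new_dim J) = dim (Inv I)"
proof -
  have n: "n \<ge> 1" using I by (cases n) auto
  have main: "(\<Sum>J | J \<subseteq> I \<and> J \<noteq> {}. new_dim J) = dim (Inv I)" if I: "I \<subseteq> {1..n}" "n \<in> I" for I
  proof -
    have fI: "finite I" using I(1) finite_subset by blast
    have "(\<Sum>J | J \<subseteq> I \<and> J \<noteq> {}. new_dim J) =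
        new_dim {n} + (\<Sum>K | K \<subseteq> I - {n} \<and> K \<noteq> {}. new_dim (insert n K) + new_dim K)"
      by (rule sum_pairs[OF fI I(2)])
    also have "(\<Sum>K | K \<subseteq> I - {n} \<and> K \<noteq> {}. new_dim (insert n K) + new_dim K) =
        (\<Sum>K | K \<subseteq> I - {n} \<and> K \<noteq> {}. num_des K)"
    proof (rule sum.cong[OF refl])
      fix K assume K: "K \<in> {K. K \<subseteq> I - {n} \<and> K \<noteq> {}}"
      then have "insert n K \<subseteq> {1..n}" "insert n K - {n} = K" "insert n K \<noteq> {n}" using I by auto
      then show "new_dim (insert n K) + new_dim K = num_des K" using assms(1) unfolding lower_exact_iff by (metis insertI1)
    qed
    also have "new_dim {n} + \<dots> = dim (Inv I)" by (rule sum_num_des_nonempty[OF I(2) fI])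
    finally show ?thesis .
  qed
  obtain k where k: "n \<in> cyc_shift n (int k) I" using shift_to_last[OF I] .
  have "(\<Sum>J | J \<subseteq> I \<and> J \<noteq> {}. new_dim J) = (\<Sum>J | J \<subseteq> I \<and> J \<noteq> {}. new_dim (cyc_shift n (int k) J))"
    using I by (intro sum.cong refl new_dim_shift[symmetric]) auto
  also have "\<dots> = (\<Sum>J | J \<subseteq> cyc_shift n (int k) I \<and> J \<noteq> {}. new_dim J)"
    by (rule sum_shift[OF n I(1), symmetric])
  also have "\<dots> = dim (Inv (cyc_shift n (int k) I))" by (rule main[OF cyc_shift_subset[OF n] k])
  also have "\<dots> = dim (Inv I)" by (rule dim_Inv_shift[OF I])
  finally show ?thesis .
qed

end

section \<open>Adding an isolated cell\<close>

text \<open>The module of the extended system is induced from that of \<open>E\<close>: the new cell is incomparable to all others.\<close>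

definition ext_R :: "('c \<Rightarrow> 'c \<Rightarrow> bool) \<Rightarrow> 'c \<Rightarrow> 'c \<Rightarrow> 'c \<Rightarrow> bool" where
  "ext_R R b a c \<longleftrightarrow> R a c \<and> a \<noteq> b \<and> c \<noteq> b"

definition ext_rho :: "('c \<Rightarrow> 'c \<Rightarrow> real) \<Rightarrow> 'c \<Rightarrow> 'c \<Rightarrow> 'c \<Rightarrow> real" where
  "ext_rho rho b a c = (if a = b \<or> c = b then 0 else rho a c)"

locale ext_sys = W: lin_sys E R rho key eps
  for E :: "'c set" and R rho key and eps :: "'c \<Rightarrow> real" +
  fixes b :: 'c
  assumes b: "b \<notin> E" and inj_key_b: "inj_on key (insert b E)"
begin

abbreviation N :: nat where "N \<equiv> card E"

lemma card_insert_b [simp]: "card (insert b E) = Suc N"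
  using b W.finite_D by simp

lemma WL_remove:
  assumes "t \<in> lsys.L (insert b E) (ext_R R b)"
  shows "remove1 b t \<in> W.L"
proof -
  have t: "distinct t" "set t = insert b E" "sorted_wrt (\<lambda>a c. \<not> ext_R R b c a) t"
    using assms unfolding lsys.L_def by auto
  have r: "remove1 b t = filter (\<lambda>a. a \<noteq> b) t"
    using t(1) by (simp add: distinct_remove1_removeAll removeAll_filter_not_eq) metis
  have "sorted_wrt (\<lambda>a c. \<not> ext_R R b c a) (filter (\<lambda>a. a \<noteq> b) t)"
    by (rule sorted_wrt_filter[OF t(3)])
  then have "sorted_wrt (\<lambda>a c. \<not> R c a) (filter (\<lambda>a. a \<noteq> b) t)"
    by (rule sorted_wrt_mono_rel[rotated]) (auto simp: ext_R_def)
  then show ?thesis using t b unfolding r W.L_def by auto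
qed

sublocale P: lin_sys "insert b E" "ext_R R b" "ext_rho rho b" key eps
proof
  show "finite (insert b E)" using W.finite_D by simp
  show "inj_on key (insert b E)" by (rule inj_key_b)
  show "\<not> ext_R R b a a" for a using W.R_irrefl by (simp add: ext_R_def)
  have mid: "\<exists>u' w'. u' @ a # c # w' \<in> W.L" if "u @ a # c # w \<in> lsys.L (insert b E) (ext_R R b)"
    "a \<noteq> b" "c \<noteq> b" for u a c w
  proof (cases "b \<in> set u")
    case True
    then show ?thesis using WL_remove[OF that(1)] that(2,3) by (auto simp: remove1_append)
  next
    case False
    then show ?thesis using WL_remove[OF that(1)] that(2,3) by (auto simp: remove1_append)
  qed
  show "ext_rho rho b a c = (if key a < key c then 1 else - 1)"
    if "u @ a # c # w \<in> lsys.L (insert b E) (ext_R R b)" "ext_R R b a c" for u a c w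
    using mid[OF that(1)] that(2) W.rho_R by (auto simp: ext_R_def ext_rho_def)
  show "\<bar>ext_rho rho b a c\<bar> < 1"
    if "a \<in> insert b E" "c \<in> insert b E" "\<not> ext_R R b a c" "\<not> ext_R R b c a" for a c
    using that W.rho_less by (auto simp: ext_R_def ext_rho_def)
  show "ext_rho rho b c a = - ext_rho rho b a c" for c a
    unfolding ext_rho_def using W.rho_antisym[of c a] by auto
  show "ext_rho rho b a c * ext_rho rho b c d = ext_rho rho b a d * (ext_rho rho b a c + ext_rho rho b c d)"
    if "u @ a # c # d # w \<in> lsys.L (insert b E) (ext_R R b)" for u a c d w
  proof (cases "a = b \<or> c = b \<or> d = b")
    case False
    then have "\<exists>u' w'. u' @ a # c # d # w' \<in> W.L"
      using WL_remove[OF that] by (cases "b \<in> set u") (auto simp: remove1_append, blast)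
    then show ?thesis using False W.rho_rel by (auto simp: ext_rho_def)
  qed (auto simp: ext_rho_def)
  show "ext_rho rho b a c = 0" if "u @ a # c # w \<in> lsys.L (insert b E) (ext_R R b)" "eps a \<noteq> eps c" for u a c w
    using mid[OF that(1)] that(2) W.rho_eps by (auto simp: ext_rho_def)
  show "eps a * eps a = 1" for a by (rule W.eps_sq)
qed

lemma PL_iff: "x @ b # y \<in> P.L \<longleftrightarrow> x @ y \<in> W.L"
proof
  assume L: "x @ b # y \<in> P.L"
  then have "b \<notin> set x" unfolding P.L_def by auto
  then show "x @ y \<in> W.L" using WL_remove[OF L] by (simp add: remove1_append)
next
  assume L: "x @ y \<in> W.L"
  then have bn: "b \<notin> set x" "b \<notin> set y" using b unfolding W.L_def by auto
  have "sorted_wrt (\<lambda>a c. \<not> ext_R R b c a) (x @ y)"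
    using L unfolding W.L_def by (auto intro: sorted_wrt_mono_rel[rotated] simp: ext_R_def)
  then show "x @ b # y \<in> P.L"
    using L bn unfolding P.L_def W.L_def by (auto simp: sorted_wrt_append ext_R_def)
qed

lemma PL_split:
  assumes "t \<in> P.L"
  obtains x y where "t = x @ b # y" "x @ y \<in> W.L" "b \<notin> set x"
proof -
  have "b \<in> set t" using assms unfolding P.L_def by auto
  then obtain x y where "t = x @ b # y" "b \<notin> set x" by (metis split_list_first)
  then show ?thesis using that assms PL_iff by blast
qed

definition ins :: "nat \<Rightarrow> 'c list \<Rightarrow> 'c list" where
  "ins q t = take (q - 1) t @ b # drop (q - 1) t"

text \<open>The component of \<open>f\<close> in which \<open>b\<close> stands at position
  \<open>q\<close>, counted from 1. The induced module is the direct sum of these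
  \<open>N + 1\<close> copies of the module of \<open>E\<close>.\<close>

definition pos :: "nat \<Rightarrow> ('c list \<Rightarrow> real) \<Rightarrow> 'c list \<Rightarrow> real" where
  "pos q f t = (if t \<in> W.L then f (ins q t) else 0)"

lemma ins_in_PL: "t \<in> W.L \<Longrightarrow> ins q t \<in> P.L"
  unfolding ins_def by (simp add: PL_iff)

lemma ins_append [simp]: "q = Suc (length x) \<Longrightarrow> ins q (x @ y) = x @ b # y"
  unfolding ins_def by simp

lemma pos_in_V [simp]: "pos q f \<in> W.V"
  unfolding W.V_def pos_def by simp

lemma linear_pos: "linear (pos q)"
  by (rule linearI) (auto simp: pos_def fun_eq_iff)

lemma P_ext:
  assumes "f \<in> P.V" "g \<in> P.V" "\<And>q. 1 \<le> q \<Longrightarrow> q \<le> Suc N \<Longrightarrow> pos q f = pos q g"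
  shows "f = g"
proof
  fix t
  show "f t = g t"
  proof (cases "t \<in> P.L")
    case True
    then obtain x y where t: "t = x @ b # y" "x @ y \<in> W.L" using PL_split by metis
    have "length x \<le> N" using W.length_L[OF t(2)] by simp
    then have "pos (Suc (length x)) f (x @ y) = pos (Suc (length x)) g (x @ y)" using assms(3) by simp
    then show ?thesis using t by (simp add: pos_def)
  next
    case False
    then show ?thesis using P.V_outside[OF assms(1)] P.V_outside[OF assms(2)] by simp
  qed
qed

lemma pos_append:
  assumes "f \<in> P.V" "q = Suc (length x)"
  shows "pos q f (x @ y) = f (x @ b # y)"
  using P.V_outside[OF assms(1), of "x @ b # y"] assms(2) by (auto simp: pos_def PL_iff)

lemma W_split_q:
  assumes "t \<in> W.L" "1 \<le> q" "q \<le> Suc N"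
  obtains x y where "t = x @ y" "q = Suc (length x)"
  using that[of "take (q - 1) t" "drop (q - 1) t"] W.length_L[OF assms(1)] assms(2,3) by simp

lemma E_not_b: "u @ a # c # w \<in> W.L \<Longrightarrow> a \<noteq> b \<and> c \<noteq> b"
  using b unfolding W.L_def by auto

text \<open>Since \<open>ext_rho\<close> vanishes at \<open>b\<close>, a swap involving
  \<open>b\<close> merely exchanges two neighbouring components. Any other swap acts inside each
  component, with its index lowered by one when it takes place behind \<open>b\<close>.\<close>

lemma pos_S:
  assumes f: "f \<in> P.V" and "1 \<le> i" "i \<le> N" "1 \<le> q" "q \<le> Suc N"
  shows "Suc i < q \<Longrightarrow> pos q (P.S i f) = W.S i (pos q f)"
    and "q < i \<Longrightarrow> pos q (P.S i f) = W.S (i - 1) (pos q f)"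
    and "q = i \<Longrightarrow> pos q (P.S i f) = pos (Suc i) f"
    and "q = Suc i \<Longrightarrow> pos q (P.S i f) = pos i f"
proof -
  have *: "pos q (P.S i f) t = (if Suc i < q then W.S i (pos q f) t else if q < i then W.S (i - 1) (pos q f) t
     else if q = i then pos (Suc i) f t else pos i f t)" for t
  proof (cases "t \<in> W.L")
    case False
    then show ?thesis by (simp add: pos_def W.S_outside)
  next
    case True
    then obtain x y where t: "t = x @ y" and q: "q = Suc (length x)" using W_split_q assms by metis
    have L: "x @ b # y \<in> P.L" using True unfolding t PL_iff .
    have len: "length x + length y = N" using W.length_L[OF True] unfolding t by simp
    have p: "pos q (P.S i f) t = P.S i f (x @ b # y)" using True q unfolding t pos_def by simp
    consider "Suc i < q" | "q < i" | "q = i" | "q = Suc i" by linarith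
    then show ?thesis
    proof cases
      case 1
      then have "i < length x" using q by simp
      then obtain u a c w where x: "x = u @ a # c # w" and i: "i = Suc (length u)"
        using split_at_pair[OF assms(2), of x] by metis
      have WL: "u @ a # c # (w @ y) \<in> W.L" using True unfolding t x by simp
      have PL: "u @ a # c # (w @ b # y) \<in> P.L" using L unfolding x by simp
      have "pos q f (u @ a # c # (w @ y)) = f (u @ a # c # (w @ b # y))"
        "pos q f (u @ c # a # (w @ y)) = f (u @ c # a # (w @ b # y))"
        using pos_append[OF f, of q "u @ a # c # w" y] pos_append[OF f, of q "u @ c # a # w" y] q x by auto
      then show ?thesis
        using 1 p W.S_append[OF WL, of "pos q f"] P.S_append[OF PL, of f] E_not_b[OF WL]
        unfolding t x i by (simp add: ext_rho_def)
    next
      case 2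
      then have "1 \<le> i - q" "i - q < length y" using q len assms by auto
      then obtain u a c w where y: "y = u @ a # c # w" and i: "i - q = Suc (length u)"
        using split_at_pair by metis
      have i1: "i - 1 = Suc (length (x @ u))" "i = Suc (length (x @ b # u))" using i q 2 by auto
      have WL: "(x @ u) @ a # c # w \<in> W.L" using True unfolding t y by simp
      have PL: "(x @ b # u) @ a # c # w \<in> P.L" using L unfolding y by simp
      have "pos q f ((x @ u) @ a # c # w) = f ((x @ b # u) @ a # c # w)"
        "pos q f ((x @ u) @ c # a # w) = f ((x @ b # u) @ c # a # w)"
        using pos_append[OF f q, of "u @ a # c # w"] pos_append[OF f q, of "u @ c # a # w"] by auto
      then show ?thesis
        using 2 p W.S_append[OF WL, of "pos q f", folded i1] P.S_append[OF PL, of f, folded i1] E_not_b[OF WL]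
        unfolding t y by (simp add: ext_rho_def)
    next
      case 3
      then obtain c y' where y: "y = c # y'" using len assms q by (cases y) auto
      have PL: "x @ b # c # y' \<in> P.L" using L unfolding y .
      have "P.S i f (x @ b # c # y') = f ((x @ [c]) @ b # y')"
        using P.S_append[OF PL, of f] 3 q by (simp add: ext_rho_def)
      then show ?thesis using 3 p pos_append[OF f, of "Suc i" "x @ [c]" y'] q unfolding t y by simp
    next
      case 4
      then have "x \<noteq> []" using assms q by auto
      then obtain x' c where x: "x = x' @ [c]" by (metis rev_exhaust)
      have PL: "x' @ c # b # y \<in> P.L" using L unfolding x by simp
      have i: "i = Suc (length x')" using 4 q x by simp
      have "P.S i f (x' @ c # b # y) = f (x' @ b # c # y)"
        using P.S_append[OF PL, of f] i by (simp add: ext_rho_def)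
      then show ?thesis using 4 p pos_append[OF f i, of "c # y"] unfolding t x by simp
    qed
  qed
  show "Suc i < q \<Longrightarrow> pos q (P.S i f) = W.S i (pos q f)"
    and "q < i \<Longrightarrow> pos q (P.S i f) = W.S (i - 1) (pos q f)"
    and "q = i \<Longrightarrow> pos q (P.S i f) = pos (Suc i) f"
    and "q = Suc i \<Longrightarrow> pos q (P.S i f) = pos i f"
    using * by (auto simp: fun_eq_iff)
qed

lemma pos_foldr_before:
  assumes "f \<in> P.V" "q \<le> Suc N" "\<forall>i\<in>set is. 1 \<le> i \<and> Suc i < q"
  shows "pos q (foldr P.S is f) = foldr W.S is (pos q f)"
  using assms(3)
proof (induction "is")
  case (Cons i js)
  then show ?case using pos_S(1)[of "foldr P.S js f" i q] P.foldr_S_in_V[OF assms(1)] assms(2) by simp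
qed simp

lemma pos_foldr_after:
  assumes "f \<in> P.V" "1 \<le> q" "q \<le> Suc N" "\<forall>i\<in>set is. q < i \<and> i \<le> N"
  shows "pos q (foldr P.S is f) = foldr W.S (map (\<lambda>i. i - 1) is) (pos q f)"
  using assms(4)
proof (induction "is")
  case (Cons i js)
  then show ?case using pos_S(2)[of "foldr P.S js f" i q] P.foldr_S_in_V[OF assms(1)] assms(2,3) by simp
qed simp

lemma pos_om:
  assumes f: "f \<in> P.V" and q: "1 \<le> q" "q \<le> N"
  shows "pos (Suc q) (P.om f) = W.om (pos q f)"
proof -
  let ?g = "foldr P.S [Suc q..<Suc N] f"
  have g: "?g \<in> P.V" by (rule P.foldr_S_in_V[OF f])
  have split: "[1..<Suc N] = [1..<q] @ q # [Suc q..<Suc N]"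
    using q upt_add_eq_append[of 1 q "Suc N - q"] by (simp add: upt_conv_Cons)
  have "P.cox f = foldr P.S [1..<q] (P.S q ?g)"
    using fun_cong[OF P.cox_def, of f] unfolding card_insert_b split by simp
  then have "pos (Suc q) (P.cox f) = foldr W.S [1..<q] (pos (Suc q) (P.S q ?g))"
    using q pos_foldr_before[of "P.S q ?g" "Suc q" "[1..<q]"] by simp
  also have "pos (Suc q) (P.S q ?g) = pos q ?g"
    using pos_S(4)[OF g q, of "Suc q"] q by simp
  also have "pos q ?g = foldr W.S (map (\<lambda>i. i - 1) [Suc q..<Suc N]) (pos q f)"
    using q by (intro pos_foldr_after[OF f]) auto
  also have "map (\<lambda>i. i - 1) [Suc q..<Suc N] = [q..<N]"
    by (rule nth_equalityI) (auto simp del: upt_Suc)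
  also have "foldr W.S [1..<q] (foldr W.S [q..<N] (pos q f)) = W.cox (pos q f)"
    unfolding W.cox_def using q upt_add_eq_append[of 1 q "N - q"] by (simp flip: foldr_append)
  finally have c: "pos (Suc q) (P.cox f) = W.cox (pos q f)" .
  have "pos (Suc q) (P.X 1 h) = W.X 1 (pos (Suc q) h)" for h
  proof
    fix t
    show "pos (Suc q) (P.X 1 h) t = W.X 1 (pos (Suc q) h) t"
    proof (cases "t \<in> W.L")
      case True
      then have "t \<noteq> []" using W.length_L q by fastforce
      then have "ins (Suc q) t ! 0 = t ! 0" using q unfolding ins_def by (cases t; cases q) auto
      then show ?thesis using True by (simp add: pos_def P.X_def W.X_def)
    qed (simp add: pos_def W.X_def)
  qed
  then show ?thesis unfolding P.om_def W.om_def c[symmetric] .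
qed

lemma pos_om_1:
  assumes f: "f \<in> P.V"
  shows "pos 1 (P.om f) = eps b *\<^sub>R pos (Suc N) f"
proof -
  have "pos q (foldr P.S [q..<Suc N] f) = pos (Suc N) f" if "1 \<le> q" "q \<le> Suc N" for q
    using that(2,1)
  proof (induction q rule: inc_induct)
    case (step q)
    have "[q..<Suc N] = q # [Suc q..<Suc N]" using step by (simp add: upt_conv_Cons)
    then show ?case using step pos_S(3)[OF P.foldr_S_in_V[OF f], of q q "[Suc q..<Suc N]"] by simp
  qed simp
  then have "pos 1 (P.cox f) = pos (Suc N) f"
    using fun_cong[OF P.cox_def, of f] by simp
  moreover have "pos 1 (P.X 1 h) = eps b *\<^sub>R pos 1 h" for h
    by (auto simp: fun_eq_iff pos_def P.X_def ins_def)
  ultimately show ?thesis unfolding P.om_def by simp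
qed

text \<open>\<open>P.om\<close> moves the component \<open>q\<close> to \<open>q + 1\<close> and
  applies \<open>W.om\<close> to it. When \<open>b\<close> passes from the last position to the
  first, the factor \<open>eps b\<close> appears in place of \<open>W.om\<close>, hence the exponent
  \<open>k - 1\<close>.\<close>

lemma pos_om_pow:
  assumes f: "f \<in> P.V" and "k \<le> Suc N" "1 \<le> q" "q \<le> Suc N"
  shows "pos q ((P.om ^^ k) f) = (if k < q then (W.om ^^ k) (pos (q - k) f)
           else eps b *\<^sub>R (W.om ^^ (k - 1)) (pos (q + Suc N - k) f))"
  using assms(2-4)
proof (induction k arbitrary: q)
  case (Suc k)
  have V: "(P.om ^^ k) f \<in> P.V" using f by simp
  show ?case
  proof (cases "q = 1")
    case True
    have "pos 1 ((P.om ^^ Suc k) f) = eps b *\<^sub>R pos (Suc N) ((P.om ^^ k) f)"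
      using pos_om_1[OF V] by simp
    then show ?thesis using True Suc.IH[of "Suc N"] Suc.prems by simp
  next
    case False
    then obtain r where r: "q = Suc r" "1 \<le> r" "r \<le> N" using Suc.prems by (cases q) auto
    have "pos q ((P.om ^^ Suc k) f) = W.om (pos r ((P.om ^^ k) f))"
      using pos_om[OF V r(2,3)] r by simp
    also have "pos r ((P.om ^^ k) f) = (if k < r then (W.om ^^ k) (pos (r - k) f)
           else eps b *\<^sub>R (W.om ^^ (k - 1)) (pos (r + Suc N - k) f))"
      using Suc.IH[of r] Suc.prems r by simp
    also have "W.om \<dots> = (if k < r then (W.om ^^ Suc k) (pos (r - k) f)
           else eps b *\<^sub>R (W.om ^^ Suc (k - 1)) (pos (r + Suc N - k) f))"
      by (simp add: linear_scale[OF W.linear_om])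
    finally show ?thesis using r Suc.prems by (cases k) auto
  qed
qed simp

text \<open>Places \<open>b\<close> in all positions after \<open>p\<close>.\<close>

definition emb :: "nat \<Rightarrow> ('c list \<Rightarrow> real) \<Rightarrow> 'c list \<Rightarrow> real" where
  "emb p y t = (if t \<in> P.L \<and> b \<notin> set (take p t) then y (remove1 b t) else 0)"

lemma emb_in_V [simp]: "emb p y \<in> P.V"
  unfolding P.V_def emb_def by simp

lemma linear_emb: "linear (emb p)"
  by (rule linearI) (auto simp: emb_def fun_eq_iff)

lemma pos_emb:
  assumes "y \<in> W.V" "1 \<le> q" "q \<le> Suc N"
  shows "pos q (emb p y) = (if p < q then y else 0)"
proof
  fix t
  show "pos q (emb p y) t = (if p < q then y else 0) t"
  proof (cases "t \<in> W.L")
    case True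
    then obtain x z where t: "t = x @ z" and q: "q = Suc (length x)" using W_split_q assms by metis
    have bn: "b \<notin> set x" "b \<notin> set z" using True b unfolding t W.L_def by auto
    have "b \<in> set (take p (x @ b # z)) \<longleftrightarrow> length x < p"
      using bn set_take_subset[of p x] by (cases "p - length x") (auto simp: take_Cons')
    then show ?thesis using True bn q unfolding t pos_def emb_def
      by (auto simp: PL_iff remove1_append)
  qed (simp add: pos_def W.V_outside[OF assms(1)])
qed

lemma P_in_U_iff:
  assumes "f \<in> P.V" "1 \<le> i" "i \<le> N"
  shows "f \<in> P.U i \<longleftrightarrow> (\<forall>q. 1 \<le> q \<and> q \<le> Suc N \<longrightarrow> pos q (P.S i f) = pos q f)"
  using assms P_ext[of "P.S i f" f] unfolding P.U_def by auto

text \<open>At \<open>i = p\<close> the swap would compare a component \<open>y\<close> with a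
  component 0. For all other \<open>i\<close> the exchanged components are equal, and the remaining
  ones ask for invariance of \<open>y\<close> under \<open>W.S i\<close> or
  \<open>W.S (i - 1)\<close>.\<close>

lemma emb_in_U:
  assumes y: "y \<in> W.V" and i: "1 \<le> i" "i \<le> N" "i \<noteq> p"
    and 1: "i < p \<Longrightarrow> i < N \<Longrightarrow> y \<in> W.U i" and 2: "\<And>j. p < i \<Longrightarrow> p < j \<Longrightarrow> j < N \<Longrightarrow> y \<in> W.U j"
  shows "emb p y \<in> P.U i"
  unfolding P_in_U_iff[OF emb_in_V i(1,2)]
proof (intro allI impI)
  fix q assume q: "1 \<le> q \<and> q \<le> Suc N"
  have U: "W.S j y = y" if "y \<in> W.U j" "j < N" for j using that unfolding W.U_def by auto
  have S0: "W.S j 0 = 0" for j using linear_0[OF W.linear_S] .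
  note S = pos_S[OF emb_in_V i(1,2) conjunct1[OF q] conjunct2[OF q], of p y]
  note pe = pos_emb[OF y, of _ p]
  consider "Suc i < q" | "q < i" | "q = i" | "q = Suc i" by linarith
  then show "pos q (P.S i (emb p y)) = pos q (emb p y)"
  proof cases
    case 1
    show ?thesis
    proof (cases "p < q")
      case True
      have "y \<in> W.U i" using assms(5,6) 1 q i by (cases "i < p") auto
      then show ?thesis using S(1)[OF 1] pe q U[of i] 1 True by simp
    qed (use S(1)[OF 1] pe q S0 in simp)
  next
    case 2
    show ?thesis
    proof (cases "p < q")
      case True
      have "y \<in> W.U (i - 1)" "i - 1 < N" using assms(6)[of "i - 1"] 2 q i True by auto
      then show ?thesis using S(2)[OF 2] pe q U[of "i - 1"] True by simp
    qed (use S(2)[OF 2] pe q S0 in simp)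
  next
    case 3
    then show ?thesis using S(3)[OF 3] pe q i by auto
  next
    case 4
    then show ?thesis using S(4)[OF 4] pe q i by auto
  qed
qed

end

text \<open>On the empty set the value is 0, so that \<open>emb (max0 K)\<close> puts
  \<open>b\<close> in every position.\<close>

definition max0 :: "nat set \<Rightarrow> nat" where
  "max0 K = Max (insert 0 K)"

lemma max0_in: "finite K \<Longrightarrow> K \<noteq> {} \<Longrightarrow> max0 K \<in> K \<or> max0 K = 0"
  unfolding max0_def using Max_in[of "insert 0 K"] by auto

lemma max0_ge: "finite K \<Longrightarrow> k \<in> K \<Longrightarrow> k \<le> max0 K"
  unfolding max0_def by simp

lemma max0_empty [simp]: "max0 {} = 0"
  unfolding max0_def by simp

lemma max0_mem:
  assumes "K \<subseteq> {1..m}" "K \<noteq> {}"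
  shows "max0 K \<in> K"
proof -
  have f: "finite K" using assms finite_subset by blast
  obtain k where "k \<in> K" using assms by blast
  then have "max0 K \<noteq> 0" using max0_ge[OF f, of k] assms by fastforce
  then show ?thesis using max0_in[OF f assms(2)] by simp
qed

lemma max0_eqI:
  assumes "finite K" "p \<in> K" "\<And>k. k \<in> K \<Longrightarrow> k \<le> p"
  shows "max0 K = p"
  unfolding max0_def using assms by (intro Max_eqI) auto

lemma cyc_rep_eqI: "r \<in> {1..m} \<Longrightarrow> i mod int m = int r mod int m \<Longrightarrow> cyc_rep m i = r"
  using cyc_rep_cong cyc_rep_id by metis

text \<open>An index set is read as a cyclic composition, its elements being the last positions of
  the blocks. The rotation by \<open>- p\<close> makes the block before the last one of
  \<open>J\<close> the last in turn. Deleting \<open>Suc N\<close> then leaves, up to rotation on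
  \<open>N\<close> points, the composition in which the last two blocks of \<open>J\<close> are
  merged and have lost one position.\<close>

lemma frame_shift:
  assumes J: "J \<subseteq> {1..Suc N}" "Suc N \<in> J" and K: "K = J - {Suc N}" "K \<noteq> {}" and p: "p = max0 K"
    and Y: "Y = cyc_shift (Suc N) (- int p) J - {Suc N}"
  shows "Y = insert (Suc N - p) ((\<lambda>j. j + Suc N - p) ` (K - {p}))"
    and "cyc_shift N (int (p - 1)) Y = insert N (K - {p})"
    and "cyc_shift N (int (p - 1)) (Y - {Suc N - p}) = K - {p}"
    and "Y - {Suc N - p} = (\<lambda>j. j + Suc N - p) ` (K - {p})"
    and "max0 Y = Suc N - p + max0 (K - {p})"
    and "Suc N \<in> cyc_shift (Suc N) (- int p) J"
proof -
  have KN: "K \<subseteq> {1..N}" using J K by (auto simp: le_Suc_eq)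
  have fK: "finite K" using KN finite_subset by blast
  have pK: "p \<in> K" using max0_mem[OF KN K(2)] p by simp
  then have p1: "1 \<le> p" "p \<le> N" using KN by auto
  have less: "1 \<le> j" "j < p" if "j \<in> K - {p}" for j
    using that max0_ge[OF fK, of j] KN p by auto
  have r1: "cyc_rep (Suc N) (int j + - int p) = j + Suc N - p" if "j \<in> K - {p}" for j
  proof (rule cyc_rep_eqI)
    have "int (j + Suc N - p) = int j + - int p + int (Suc N)" using less[OF that] p1 by simp
    then show "(int j + - int p) mod int (Suc N) = int (j + Suc N - p) mod int (Suc N)" by simp
  qed (use less[OF that] p1 in auto)
  have r2: "cyc_rep (Suc N) (int p + - int p) = Suc N"
    by (rule cyc_rep_eqI) auto
  have r3: "cyc_rep (Suc N) (int (Suc N) + - int p) = Suc N - p"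
    by (rule cyc_rep_eqI) (use p1 in \<open>auto simp: of_nat_diff\<close>)
  have "J = insert (Suc N) (insert p (K - {p}))" using J K pK by auto
  then have "cyc_shift (Suc N) (- int p) J =
      insert (Suc N - p) (insert (Suc N) ((\<lambda>j. cyc_rep (Suc N) (int j + - int p)) ` (K - {p})))"
    unfolding cyc_shift_def using r2 r3 by (metis (no_types, lifting) image_insert)
  also have "(\<lambda>j. cyc_rep (Suc N) (int j + - int p)) ` (K - {p}) = (\<lambda>j. j + Suc N - p) ` (K - {p})"
    by (rule image_cong[OF refl r1])
  finally have unshift: "cyc_shift (Suc N) (- int p) J =
      insert (Suc N - p) (insert (Suc N) ((\<lambda>j. j + Suc N - p) ` (K - {p})))" .
  then show "Suc N \<in> cyc_shift (Suc N) (- int p) J" by simp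
  have "Suc N \<notin> (\<lambda>j. j + Suc N - p) ` (K - {p})" "Suc N - p \<noteq> Suc N"
    using less p1 by (fastforce, simp)
  then show Yeq: "Y = insert (Suc N - p) ((\<lambda>j. j + Suc N - p) ` (K - {p}))"
    unfolding Y unshift by auto
  have "Suc N - p \<notin> (\<lambda>j. j + Suc N - p) ` (K - {p})" using less p1 by fastforce
  then show Yd: "Y - {Suc N - p} = (\<lambda>j. j + Suc N - p) ` (K - {p})" unfolding Yeq by auto
  have s1: "cyc_rep N (int (j + Suc N - p) + int (p - 1)) = j" if "j \<in> K - {p}" for j
  proof (rule cyc_rep_eqI)
    have "int (j + Suc N - p) + int (p - 1) = int j + int N" using less[OF that] p1 by simp
    then show "(int (j + Suc N - p) + int (p - 1)) mod int N = int j mod int N" by simp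
  qed (use less[OF that] p1 in auto)
  have s2: "cyc_rep N (int (Suc N - p) + int (p - 1)) = N"
    by (rule cyc_rep_eqI) (use p1 in \<open>auto simp: of_nat_diff\<close>)
  have img: "(\<lambda>j. cyc_rep N (int (j + Suc N - p) + int (p - 1))) ` (K - {p}) = K - {p}"
    using s1 by force
  show "cyc_shift N (int (p - 1)) (Y - {Suc N - p}) = K - {p}"
    unfolding Yd cyc_shift_def image_image by (rule img)
  show "cyc_shift N (int (p - 1)) Y = insert N (K - {p})"
    unfolding Yeq cyc_shift_def image_insert image_image s2 img ..
  show "max0 Y = Suc N - p + max0 (K - {p})"
  proof (cases "K - {p} = {}")
    case True
    show ?thesis unfolding Yeq True by (simp add: max0_def)
  next
    case False
    have m: "max0 (K - {p}) \<in> K - {p}" using max0_mem[of "K - {p}" N] KN False by blast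
    have "max0 Y = max0 (K - {p}) + Suc N - p"
    proof (rule max0_eqI)
      show "finite Y" unfolding Yeq using fK by simp
      show "max0 (K - {p}) + Suc N - p \<in> Y" unfolding Yeq using m by blast
      fix k assume "k \<in> Y"
      then consider "k = Suc N - p" | j where "j \<in> K - {p}" "k = j + Suc N - p"
        unfolding Yeq by blast
      then show "k \<le> max0 (K - {p}) + Suc N - p"
      proof cases
        case 2
        then have "j \<le> max0 (K - {p})" using max0_ge[of "K - {p}" j] fK by simp
        then show ?thesis using 2 by simp
      qed (use p1 in simp)
    qed
    then show ?thesis using p1 by simp
  qed
qed

section \<open>Invariants of the induced module, by the block that contains \<open>b\<close>\<close>

context ext_sys
begin

text \<open>With \<open>J\<close> read as a composition, \<open>b\<close> is spread over the last
  block, the positions after \<open>max0\<close>, and \<open>y\<close> is invariant for the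
  composition of \<open>N\<close> in which this block is shortened by one.\<close>

lemma emb_Inv:
  assumes J: "J \<subseteq> {1..Suc N}" "Suc N \<in> J"
    and y: "y \<in> W.Inv (insert N (J - {Suc N}))"
  shows "emb (max0 (J - {Suc N})) y \<in> P.Inv J"
proof -
  let ?K = "J - {Suc N}"
  let ?p = "max0 ?K"
  have fK: "finite ?K" using J(1) finite_subset by blast
  have yV: "y \<in> W.V" using y W.Inv_subset by blast
  have "emb ?p y \<in> P.U i" if "i \<in> {1..P.n} - J" for i
  proof (rule emb_in_U[OF yV])
    show i: "1 \<le> i" "i \<le> N" using that J(2) by (auto simp: le_Suc_eq)
    show "i \<noteq> ?p"
    proof
      assume "i = ?p"
      then have "?K \<noteq> {}" using i max0_empty by (metis not_one_le_zero)
      moreover have "?K \<subseteq> {1..Suc N}" using J(1) by blast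
      ultimately show False using max0_mem[of ?K "Suc N"] that \<open>i = ?p\<close> by auto
    qed
    show "y \<in> W.U i" if "i < N" using y i that \<open>i \<in> {1..P.n} - J\<close> unfolding W.Inv_def by auto
    show "y \<in> W.U j" if "?p < j" "j < N" for j
    proof -
      have "j \<notin> ?K" using max0_ge[OF fK, of j] that by auto
      then show ?thesis using y that unfolding W.Inv_def by auto
    qed
  qed
  then show ?thesis unfolding P.Inv_def by simp
qed

text \<open>Dropping \<open>j\<close> leaves the last block as it is, so the same \<open>emb\<close>
  already lies in \<open>Inv (J - {j})\<close>.\<close>

lemma emb_inner:
  assumes J: "J \<subseteq> {1..Suc N}" "Suc N \<in> J" and j: "j \<in> J - {Suc N}" "j \<noteq> max0 (J - {Suc N})"
    and y: "y \<in> W.Inv (insert N (J - {Suc N} - {j}))"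
  shows "emb (max0 (J - {Suc N})) y \<in> P.Merged J"
proof -
  have K: "J - {Suc N} \<subseteq> {1..Suc N}" "J - {Suc N} \<noteq> {}" using J j by auto
  then have f: "finite (J - {Suc N})" using finite_subset by blast
  have "max0 (J - {j} - {Suc N}) = max0 (J - {Suc N})"
    using max0_mem[OF K] j max0_ge[OF f] f by (intro max0_eqI) auto
  moreover have "J - {Suc N} - {j} = J - {j} - {Suc N}" by blast
  ultimately have "emb (max0 (J - {Suc N})) y \<in> P.Inv (J - {j})"
    using emb_Inv[of "J - {j}" y] J j y by auto
  moreover have "j \<in> {j \<in> J. J - {j} \<noteq> {}}" using J j by auto
  ultimately show ?thesis unfolding P.Merged_def by (intro span_base) blast
qed

text \<open>The relation that moves \<open>b\<close> between blocks. If \<open>y\<close> is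
  invariant for the last two blocks merged, spreading \<open>b\<close> over both gives a vector of
  \<open>Inv (J - {p})\<close>, hence of \<open>Merged J\<close>. Its part with \<open>b\<close> in
  the last block is \<open>emb p y\<close>; the part with \<open>b\<close> in the block before is a
  vector of the same kind, seen from the frame rotated by \<open>p\<close>. Modulo
  \<open>Merged J\<close> each is the negative of the other.\<close>

lemma emb_merge_left:
  assumes J: "J \<subseteq> {1..Suc N}" "Suc N \<in> J" and K: "K = J - {Suc N}" "K \<noteq> {}" and p: "p = max0 K"
    and Y: "Y = cyc_shift (Suc N) (- int p) J - {Suc N}"
    and y: "y \<in> W.Inv (insert N (K - {p}))"
  obtains z where "z \<in> W.Inv Y" "emb p y + (P.om ^^ p) (emb (max0 Y) z) \<in> P.Merged J"
    "y \<in> W.Inv (K - {p}) \<Longrightarrow> K - {p} \<noteq> {} \<Longrightarrow> z \<in> W.Inv (Y - {Suc N - p})"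
proof -
  note fs = frame_shift[OF J K p Y]
  have KN: "K \<subseteq> {1..N}" using J K by (auto simp: le_Suc_eq)
  have pK: "p \<in> K" using max0_mem[OF KN K(2)] p by simp
  then have p1: "1 \<le> p" "p \<le> N" using KN by auto
  have YN: "Y \<subseteq> {1..N}" "Y \<noteq> {}"
  proof -
    have "Y \<subseteq> {1..Suc N} - {Suc N}" unfolding Y using cyc_shift_subset[of "Suc N"] by auto
    then show "Y \<subseteq> {1..N}" by (auto simp: le_Suc_eq)
    show "Y \<noteq> {}" unfolding fs(1) by simp
  qed
  have yV: "y \<in> W.V" using y W.Inv_subset by blast
  have "eps b *\<^sub>R y \<in> W.Inv (insert N (K - {p}))"
    using y W.subspace_Inv subspace_scale by blast
  also have "\<dots> = (W.om ^^ (p - 1)) ` W.Inv Y" unfolding W.om_Inv[OF YN] fs(2) ..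
  \<comment> \<open>\<open>z\<close> is chosen to absorb the factor \<open>eps b\<close> and the
    power of \<open>W.om\<close> that \<open>pos_om_pow\<close> produces when \<open>b\<close> wraps
    round.\<close>
  finally obtain z where z: "z \<in> W.Inv Y" "eps b *\<^sub>R y = (W.om ^^ (p - 1)) z" by blast
  have zV: "z \<in> W.V" using z W.Inv_subset by blast
  have y_eq: "eps b *\<^sub>R (W.om ^^ (p - 1)) z = y"
    using W.eps_sq[of b] unfolding z(2)[symmetric] by simp
  let ?p' = "max0 (K - {p})"
  have p': "?p' < p" "max0 Y = Suc N - p + ?p'"
  proof -
    show "?p' < p"
    proof (cases "K - {p} = {}")
      case True
      show ?thesis unfolding True using p1 by simp
    next
      case False
      then have "?p' \<in> K - {p}" using max0_mem[of "K - {p}" N] KN by blast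
      then show ?thesis using max0_ge[of K ?p'] KN p finite_subset[OF KN] by fastforce
    qed
  qed (rule fs(5))
  have "emb p y + (P.om ^^ p) (emb (max0 Y) z) = emb ?p' y"
  proof (rule P_ext)
    show "emb p y + (P.om ^^ p) (emb (max0 Y) z) \<in> P.V"
      using subspace_add[OF P.subspace_V] by simp
    fix q assume q: "1 \<le> q" "q \<le> Suc N"
    have pp: "pos q ((P.om ^^ p) (emb (max0 Y) z)) = (if p < q then 0 else if ?p' < q then y else 0)"
    proof (cases "p < q")
      case True
      then have "pos (q - p) (emb (max0 Y) z) = 0" using pos_emb[OF zV, of "q - p" "max0 Y"] q p' p1 by auto
      then show ?thesis using True pos_om_pow[OF emb_in_V, of p q] q p1 linear_0[OF W.linear_om_pow] by simp
    next
      case False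
      then have "pos (q + Suc N - p) (emb (max0 Y) z) = (if ?p' < q then z else 0)"
        using pos_emb[OF zV, of "q + Suc N - p" "max0 Y"] q p' p1 by auto
      then show ?thesis using False pos_om_pow[OF emb_in_V, of p q "max0 Y" z] q p1 y_eq
          linear_0[OF W.linear_om_pow] by simp
    qed
    show "pos q (emb p y + (P.om ^^ p) (emb (max0 Y) z)) = pos q (emb ?p' y)"
      unfolding linear_add[OF linear_pos] pp pos_emb[OF yV q] using p'(1) by auto
  qed simp
  moreover have "emb ?p' y \<in> P.Merged J"
  proof -
    have eq: "J - {p} - {Suc N} = K - {p}" using K by blast
    have "emb ?p' y \<in> P.Inv (J - {p})"
      using emb_Inv[of "J - {p}" y] J y p1 unfolding eq by auto
    moreover have "p \<in> {j \<in> J. J - {j} \<noteq> {}}" using J K pK p1 by auto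
    ultimately show ?thesis unfolding P.Merged_def by (intro span_base) blast
  qed
  ultimately have 2: "emb p y + (P.om ^^ p) (emb (max0 Y) z) \<in> P.Merged J" by simp
  have 3: "z \<in> W.Inv (Y - {Suc N - p})" if "y \<in> W.Inv (K - {p})" "K - {p} \<noteq> {}"
  proof -
    have Yd: "Y - {Suc N - p} \<subseteq> {1..N}" "Y - {Suc N - p} \<noteq> {}"
      using YN fs(4) that(2) by auto
    have "eps b *\<^sub>R y \<in> W.Inv (K - {p})" using that(1) W.subspace_Inv subspace_scale by blast
    then have "eps b *\<^sub>R y \<in> (W.om ^^ (p - 1)) ` W.Inv (Y - {Suc N - p})"
      unfolding W.om_Inv[OF Yd] fs(3) .
    then obtain z' where z': "z' \<in> W.Inv (Y - {Suc N - p})" "eps b *\<^sub>R y = (W.om ^^ (p - 1)) z'" by blast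
    have "(W.om ^^ (p - 1)) (z - z') = 0"
      using z(2) z'(2) by (simp add: linear_diff[OF W.linear_om_pow])
    moreover have "z - z' \<in> W.V"
      using zV z'(1) W.Inv_subset subspace_diff[OF W.subspace_V] by blast
    ultimately have "z = z'" using W.om_pow_inj by fastforce
    then show ?thesis using z'(1) by simp
  qed
  show thesis by (rule that[OF z(1) 2 3])
qed

text \<open>
  Up to \<open>Merged\<close>, every element of \<open>Inv J\<close> is a combination of the vectors \<open>frame J i y\<close>; this bounds \<open>new_dim J\<close>
  by numbers for \<open>E\<close>, and summing the bounds over \<open>J\<close> leaves no room for strict inequality.
\<close>

definition unshift :: "nat set \<Rightarrow> nat \<Rightarrow> nat set" where
  "unshift J i = cyc_shift (Suc N) (- int i) J"

definition cut :: "nat set \<Rightarrow> nat \<Rightarrow> nat set" where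
  "cut J i = unshift J i - {Suc N}"

definition frame :: "nat set \<Rightarrow> nat \<Rightarrow> ('c list \<Rightarrow> real) \<Rightarrow> 'c list \<Rightarrow> real" where
  "frame J i y = (P.om ^^ i) (emb (max0 (cut J i)) y)"

lemma unshift_subset: "unshift J i \<subseteq> {1..Suc N}"
  unfolding unshift_def by (rule cyc_shift_subset) simp

lemma cut_subset: "cut J i \<subseteq> {1..N}"
  using unshift_subset[of J i] unfolding cut_def by (auto simp: le_Suc_eq)

lemma unshift_shift: "unshift J (i + p) = cyc_shift (Suc N) (- int p) (unshift J i)"
  unfolding unshift_def by (simp add: cyc_shift_shift algebra_simps)

lemma unshift_nonempty: "unshift J i = {} \<longleftrightarrow> J = {}"
  unfolding unshift_def by simp

lemma unshift_back: "J \<subseteq> {1..Suc N} \<Longrightarrow> cyc_shift (Suc N) (int i) (unshift J i) = J"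
  unfolding unshift_def by (simp add: cyc_shift_shift cyc_shift_0)

lemma unshift_period: "unshift J (i + Suc N) = unshift J i"
proof -
  have "cyc_rep (Suc N) (int j + - int (i + Suc N)) = cyc_rep (Suc N) (int j + - int i)" for j
  proof (rule cyc_rep_cong)
    have "int j + - int i = int j + - int (i + Suc N) + int (Suc N)" by simp
    then show "(int j + - int (i + Suc N)) mod int (Suc N) = (int j + - int i) mod int (Suc N)"
      by (metis mod_add_self2)
  qed
  then show ?thesis unfolding unshift_def cyc_shift_def by simp
qed

lemma linear_frame: "linear (frame J i)"
  using linear_compose[OF linear_emb P.linear_om_pow] unfolding frame_def o_def by simp

text \<open>A full turn of \<open>P.om\<close> returns every component to its place, transformed by
  \<open>W.om ^^ N\<close> and multiplied by \<open>eps b\<close>. So frames matter only modulo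
  \<open>Suc N\<close>, up to an automorphism of the invariants.\<close>

lemma frame_period:
  assumes "y \<in> W.V" "1 \<le> N"
  shows "frame J (i + Suc N) y = eps b *\<^sub>R frame J i ((W.om ^^ N) y)"
proof -
  have V: "(W.om ^^ N) y \<in> W.V" using assms by simp
  have "(P.om ^^ Suc N) (emb p y) = eps b *\<^sub>R emb p ((W.om ^^ N) y)" for p
  proof (rule P_ext)
    show "(P.om ^^ Suc N) (emb p y) \<in> P.V" by (rule P.om_pow_in_V[OF emb_in_V])
    show "eps b *\<^sub>R emb p ((W.om ^^ N) y) \<in> P.V" using subspace_scale[OF P.subspace_V] by simp
    fix q assume q: "1 \<le> q" "q \<le> Suc N"
    then show "pos q ((P.om ^^ Suc N) (emb p y)) = pos q (eps b *\<^sub>R emb p ((W.om ^^ N) y))"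
      using pos_om_pow[OF emb_in_V, of "Suc N" q p y] pos_emb[OF assms(1) q] pos_emb[OF V q]
        linear_0[OF W.linear_om_pow] by (simp add: linear_scale[OF linear_pos] del: funpow.simps)
  qed
  moreover have "cut J (i + Suc N) = cut J i" unfolding cut_def unshift_period ..
  ultimately show ?thesis
    unfolding frame_def funpow_add by (simp only: o_apply linear_scale[OF P.linear_om_pow])
qed

text \<open>\<open>T\<close> will be \<open>Merged J\<close> itself or its span with a chosen set of
  generators; membership in \<open>T\<close> expresses congruences modulo it.\<close>

context
  fixes J T
  assumes J: "J \<subseteq> {1..Suc N}" "J \<noteq> {}" and T: "subspace T" "P.Merged J \<subseteq> T" and N1: "1 \<le> N"
begin

lemma om_Merged_T: "f \<in> P.Merged (unshift J i) \<Longrightarrow> (P.om ^^ i) f \<in> T"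
  using P.om_Merged[of "unshift J i" i] unshift_subset[of J i] unshift_nonempty[of J i] unshift_back[OF J(1)] J(2) T(2) by auto

lemma frame_wrap:
  assumes X: "X \<subseteq> {1..N}" "X \<noteq> {}" and G: "\<And>y. y \<in> W.Inv X \<Longrightarrow> frame J (i mod Suc N) y \<in> T"
  shows "y \<in> W.Inv X \<Longrightarrow> frame J i y \<in> T"
proof -
  have "\<forall>y\<in>W.Inv X. frame J (i mod Suc N + k * Suc N) y \<in> T" for k
  proof (induction k)
    case 0
    then show ?case using G by simp
  next
    case (Suc k)
    show ?case
    proof
      fix y assume y: "y \<in> W.Inv X"
      have yV: "y \<in> W.V" using y W.Inv_subset by blast
      have "cyc_shift N (int N) X = X"
      proof -
        have "cyc_rep N (int j + int N) = j" if "j \<in> X" for j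
          by (rule cyc_rep_eqI) (use that X in auto)
        then show ?thesis unfolding cyc_shift_def by simp
      qed
      then have "(W.om ^^ N) y \<in> W.Inv X" using W.om_Inv[OF X, of N] y by auto
      then have "frame J (i mod Suc N + k * Suc N) ((W.om ^^ N) y) \<in> T" using Suc by blast
      then have "eps b *\<^sub>R frame J (i mod Suc N + k * Suc N) ((W.om ^^ N) y) \<in> T"
        using T(1) subspace_scale by blast
      then have "frame J (i mod Suc N + k * Suc N + Suc N) y \<in> T"
        using frame_period[OF yV N1] by simp
      then show "frame J (i mod Suc N + Suc k * Suc N) y \<in> T" by (simp add: algebra_simps)
    qed
  qed
  from this[of "i div Suc N"] show "y \<in> W.Inv X \<Longrightarrow> frame J i y \<in> T" by (simp only: mod_div_mult_eq)
qed

lemma frame_span: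
  assumes "\<And>y. y \<in> Z \<Longrightarrow> frame J i y \<in> T" "y \<in> span Z"
  shows "frame J i y \<in> T"
proof -
  have "frame J i ` span Z = span (frame J i ` Z)"
    by (rule linear_span_image[OF linear_frame, symmetric])
  also have "\<dots> \<subseteq> T" by (rule span_minimal[OF _ T(1)]) (use assms(1) in blast)
  finally show ?thesis using assms(2) by blast
qed

lemma frame_inner:
  assumes n: "Suc N \<in> unshift J i" and j: "j \<in> cut J i" "j \<noteq> max0 (cut J i)"
    and y: "y \<in> W.Inv (insert N (cut J i - {j}))"
  shows "frame J i y \<in> T"
  unfolding frame_def using emb_inner[OF unshift_subset n] j y by (intro om_Merged_T) (simp add: cut_def)

lemma frame_merge_left:
  assumes n: "Suc N \<in> unshift J i" and K: "cut J i \<noteq> {}" and p: "p = max0 (cut J i)"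
    and y: "y \<in> W.Inv (insert N (cut J i - {p}))"
  obtains z where "z \<in> W.Inv (cut J (i + p))" "frame J (i + p) z \<in> T \<Longrightarrow> frame J i y \<in> T"
    "y \<in> W.Inv (cut J i - {p}) \<Longrightarrow> cut J i - {p} \<noteq> {} \<Longrightarrow> z \<in> W.Inv (cut J (i + p) - {Suc N - p})"
    "Suc N \<in> unshift J (i + p)"
proof -
  have K': "cut J i = unshift J i - {Suc N}" unfolding cut_def ..
  have Y: "cut J (i + p) = cyc_shift (Suc N) (- int p) (unshift J i) - {Suc N}" unfolding cut_def unshift_shift ..
  obtain z where z: "z \<in> W.Inv (cut J (i + p))"
    "emb p y + (P.om ^^ p) (emb (max0 (cut J (i + p))) z) \<in> P.Merged (unshift J i)"
    "y \<in> W.Inv (cut J i - {p}) \<Longrightarrow> cut J i - {p} \<noteq> {} \<Longrightarrow> z \<in> W.Inv (cut J (i + p) - {Suc N - p})"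
    using emb_merge_left[OF unshift_subset n K' K p Y y] by metis
  have "(P.om ^^ i) (emb p y + (P.om ^^ p) (emb (max0 (cut J (i + p))) z)) \<in> T"
    by (rule om_Merged_T[OF z(2)])
  then have "frame J i y + frame J (i + p) z \<in> T"
    unfolding frame_def p[symmetric] by (simp add: linear_add[OF P.linear_om_pow] funpow_add)
  then have "frame J i y \<in> T" if "frame J (i + p) z \<in> T"
    using subspace_diff[OF T(1) _ that] by fastforce
  moreover have "Suc N \<in> unshift J (i + p)"
    unfolding unshift_shift by (rule frame_shift(6)[OF unshift_subset n K' K p Y])
  ultimately show thesis using that z by blast
qed

lemma Inv_Merged_span:
  assumes "W.Inv X \<subseteq> span (W.Merged X \<union> R0)" "y \<in> W.Inv X"
    "\<And>j y. j \<in> X \<Longrightarrow> X - {j} \<noteq> {} \<Longrightarrow> y \<in> W.Inv (X - {j}) \<Longrightarrow> frame J i y \<in> T"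
    "\<And>y. y \<in> R0 \<Longrightarrow> frame J i y \<in> T"
  shows "frame J i y \<in> T"
proof (rule frame_span[of "W.Merged X \<union> R0"])
  show "y \<in> span (W.Merged X \<union> R0)" using assms by blast
  fix y assume "y \<in> W.Merged X \<union> R0"
  then show "frame J i y \<in> T"
  proof
    assume "y \<in> W.Merged X"
    then show ?thesis unfolding W.Merged_def
      by (rule frame_span[rotated]) (use assms(3) in blast)
  qed (rule assms(4))
qed

text \<open>If \<open>N \<in> unshift J i\<close>, the block of \<open>b\<close> has length one and
  \<open>b\<close> is passed to the block on its left, which is the step from \<open>i\<close> to
  \<open>i + N\<close>. The position \<open>N - k\<close> outside the set bounds the number of steps
  until a longer block, treated by \<open>base\<close>, is reached.\<close>

lemma frame_right_run:
  assumes base: "\<And>i y. Suc N \<in> unshift J i \<Longrightarrow> N \<notin> unshift J i \<Longrightarrow> cut J i \<noteq> {} \<Longrightarrow> y \<in> W.Inv (cut J i) \<Longrightarrow> frame J i y \<in> T"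
    and "Suc N \<in> unshift J i" "k < N" "N - k \<notin> unshift J i" "cut J i \<noteq> {}" "y \<in> W.Inv (cut J i)"
  shows "frame J i y \<in> T"
  using assms(2-)
proof (induction k arbitrary: i y)
  case 0
  then show ?case using base by simp
next
  case (Suc k)
  show ?case
  proof (cases "N \<in> unshift J i")
    case False
    then show ?thesis using base Suc.prems by blast
  next
    case True
    have NK: "N \<in> cut J i" using True unfolding cut_def by simp
    have fK: "finite (cut J i)" using cut_subset finite_subset by blast
    have p: "N = max0 (cut J i)"
      using cut_subset[of J i] by (intro max0_eqI[OF fK NK, symmetric]) auto
    have "insert N (cut J i - {N}) = cut J i" using NK by blast
    then have "y \<in> W.Inv (insert N (cut J i - {N}))" using Suc.prems by simp
    then obtain z where z: "z \<in> W.Inv (cut J (i + N))" "frame J (i + N) z \<in> T \<Longrightarrow> frame J i y \<in> T" "Suc N \<in> unshift J (i + N)"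
      using frame_merge_left[OF Suc.prems(1,4) p] by metis
    have sh1: "unshift J i = cyc_shift (Suc N) (- 1) (unshift J (i + N))"
      using unshift_shift[of J "i + N" 1] unshift_period[of J i] by simp
    have "N - k \<notin> unshift J (i + N)"
    proof
      assume "N - k \<in> unshift J (i + N)"
      then have "cyc_rep (Suc N) (int (N - k) + - 1) \<in> unshift J i"
        unfolding sh1 cyc_shift_def by blast
      moreover have "cyc_rep (Suc N) (int (N - k) + - 1) = N - Suc k"
        by (rule cyc_rep_eqI) (use Suc.prems in \<open>auto simp: of_nat_diff\<close>)
      ultimately show False using Suc.prems by simp
    qed
    moreover have "cut J (i + N) \<noteq> {}"
      using frame_shift(1)[OF unshift_subset Suc.prems(1) cut_def Suc.prems(4) p refl]
      unfolding cut_def unshift_shift by blast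
    ultimately show ?thesis using Suc.IH[of "i + N" z] z Suc.prems by simp
  qed
qed

text \<open>Generators are supplied only in frames where the block of \<open>b\<close> has length at
  least two. There \<open>y\<close> is split along \<open>R0\<close> into generators and a
  \<open>Merged\<close> part. Dropping an inner element stays in \<open>T\<close> by
  \<open>frame_inner\<close>, dropping the largest one passes \<open>b\<close> to the left, and
  dropping \<open>N\<close> leads to \<open>Inv (cut J i)\<close>, which is split in the same way
  along \<open>R1\<close>.\<close>

lemma frame_all:
  assumes J': "J \<noteq> {1..Suc N}"
    and R0: "\<And>K. K \<subseteq> {1..N} \<Longrightarrow> W.Inv (insert N K) \<subseteq> span (W.Merged (insert N K) \<union> R0 K)"
    and R1: "\<And>K. K \<subseteq> {1..N} \<Longrightarrow> K \<noteq> {} \<Longrightarrow> W.Inv K \<subseteq> span (W.Merged K \<union> R1 K)"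
    and T0: "\<And>i y. i < Suc N \<Longrightarrow> Suc N \<in> unshift J i \<Longrightarrow> N \<notin> unshift J i \<Longrightarrow> y \<in> R0 (cut J i) \<Longrightarrow> frame J i y \<in> T"
    and T1: "\<And>i y. i < Suc N \<Longrightarrow> Suc N \<in> unshift J i \<Longrightarrow> N \<notin> unshift J i \<Longrightarrow> cut J i \<noteq> {} \<Longrightarrow> y \<in> R1 (cut J i) \<Longrightarrow> frame J i y \<in> T"
    and i: "Suc N \<in> unshift J i" and y: "y \<in> W.Inv (insert N (cut J i))"
  shows "frame J i y \<in> T"
proof -
  have md: "unshift J (i mod Suc N) = unshift J i" for i
  proof -
    have "unshift J (i mod Suc N + k * Suc N) = unshift J (i mod Suc N)" for k
    proof (induction k)
      case (Suc k)
      then show ?case using unshift_period[of J "i mod Suc N + k * Suc N"] by (simp add: algebra_simps)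
    qed simp
    from this[of "i div Suc N"] show ?thesis by (simp only: mod_div_mult_eq)
  qed
  then have mdk: "cut J (i mod Suc N) = cut J i" for i unfolding cut_def by simp
  have inner: "frame J i y \<in> T" if "Suc N \<in> unshift J i" "j \<in> cut J i" "j \<noteq> max0 (cut J i)" "y \<in> W.Inv (X - {j})"
    "X \<subseteq> insert N (cut J i)" for i j y X
  proof -
    have "X - {j} \<subseteq> insert N (cut J i - {j})" using that(5) by blast
    then show ?thesis using frame_inner[OF that(1-3)] that(4) W.Inv_mono by blast
  qed
  have base: "frame J i y \<in> T" if i: "Suc N \<in> unshift J i" "N \<notin> unshift J i" and K: "cut J i \<noteq> {}" and y: "y \<in> W.Inv (cut J i)" for i y
  proof -
    have lt: "frame J i y \<in> T" if i: "Suc N \<in> unshift J i" "N \<notin> unshift J i" and K: "cut J i \<noteq> {}" and y: "y \<in> W.Inv (cut J i)"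
      and iN: "i < Suc N" for i y
    proof (rule Inv_Merged_span[OF R1[OF cut_subset K] y])
      fix j y assume j: "j \<in> cut J i" "cut J i - {j} \<noteq> {}" and yj: "y \<in> W.Inv (cut J i - {j})"
      show "frame J i y \<in> T"
      proof (cases "j = max0 (cut J i)")
        case False
        then show ?thesis using inner[OF i(1) j(1) False yj] by blast
      next
        case True
        have yi: "y \<in> W.Inv (insert N (cut J i - {j}))" using yj W.Inv_mono[of "cut J i - {j}"] by blast
        obtain z where z: "frame J (i + j) z \<in> T \<Longrightarrow> frame J i y \<in> T"
          "z \<in> W.Inv (cut J (i + j) - {Suc N - j})" "Suc N \<in> unshift J (i + j)"
          using frame_merge_left[OF i(1) K True yi] yj j(2) by metis
        note fs = frame_shift[OF unshift_subset i(1) cut_def K True refl, unfolded unshift_shift[symmetric] cut_def[symmetric]]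
        have j1: "1 \<le> j" "j \<le> N" using j(1) cut_subset[of J i] by auto
        have "max0 (cut J i - {j}) \<in> cut J i - {j}"
          using max0_mem[of "cut J i - {j}" N] cut_subset[of J i] j(2) by blast
        \<comment> \<open>In the new frame the dropped element is not the largest one, so
          \<open>inner\<close> settles \<open>z\<close> at once.\<close>
        then have "Suc N - j \<noteq> max0 (cut J (i + j))" using fs(5) cut_subset[of J i] by auto
        moreover have "Suc N - j \<in> cut J (i + j)" using fs(1) by simp
        ultimately have "frame J (i + j) z \<in> T" using inner[OF z(3) _ _ z(2)] by blast
        then show ?thesis by (rule z(1))
      qed
    qed (use T1[OF iN i K] in blast)
    show ?thesis
    proof (rule frame_wrap[OF cut_subset K _ y])
      fix y assume "y \<in> W.Inv (cut J i)"
      then show "frame J (i mod Suc N) y \<in> T" using lt[of "i mod Suc N" y] i K unfolding md mdk by simp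
    qed
  qed
  have run: "frame J i y \<in> T" if i: "Suc N \<in> unshift J i" and K: "cut J i \<noteq> {}" and y: "y \<in> W.Inv (cut J i)" for i y
  proof -
    have "unshift J i \<noteq> {1..Suc N}"
    proof
      assume "unshift J i = {1..Suc N}"
      then have "J = cyc_shift (Suc N) (int i) {1..Suc N}" using unshift_back[OF J(1), of i] by simp
      moreover have "cyc_shift (Suc N) (int i) {1..Suc N} = {1..Suc N}"
      proof -
        have "{1..Suc N} = cyc_shift (Suc N) (int i) (cyc_shift (Suc N) (- int i) {1..Suc N})"
          by (simp add: cyc_shift_shift cyc_shift_0)
        also have "\<dots> \<subseteq> cyc_shift (Suc N) (int i) {1..Suc N}"
          using cyc_shift_subset[of "Suc N" "- int i" "{1..Suc N}"] unfolding cyc_shift_def[of _ "int i"] by auto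
        finally show ?thesis using cyc_shift_subset[of "Suc N" "int i" "{1..Suc N}"] by auto
      qed
      ultimately show False using J' by simp
    qed
    then obtain m where m: "m \<in> {1..Suc N}" "m \<notin> unshift J i" using unshift_subset[of J i] by blast
    then have m1: "1 \<le> m" "m \<le> N" using i by (auto simp: le_Suc_eq)
    then have "N - m < N" "N - (N - m) \<notin> unshift J i" using m by auto
    then show ?thesis using frame_right_run[OF base i _ _ K y] by blast
  qed
  have lt: "frame J i y \<in> T" if i: "Suc N \<in> unshift J i" and y: "y \<in> W.Inv (insert N (cut J i))" and iN: "i < Suc N" for i y
  proof (cases "N \<in> cut J i")
    case True
    then have "insert N (cut J i) = cut J i" by blast
    then show ?thesis using run[OF i] y True by auto
  next
    case False
    then have nN: "N \<notin> unshift J i" unfolding cut_def by simp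
    show ?thesis
    proof (rule Inv_Merged_span[OF R0[OF cut_subset] y])
      fix j y assume j: "j \<in> insert N (cut J i)" "insert N (cut J i) - {j} \<noteq> {}"
        and yj: "y \<in> W.Inv (insert N (cut J i) - {j})"
      show "frame J i y \<in> T"
      proof (cases "j = N")
        case True
        then have "insert N (cut J i) - {j} = cut J i" using False by blast
        then show ?thesis using run[OF i] yj j(2) by metis
      next
        case jN: False
        then have jk: "j \<in> cut J i" "cut J i \<noteq> {}" using j by auto
        show ?thesis
        proof (cases "j = max0 (cut J i)")
          case False
          then show ?thesis using inner[OF i jk(1) False yj] by blast
        next
          case True
          have "insert N (cut J i) - {j} = insert N (cut J i - {j})" using jN by blast
          then obtain z where z: "z \<in> W.Inv (cut J (i + j))" "frame J (i + j) z \<in> T \<Longrightarrow> frame J i y \<in> T"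
            "Suc N \<in> unshift J (i + j)"
            using frame_merge_left[OF i jk(2) True] yj by metis
          have "cut J (i + j) \<noteq> {}"
            using frame_shift(1)[OF unshift_subset i cut_def jk(2) True refl]
            unfolding cut_def unshift_shift by blast
          then show ?thesis using run[OF z(3) _ z(1)] z(2) by blast
        qed
      qed
    qed (use T0[OF iN i nN] in blast)
  qed
  show ?thesis
  proof (rule frame_wrap[OF _ _ _ y])
    show "insert N (cut J i) \<subseteq> {1..N}" using cut_subset N1 by auto
    fix y assume "y \<in> W.Inv (insert N (cut J i))"
    then show "frame J (i mod Suc N) y \<in> T" using lt[of "i mod Suc N" y] i unfolding md mdk by simp
  qed simp
qed

lemma pos_last_Inv:
  assumes g: "g \<in> P.Inv I" and n: "Suc N \<in> I"
  shows "pos (Suc N) g \<in> W.Inv (insert N (I - {Suc N}))"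
proof -
  have "pos (Suc N) g \<in> W.U i" if i: "i \<in> {1..N} - insert N (I - {Suc N})" for i
  proof -
    have i': "1 \<le> i" "i < N" "i \<notin> I" using i n by auto
    have gV: "g \<in> P.V" using g P.Inv_subset by blast
    have "g \<in> P.U i" using g i' unfolding P.Inv_def by simp
    then have "P.S i g = g" using i' unfolding P.U_def by simp
    then have "W.S i (pos (Suc N) g) = pos (Suc N) g"
      using pos_S(1)[OF gV, of i "Suc N"] i' by simp
    then show ?thesis using i' unfolding W.U_def by simp
  qed
  then show ?thesis unfolding W.Inv_def by simp
qed

text \<open>An invariant is exhausted by frames, from its last nonzero component \<open>q\<close>
  downwards. If \<open>q\<close> is not in the rotated \<open>J\<close>, invariance equates the
  components \<open>q\<close> and \<open>q + 1\<close>, so both vanish. Otherwise the component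
  \<open>q\<close> is cancelled by the frame of the block that ends at \<open>q\<close>.\<close>

lemma Inv_in_T:
  assumes A: "\<And>i y. Suc N \<in> unshift J i \<Longrightarrow> y \<in> W.Inv (insert N (cut J i)) \<Longrightarrow> frame J i y \<in> T"
  shows "P.Inv J \<subseteq> T"
proof -
  have main: "(P.om ^^ i) f \<in> T"
    if i: "Suc N \<in> unshift J i" and "f \<in> P.Inv (unshift J i)" "q \<le> Suc N"
      "\<And>q'. q < q' \<Longrightarrow> q' \<le> Suc N \<Longrightarrow> pos q' f = 0" for i f q
    using that(2-)
  proof (induction q arbitrary: f)
    case 0
    have fV: "f \<in> P.V" using "0.prems"(1) P.Inv_subset by blast
    have "f = 0"
    proof (rule P_ext[OF fV subspace_0[OF P.subspace_V]])
      fix q assume q: "1 \<le> q" "q \<le> Suc N"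
      have "pos q f = 0" by (rule "0.prems"(3)) (use q in auto)
      then show "pos q f = pos q 0" unfolding linear_0[OF linear_pos] .
    qed
    then show ?case
      by (simp only: linear_0[OF P.linear_om_pow] subspace_0[OF T(1)])
  next
    case (Suc e)
    let ?q = "Suc e"
    have fV: "f \<in> P.V" using Suc.prems(1) P.Inv_subset by blast
    show ?case
    proof (cases "?q \<in> unshift J i")
      case False
      then have qN: "?q \<le> N" using Suc.prems(2) i by (cases "?q = Suc N") auto
      have "f \<in> P.U ?q" using Suc.prems(1) False qN unfolding P.Inv_def by auto
      then have "P.S ?q f = f" using qN unfolding P.U_def by simp
      then have "pos ?q f = pos (Suc ?q) f" using pos_S(3)[OF fV, of ?q ?q] qN by simp
      also have "\<dots> = 0" by (rule Suc.prems(3)) (use qN in auto)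
      finally have z: "pos ?q f = 0" .
      show ?thesis
      proof (rule Suc.IH[OF Suc.prems(1)])
        show "e \<le> Suc N" using Suc.prems(2) by simp
        fix q' assume "e < q'" "q' \<le> Suc N"
        then show "pos q' f = 0" using z Suc.prems(3)[of q'] by (cases "q' = ?q") auto
      qed
    next
      case True
      let ?J1 = "unshift J (i + ?q)"
      have J1: "?J1 = cyc_shift (Suc N) (- int ?q) (unshift J i)" by (rule unshift_shift)
      have bk: "cyc_shift (Suc N) (int ?q) ?J1 = unshift J i"
        unfolding J1 using unshift_subset[of J i] by (simp only: cyc_shift_shift cyc_shift_0) (simp add: cyc_shift_0)
      have n1: "Suc N \<in> ?J1"
      proof -
        have "cyc_rep (Suc N) (int ?q + - int ?q) = Suc N" by (rule cyc_rep_eqI) auto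
        then show ?thesis unfolding J1 cyc_shift_def using True by (metis image_eqI)
      qed
      have "?J1 \<noteq> {}" using n1 by blast
      then have "(P.om ^^ ?q) ` P.Inv ?J1 = P.Inv (unshift J i)"
        using P.om_Inv[of ?J1 ?q] unshift_subset[of J "i + ?q"] bk by simp
      then obtain g where g: "g \<in> P.Inv ?J1" "f = (P.om ^^ ?q) g" using Suc.prems(1) by blast
      have gV: "g \<in> P.V" using g(1) P.Inv_subset by blast
      define y where "y = pos (Suc N) g"
      have y: "y \<in> W.Inv (insert N (cut J (i + ?q)))"
        unfolding y_def cut_def by (rule pos_last_Inv[OF g(1) n1])
      have yV: "y \<in> W.V" using y W.Inv_subset by blast
      let ?e = "emb (max0 (cut J (i + ?q))) y"
      define f' where "f' = f - (P.om ^^ ?q) ?e"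
      have "?e \<in> P.Inv ?J1" using emb_Inv[OF unshift_subset n1] y unfolding cut_def by blast
      then have eW: "(P.om ^^ ?q) ?e \<in> P.Inv (unshift J i)"
        using \<open>(P.om ^^ ?q) ` P.Inv ?J1 = P.Inv (unshift J i)\<close> by blast
      \<comment> \<open>This places the start of the block late enough for the subtracted frame to
        vanish at all positions beyond \<open>?q\<close>.\<close>
      have pn: "?q = Suc N \<or> Suc N - ?q \<le> max0 (cut J (i + ?q))"
      proof (cases "?q = Suc N")
        case False
        have "cyc_rep (Suc N) (int (Suc N) + - int ?q) = Suc N - ?q"
          by (rule cyc_rep_eqI) (use False Suc.prems(2) in \<open>auto simp: of_nat_diff\<close>)
        then have "Suc N - ?q \<in> ?J1" unfolding J1 cyc_shift_def using i
          image_eqI[of "Suc N - ?q" "\<lambda>j. cyc_rep (Suc N) (int j + - int ?q)" "Suc N" "unshift J i"] by simp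
        then have "Suc N - ?q \<in> cut J (i + ?q)" unfolding cut_def by auto
        then show ?thesis using max0_ge[OF finite_subset[OF cut_subset finite_atLeastAtMost]] by blast
      qed simp
      have "(P.om ^^ i) f' \<in> T"
      proof (rule Suc.IH)
        show "f' \<in> P.Inv (unshift J i)" unfolding f'_def
          by (rule subspace_diff[OF P.subspace_Inv Suc.prems(1) eW])
        show "e \<le> Suc N" using Suc.prems(2) by simp
        fix q' assume q': "e < q'" "q' \<le> Suc N"
        show "pos q' f' = 0"
        proof (cases "q' = ?q")
          case True
          have pmN: "max0 (cut J (i + ?q)) < Suc N"
          proof (cases "cut J (i + ?q) = {}")
            case False
            then show ?thesis using max0_mem[OF cut_subset False] cut_subset[of J "i + ?q"] by auto
          qed (use N1 in simp)
          have "pos ?q f = eps b *\<^sub>R (W.om ^^ e) y"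
            using pos_om_pow[OF gV Suc.prems(2), of ?q] Suc.prems(2) unfolding g(2) y_def by simp
          moreover have "pos ?q ((P.om ^^ ?q) ?e) = eps b *\<^sub>R (W.om ^^ e) y"
            using pos_om_pow[OF emb_in_V Suc.prems(2), of ?q "max0 (cut J (i + ?q))" y] Suc.prems(2)
              pos_emb[OF yV, of "Suc N" "max0 (cut J (i + ?q))"] pmN by simp
          ultimately show ?thesis unfolding True f'_def linear_diff[OF linear_pos] by simp
        next
          case False
          then have lt: "?q < q'" using q' by simp
          then have "pos (q' - ?q) ?e = 0"
            using pos_emb[OF yV, of "q' - ?q" "max0 (cut J (i + ?q))"] pn q' by auto
          then have e0: "pos q' ((P.om ^^ ?q) ?e) = 0"
            using pos_om_pow[OF emb_in_V Suc.prems(2), of q' "max0 (cut J (i + ?q))" y] lt q'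
              linear_0[OF W.linear_om_pow] by (simp del: funpow.simps)
          show ?thesis
            unfolding f'_def linear_diff[OF linear_pos] e0 Suc.prems(3)[OF lt q'(2)] by (rule diff_zero)
        qed
      qed
      moreover have "(P.om ^^ i) ((P.om ^^ ?q) ?e) \<in> T"
        using A[OF n1 y] unfolding frame_def by (simp only: funpow_add o_apply)
      ultimately have "(P.om ^^ i) f' + (P.om ^^ i) ((P.om ^^ ?q) ?e) \<in> T" by (rule subspace_add[OF T(1)])
      then show ?thesis unfolding f'_def linear_diff[OF P.linear_om_pow] by simp
    qed
  qed
  obtain j where j: "j \<in> J" using J by blast
  have "cyc_rep (Suc N) (int j + - int j) = Suc N" by (rule cyc_rep_eqI) auto
  then have n: "Suc N \<in> unshift J j" unfolding unshift_def cyc_shift_def using j by (metis image_eqI)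
  show ?thesis
  proof
    fix f assume "f \<in> P.Inv J"
    then have "f \<in> (P.om ^^ j) ` P.Inv (unshift J j)"
      using P.om_Inv[of "unshift J j" j] unshift_subset[of J j] n unshift_back[OF J(1), of j] by auto
    then obtain g where "g \<in> P.Inv (unshift J j)" "f = (P.om ^^ j) g" by blast
    then show "f \<in> T" using main[OF n, of g "Suc N"] by simp
  qed
qed

end

lemma W_num_des_empty: "W.num_des {} = W.new_dim {N}"
  using W.sum_num_des[of "{N}"] W.new_dim_last by simp

text \<open>There is one summand for each block of length at least two, that is, for each possible
  home of \<open>b\<close> in \<open>frame_all\<close>. With \<open>K = cut J i\<close> its
  generators are complements of \<open>Merged (insert N K)\<close> and \<open>Merged K\<close>, in
  all \<open>num_des K\<close> vectors by exactness for \<open>E\<close>.\<close>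

lemma new_dim_bound:
  assumes ex: "W.lower_exact" and N1: "1 \<le> N" and J: "J \<subseteq> {1..Suc N}" "J \<noteq> {}" "J \<noteq> {1..Suc N}"
  shows "P.new_dim J \<le> (\<Sum>i<Suc N. if Suc N \<in> unshift J i \<and> N \<notin> unshift J i then W.num_des (cut J i) else 0)"
proof -
  have "\<forall>X. \<exists>R. finite R \<and> W.Inv X \<subseteq> span (W.Merged X \<union> R) \<and> card R = W.new_dim X"
  proof
    fix X
    obtain R where "finite R" "W.Inv X \<subseteq> span (W.Merged X \<union> R)" "card R + dim (span (W.Merged X)) = dim (W.Inv X)"
      using dim_span_complement[OF W.fin_dim_Inv W.subspace_Inv W.Merged_subset_Inv] by metis
    then show "\<exists>R. finite R \<and> W.Inv X \<subseteq> span (W.Merged X \<union> R) \<and> card R = W.new_dim X"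
      unfolding W.new_dim_def by (intro exI[of _ R]) auto
  qed
  then obtain R where R: "finite (R X)" "W.Inv X \<subseteq> span (W.Merged X \<union> R X)" "card (R X) = W.new_dim X" for X
    by metis
  define I where "I = {i. i < Suc N \<and> Suc N \<in> unshift J i \<and> N \<notin> unshift J i}"
  \<comment> \<open>For empty \<open>K\<close> only the first complement is taken, and
    \<open>num_des {} = new_dim {N}\<close> makes the count agree.\<close>
  define Q where "Q K = R (insert N K) \<union> (if K = {} then {} else R K)" for K
  define B where "B = (\<Union>i\<in>I. frame J i ` Q (cut J i))"
  define T where "T = span (P.Merged J \<union> B)"
  have fQ: "finite (Q K)" for K unfolding Q_def using R(1) by simp
  have fB: "finite B" unfolding B_def I_def using fQ by simp
  have cQ: "card (Q (cut J i)) \<le> W.num_des (cut J i)" if "i \<in> I" for i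
  proof (cases "cut J i = {}")
    case True
    then show ?thesis unfolding Q_def using R(3)[of "{N}"] W_num_des_empty by simp
  next
    case False
    have N: "N \<notin> cut J i" "cut J i \<subseteq> {1..N}" using that cut_subset unfolding I_def cut_def by auto
    then have "insert N (cut J i) - {N} = cut J i" "insert N (cut J i) \<noteq> {N}" "insert N (cut J i) \<subseteq> {1..N}"
      using False N1 by auto
    then have "W.new_dim (insert N (cut J i)) + W.new_dim (cut J i) = W.num_des (cut J i)"
      using ex unfolding W.lower_exact_iff by (metis insertI1)
    then show ?thesis using card_Un_le[of "R (insert N (cut J i))" "R (cut J i)"] R(3) False
      unfolding Q_def by simp
  qed
  have "subspace T" "P.Merged J \<subseteq> T"
    unfolding T_def using span_superset[of "P.Merged J \<union> B"] by auto
  moreover have BT: "B \<subseteq> T" unfolding T_def using span_superset[of "P.Merged J \<union> B"] by blast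
  ultimately have "P.Inv J \<subseteq> T"
  proof (intro Inv_in_T[OF J(1,2) _ _ N1])
    fix i y assume iy: "Suc N \<in> unshift J i" "y \<in> W.Inv (insert N (cut J i))"
    show "frame J i y \<in> T"
    proof (rule frame_all[OF J(1,2) \<open>subspace T\<close> \<open>P.Merged J \<subseteq> T\<close> N1 J(3), of "\<lambda>K. R (insert N K)" R])
      show "W.Inv (insert N K) \<subseteq> span (W.Merged (insert N K) \<union> R (insert N K))" for K by (rule R(2))
      show "W.Inv K \<subseteq> span (W.Merged K \<union> R K)" for K by (rule R(2))
      fix i y assume i: "i < Suc N" "Suc N \<in> unshift J i" "N \<notin> unshift J i"
      then have "i \<in> I" unfolding I_def by simp
      then have sub: "frame J i ` Q (cut J i) \<subseteq> T" using BT unfolding B_def by blast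
      show "frame J i y \<in> T" if "y \<in> R (insert N (cut J i))" using that sub unfolding Q_def by blast
      show "frame J i y \<in> T" if "cut J i \<noteq> {}" "y \<in> R (cut J i)" using that sub unfolding Q_def by auto
    qed (use iy in auto)
  qed auto
  moreover have fT: "fin_dim T"
    unfolding T_def by (rule fin_dim_span[OF fin_dim_Un[OF P.fin_dim_Merged fin_dim_finite[OF fB]]])
  ultimately have "dim (P.Inv J) \<le> dim T" by (intro fin_dim_dim_mono)
  also have "\<dots> \<le> dim (P.Merged J) + dim B"
    unfolding T_def dim_span using dim_span_Un_le[OF P.fin_dim_Merged[of J] fin_dim_finite[OF fB]] by simp
  also have "dim B \<le> card B" using fB by (rule dim_le_card')
  also have "card B \<le> (\<Sum>i\<in>I. card (frame J i ` Q (cut J i)))"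
    unfolding B_def by (rule card_UN_le) (simp add: I_def)
  also have "\<dots> \<le> (\<Sum>i\<in>I. W.num_des (cut J i))"
    by (rule sum_mono) (rule le_trans[OF card_image_le[OF fQ] cQ])
  also have "\<dots> = (\<Sum>i<Suc N. if Suc N \<in> unshift J i \<and> N \<notin> unshift J i then W.num_des (cut J i) else 0)"
    unfolding I_def by (intro sum.mono_neutral_cong_left) auto
  finally show ?thesis unfolding P.new_dim_def by simp
qed

lemma unshift_full: "unshift {1..Suc N} i = {1..Suc N}"
proof -
  have "{1..Suc N} = cyc_shift (Suc N) (- int i) (cyc_shift (Suc N) (int i) {1..Suc N})"
    by (simp add: cyc_shift_shift cyc_shift_0)
  also have "\<dots> \<subseteq> cyc_shift (Suc N) (- int i) {1..Suc N}"
    using cyc_shift_subset[of "Suc N" "int i" "{1..Suc N}"] unfolding cyc_shift_def[of _ "- int i"] by auto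
  finally show ?thesis using unshift_subset[of "{1..Suc N}" i] unfolding unshift_def by auto
qed

text \<open>For the full set every block has length one, and passing \<open>b\<close> to the left
  never reaches a longer one. Instead \<open>V\<close> is generated by the
  \<open>Inv ({1..N} - {j})\<close>: for \<open>j \<noteq> N\<close> this is an inner merge, and for
  \<open>j = N\<close> one move to the left turns it into the inner merge at 1, as
  \<open>2 \<le> N\<close>.\<close>

lemma top_exact_ext:
  assumes "W.top_exact"
  shows "P.top_exact"
proof -
  have N2: "2 \<le> N" and V: "W.V \<subseteq> W.Merged {1..N}" using assms unfolding W.top_exact_def by auto
  let ?J = "{1..Suc N}"
  let ?T = "P.Merged ?J"
  have kkf: "cut ?J i = {1..N}" for i unfolding cut_def unshift_full by auto
  have pmf: "max0 {1..N} = N" using N2 by (intro max0_eqI) auto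
  have T: "subspace ?T" "?T \<subseteq> ?T" using P.subspace_Merged by auto
  have J: "?J \<subseteq> {1..Suc N}" "?J \<noteq> {}" by auto
  have N1: "1 \<le> N" using N2 by simp
  have n: "Suc N \<in> unshift ?J i" for i unfolding unshift_full by simp
  have inner: "frame ?J i y \<in> ?T" if "j \<in> {1..N}" "j \<noteq> N" "y \<in> W.Inv ({1..N} - {j})" for i j y
  proof (rule frame_inner[OF J T N1 n, of j])
    show "y \<in> W.Inv (insert N (cut ?J i - {j}))" unfolding kkf using that(3) W.Inv_mono by blast
    show "j \<in> cut ?J i" "j \<noteq> max0 (cut ?J i)" unfolding kkf pmf using that by auto
  qed
  have "P.Inv ?J \<subseteq> ?T"
  proof (rule Inv_in_T[OF J T N1])
    fix i y assume "y \<in> W.Inv (insert N (cut ?J i))"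
    then have "y \<in> W.Merged {1..N}" using V W.Inv_subset by blast
    then show "frame ?J i y \<in> ?T" unfolding W.Merged_def
    proof (rule frame_span[OF J T N1, rotated])
      fix y assume "y \<in> (\<Union>j\<in>{j \<in> {1..N}. {1..N} - {j} \<noteq> {}}. W.Inv ({1..N} - {j}))"
      then obtain j where j: "j \<in> {1..N}" "{1..N} - {j} \<noteq> {}" "y \<in> W.Inv ({1..N} - {j})" by blast
      show "frame ?J i y \<in> ?T"
      proof (cases "j = N")
        case False
        then show ?thesis using inner j by blast
      next
        case True
        have K: "cut ?J i \<noteq> {}" "N = max0 (cut ?J i)" unfolding kkf pmf using N2 by auto
        have yi: "y \<in> W.Inv (insert N (cut ?J i - {N}))" unfolding kkf using j(3) True W.Inv_mono by blast
        obtain z where z: "frame ?J (i + N) z \<in> ?T \<Longrightarrow> frame ?J i y \<in> ?T"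
          "z \<in> W.Inv (cut ?J (i + N) - {Suc N - N})"
          using frame_merge_left[OF J T N1 n K yi] j True unfolding kkf by metis
        have "frame ?J (i + N) z \<in> ?T" using inner[of 1 z "i + N"] z(2) N2 unfolding kkf by simp
        then show ?thesis by (rule z(1))
      qed
    qed
  qed
  moreover have "P.Inv ?J = P.V" unfolding P.Inv_def by simp
  ultimately show ?thesis unfolding P.top_exact_def using N1 by simp
qed

lemma card_PL: "Suc N * card W.L \<le> card P.L"
proof -
  have "inj_on (\<lambda>(q, t). ins q t) ({1..Suc N} \<times> W.L)"
  proof (rule inj_onI, clarify)
    fix q t q' t' assume q: "q \<in> {1..Suc N}" "t \<in> W.L" "q' \<in> {1..Suc N}" "t' \<in> W.L" "ins q t = ins q' t'"
    have tw: "takeWhile (\<lambda>a. a \<noteq> b) (ins q t) = take (q - 1) t" if "t \<in> W.L" for q t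
    proof -
      have "b \<notin> set t" using that b unfolding W.L_def by auto
      then have "\<forall>a\<in>set (take (q - 1) t). a \<noteq> b" using set_take_subset by fastforce
      then show ?thesis unfolding ins_def by (simp add: takeWhile_append2)
    qed
    have rm: "remove1 b (ins q t) = t" if "t \<in> W.L" for q t
    proof -
      have "b \<notin> set t" using that b unfolding W.L_def by auto
      then have "b \<notin> set (take (q - 1) t)" using set_take_subset by fastforce
      then show ?thesis unfolding ins_def by (simp add: remove1_append)
    qed
    have "t = t'" using rm[OF q(2)] rm[OF q(4)] q(5) by metis
    moreover have "take (q - 1) t = take (q' - 1) t'" using tw[OF q(2)] tw[OF q(4)] q(5) by metis
    then have "length (take (q - 1) t) = length (take (q' - 1) t')" by simp
    then have "q = q'" using q W.length_L[OF q(2)] W.length_L[OF q(4)] by auto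
    ultimately show "q = q' \<and> t = t'" by simp
  qed
  then have "card ({1..Suc N} \<times> W.L) \<le> card P.L"
    by (rule card_inj_on_le) (use ins_in_PL P.finite_L in auto)
  then show ?thesis by (simp add: card_cartesian_product)
qed

text \<open>Summed over all \<open>J\<close>, the upper bounds run through \<open>num_des\<close> of
  \<open>E\<close> once for each of the \<open>N + 1\<close> rotations and total
  \<open>Suc N * card W.L\<close>. The lower bounds \<open>new_dim_pair_ge\<close> total
  \<open>card P.L\<close>, which is at least as large, so every pair attains equality. For
  \<open>J = {1..Suc N}\<close> the upper bound is 0, and this is where \<open>top_exact\<close>
  enters.\<close>

lemma lower_exact_ext:
  assumes ex: "W.lower_exact" and top: "W.top_exact"
  shows "P.lower_exact"
proof -
  have N1: "1 \<le> N" using top unfolding W.top_exact_def by simp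
  let ?n = "Suc N"
  let ?S = "{J. J \<subseteq> {1..?n} \<and> J \<noteq> {}}"
  let ?A = "{K. K \<subseteq> {1..?n} - {?n} \<and> K \<noteq> {}}"
  define h where "h J = (if ?n \<in> J \<and> N \<notin> J then W.num_des (J - {?n}) else 0)" for J
  have fS: "finite ?S" "finite ?A" by auto
  have "P.new_dim J \<le> (\<Sum>i<?n. h (unshift J i))" if "J \<in> ?S" for J
  proof (cases "J = {1..?n}")
    case True
    have "P.new_dim J = 0" using top_exact_ext[OF top] P.Inv_subset fin_dim_dim_mono[OF P.fin_dim_Merged, of "P.Inv J" J]
      unfolding P.top_exact_def P.new_dim_def True by auto
    then show ?thesis by simp
  next
    case False
    then show ?thesis using new_dim_bound[OF ex N1, of J] that unfolding h_def cut_def by simp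
  qed
  then have "(\<Sum>J\<in>?S. P.new_dim J) \<le> (\<Sum>J\<in>?S. \<Sum>i<?n. h (unshift J i))" by (rule sum_mono)
  also have "\<dots> = (\<Sum>i<?n. \<Sum>J\<in>?S. h (unshift J i))" by (rule sum.swap)
  also have "\<dots> = (\<Sum>i<?n. \<Sum>J\<in>?S. h J)"
  proof (rule sum.cong[OF refl])
    fix i
    show "(\<Sum>J\<in>?S. h (unshift J i)) = (\<Sum>J\<in>?S. h J)"
    proof (rule sum.reindex_bij_witness[where i = "cyc_shift ?n (int i)" and j = "\<lambda>J. unshift J i"])
      fix J assume J: "J \<in> ?S"
      then show "cyc_shift ?n (int i) (unshift J i) = J" using unshift_back by blast
      show "unshift J i \<in> ?S" using J unshift_subset unshift_nonempty by auto
      show "unshift (cyc_shift ?n (int i) J) i = J"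
        unfolding unshift_def using J by (simp add: cyc_shift_shift cyc_shift_0)
      show "cyc_shift ?n (int i) J \<in> ?S" using J cyc_shift_subset[of ?n "int i" J] by simp
    qed simp
  qed
  also have "(\<Sum>J\<in>?S. h J) = (\<Sum>K | K \<subseteq> {1..N} - {N}. W.num_des K)"
  proof -
    have "(\<Sum>J\<in>?S. h J) = (\<Sum>J\<in>{J \<in> ?S. ?n \<in> J \<and> N \<notin> J}. W.num_des (J - {?n}))"
      unfolding h_def using fS by (intro sum.mono_neutral_cong_right) auto
    also have "\<dots> = (\<Sum>K | K \<subseteq> {1..N} - {N}. W.num_des K)"
    proof (rule sum.reindex_bij_witness[where i = "insert ?n" and j = "\<lambda>J. J - {?n}"])
      fix J assume J: "J \<in> {J \<in> ?S. ?n \<in> J \<and> N \<notin> J}"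
      then show "insert ?n (J - {?n}) = J" by auto
      show "J - {?n} \<in> {K. K \<subseteq> {1..N} - {N}}"
        unfolding mem_Collect_eq
      proof
        fix k assume k: "k \<in> J - {?n}"
        then have "1 \<le> k" "k \<le> ?n" using J by auto
        then show "k \<in> {1..N} - {N}" using k J by (auto simp: le_Suc_eq)
      qed
    next
      fix K assume K: "K \<in> {K. K \<subseteq> {1..N} - {N}}"
      then have "?n \<notin> K" by auto
      then show "insert ?n K - {?n} = K" by simp
      show "insert ?n K \<in> {J \<in> ?S. ?n \<in> J \<and> N \<notin> J}" using K by auto
    qed simp
    finally show ?thesis .
  qed
  also have "\<dots> = card W.L"
  proof -
    have "{t \<in> W.L. W.Des t \<subseteq> {1..N}} = W.L" using W.Des_subset W.length_L by fastforce
    then show ?thesis using W.sum_num_des[of "{1..N}"] W.dim_Inv[of "{1..N}"] N1 by simp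
  qed
  also have "(\<Sum>i<?n. card W.L) \<le> card P.L" using card_PL by simp
  also have "card P.L = P.new_dim {?n} + (\<Sum>K\<in>?A. P.num_des K)"
  proof -
    have "{t \<in> P.L. P.Des t \<subseteq> {1..?n}} = P.L" using P.Des_subset P.length_L by fastforce
    then show ?thesis using P.sum_num_des_nonempty[of "{1..?n}"] P.dim_Inv[of "{1..?n}"] by simp
  qed
  finally have le: "(\<Sum>J\<in>?S. P.new_dim J) \<le> P.new_dim {?n} + (\<Sum>K\<in>?A. P.num_des K)" .
  have eq: "(\<Sum>J\<in>?S. P.new_dim J) = P.new_dim {?n} + (\<Sum>K\<in>?A. P.new_dim (insert ?n K) + P.new_dim K)"
    by (rule sum_pairs) auto
  have ge: "P.num_des K \<le> P.new_dim (insert ?n K) + P.new_dim K" if "K \<in> ?A" for K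
  proof -
    have "insert ?n K - {?n} = K" "insert ?n K \<noteq> {?n}" "?n \<in> insert ?n K" using that by auto
    then show ?thesis using P.new_dim_pair_ge[of "insert ?n K"] unfolding card_insert_b by metis
  qed
  have "P.new_dim (insert ?n K) + P.new_dim K = P.num_des K" if K: "K \<in> ?A" for K
  proof (rule ccontr)
    assume "P.new_dim (insert ?n K) + P.new_dim K \<noteq> P.num_des K"
    then have "P.num_des K < P.new_dim (insert ?n K) + P.new_dim K" using ge[OF K] by linarith
    then have "(\<Sum>K\<in>?A. P.num_des K) < (\<Sum>K\<in>?A. P.new_dim (insert ?n K) + P.new_dim K)"
      using sum_strict_mono_ex1[OF fS(2), of P.num_des "\<lambda>K. P.new_dim (insert ?n K) + P.new_dim K"] ge K by blast
    then show False using le eq by simp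
  qed
  then show ?thesis unfolding P.lower_exact_iff card_insert_b
  proof (intro allI impI)
    fix J assume *: "\<And>K. K \<in> ?A \<Longrightarrow> P.new_dim (insert ?n K) + P.new_dim K = P.num_des K"
      and J: "J \<subseteq> {1..?n}" "?n \<in> J" "J \<noteq> {?n}"
    then have "J - {?n} \<in> ?A" "insert ?n (J - {?n}) = J" by auto
    then show "P.new_dim J + P.new_dim (J - {?n}) = P.num_des (J - {?n})" using *[of "J - {?n}"] by simp
  qed
qed

end

section \<open>Removing a maximal cell\<close>

lemma Inv_transfer:
  assumes "lin_sys D R rho key eps" "lin_sys D R' rho' key eps" "linear F"
    and V: "\<And>v. v \<in> lsys.V D R \<Longrightarrow> F v \<in> lsys.V D R'"
    and S: "\<And>i v. v \<in> lsys.V D R \<Longrightarrow> 1 \<le> i \<Longrightarrow> i < card D \<Longrightarrow> F (lsys.S D R rho i v) = lsys.S D R' rho' i (F v)"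
    and X: "\<And>v. v \<in> lsys.V D R \<Longrightarrow> F (lsys.X eps 1 v) = lsys.X eps 1 (F v)"
  shows "F ` lsys.Inv D R rho eps I \<subseteq> lsys.Inv D R' rho' eps I"
    and "F ` lsys.Merged D R rho eps I \<subseteq> lsys.Merged D R' rho' eps I"
proof -
  interpret A: lin_sys D R rho key eps by fact
  interpret B: lin_sys D R' rho' key eps by fact
  have fold: "F (foldr A.S is v) = foldr B.S is (F v)" if "v \<in> A.V" "\<forall>i\<in>set is. 1 \<le> i \<and> i < card D" for v "is"
    using that(2) by (induction "is") (use S A.foldr_S_in_V[OF that(1)] in auto)
  have om: "F (A.om v) = B.om (F v)" if v: "v \<in> A.V" for v
    unfolding A.om_def B.om_def A.cox_def B.cox_def
    using X[OF A.foldr_S_in_V[OF v]] fold[OF v, of "[1..<card D]"] by simp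
  have U: "F v \<in> B.U i" if v: "v \<in> A.U i" and i: "i \<in> {1..card D}" for v i
  proof (cases "i < card D")
    case True
    then show ?thesis using v V S[of v i] i unfolding A.U_def B.U_def by auto
  next
    case False
    then obtain w where w: "w \<in> A.V" "A.S (card D - 1) w = w" "v = A.om w"
      using v unfolding A.U_def by auto
    have "B.S (card D - 1) (F w) = F w"
    proof (cases "card D - 1 \<ge> 1")
      case True
      then show ?thesis using S[OF w(1), of "card D - 1"] w(2) by simp
    next
      \<comment> \<open>For a single cell \<open>S 0\<close> compares the only entry with itself and
        is the identity on the space.\<close>
      case c: False
      from i have "1 \<le> card D" by auto
      with c have d: "card D = 1" by linarith
      show ?thesis
      proof
        fix t
        show "B.S (card D - 1) (F w) t = F w t"
        proof (cases "t \<in> B.L")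
          case True
          then obtain a where "t = [a]" using B.length_L[OF True] d by (auto simp: length_Suc_conv)
          then show ?thesis using True unfolding d B.S_def swp_def by (simp add: algebra_simps)
        next
          case False
          then show ?thesis using B.V_outside[OF V[OF w(1)]] by (simp add: B.S_outside)
        qed
      qed
    qed
    then show ?thesis using V[OF w(1)] om[OF w(1)] w(3) False unfolding B.U_def by auto
  qed
  have Inv: "F ` A.Inv I \<subseteq> B.Inv I" for I
    using U V unfolding A.Inv_def B.Inv_def by blast
  then show "F ` A.Inv I \<subseteq> B.Inv I" .
  have "F ` A.Merged I = span (\<Union>j\<in>{j \<in> I. I - {j} \<noteq> {}}. F ` A.Inv (I - {j}))"
    unfolding A.Merged_def linear_span_image[OF assms(3), symmetric] image_UN ..
  also have "\<dots> \<subseteq> B.Merged I" unfolding B.Merged_def using Inv by (intro span_mono) blast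
  finally show "F ` A.Merged I \<subseteq> B.Merged I" .
qed

context lin_sys
begin

text \<open>The weights \<open>wt\<close> are chosen to make every \<open>S i\<close> self-adjoint for \<open>ip\<close>; positivity is all that is needed of them.\<close>

definition phi :: "'c \<Rightarrow> 'c \<Rightarrow> real" where
  "phi a c = (if R a c then 1 else 1 + rho a c)"

fun wt :: "'c list \<Rightarrow> real" where
  "wt [] = 1"
| "wt (a # t) = (\<Prod>c\<leftarrow>t. phi a c) * wt t"

definition ip :: "('c list \<Rightarrow> real) \<Rightarrow> ('c list \<Rightarrow> real) \<Rightarrow> real" where
  "ip v w = (\<Sum>t\<in>L. wt t * v t * w t)"

lemma wt_swap: "wt (u @ a # c # w) * phi c a = wt (u @ c # a # w) * phi a c"
  by (induction u) (auto simp: algebra_simps)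

lemma phi_pos:
  assumes "a \<in> D" "c \<in> D" "\<not> R c a"
  shows "0 < phi a c"
  using rho_less[of a c] assms unfolding phi_def by auto

lemma wt_pos: "t \<in> L \<Longrightarrow> 0 < wt t"
proof -
  have pp: "0 < (\<Prod>c\<leftarrow>t. phi a c)" if "\<forall>c\<in>set t. 0 < phi a c" for a t
    using that by (induction t) auto
  have "0 < wt t" if "set t \<subseteq> D" "sorted_wrt (\<lambda>a b. \<not> R b a) t" for t
    using that by (induction t) (auto intro!: mult_pos_pos pp phi_pos)
  then show "t \<in> L \<Longrightarrow> 0 < wt t" unfolding L_def by auto
qed

lemma ip_S:
  assumes v: "v \<in> V" and w: "w \<in> V" and i: "1 \<le> i" "i < n"
  shows "ip (S i v) w = ip v (S i w)"
proof -
  define L' where "L' = {t \<in> L. swp i t \<in> L}"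
  let ?r = "\<lambda>t. rho (t ! (i - 1)) (t ! i)"
  have fL': "finite L'" unfolding L'_def using finite_L by simp
  have ss: "swp i (swp i t) = t" "?r (swp i t) = - ?r t" "wt (swp i t) * (1 + ?r t) = wt t * (1 - ?r t)" if "t \<in> L'" for t
  proof -
    have tL: "t \<in> L" "swp i t \<in> L" using that unfolding L'_def by auto
    obtain u a c x where t: "t = u @ a # c # x" and iu: "i = Suc (length u)"
      using split_L[OF tL(1) i] by metis
    show "swp i (swp i t) = t" unfolding t iu by simp
    show "?r (swp i t) = - ?r t" unfolding t iu using rho_antisym[of c a] by (simp add: nth_append)
    have "\<not> R a c" using L_swap[of u a c x] tL unfolding t iu by simp
    moreover have "\<not> R c a" using L_pair_not_R tL(1) unfolding t by blast
    ultimately show "wt (swp i t) * (1 + ?r t) = wt t * (1 - ?r t)"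
      unfolding t iu using wt_swap[of u a c x] rho_antisym[of c a] by (simp add: phi_def nth_append)
  qed
  have exp: "ip (S i x) y = (\<Sum>t\<in>L. wt t * ?r t * x t * y t) + (\<Sum>t\<in>L'. wt t * (1 - ?r t) * x (swp i t) * y t)"
    if x: "x \<in> V" for x y
  proof -
    have "ip (S i x) y = (\<Sum>t\<in>L. wt t * ?r t * x t * y t + wt t * (1 - ?r t) * x (swp i t) * y t)"
      unfolding ip_def S_def by (intro sum.cong) (auto simp: algebra_simps)
    also have "\<dots> = (\<Sum>t\<in>L. wt t * ?r t * x t * y t) + (\<Sum>t\<in>L. wt t * (1 - ?r t) * x (swp i t) * y t)"
      by (rule sum.distrib)
    also have "(\<Sum>t\<in>L. wt t * (1 - ?r t) * x (swp i t) * y t) = (\<Sum>t\<in>L'. wt t * (1 - ?r t) * x (swp i t) * y t)"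
      unfolding L'_def using finite_L V_outside[OF x] by (intro sum.mono_neutral_right) auto
    finally show ?thesis .
  qed
  have sym: "ip x y = ip y x" for x y unfolding ip_def by (simp add: mult.assoc mult.commute[of "x _"])
  have "(\<Sum>t\<in>L'. wt t * (1 - ?r t) * v (swp i t) * w t) = (\<Sum>t\<in>L'. wt t * (1 - ?r t) * w (swp i t) * v t)"
  proof (rule sum.reindex_bij_witness[where i = "swp i" and j = "swp i"])
    fix t assume t: "t \<in> L'"
    show "swp i (swp i t) = t" using ss(1)[OF t] .
    show "swp i t \<in> L'" using t ss(1)[OF t] unfolding L'_def by simp
    have "wt (swp i t) * (1 - ?r (swp i t)) = wt t * (1 - ?r t)"
      unfolding ss(2)[OF t] using ss(3)[OF t] by simp
    then show "wt (swp i t) * (1 - ?r (swp i t)) * w (swp i (swp i t)) * v (swp i t) = wt t * (1 - ?r t) * v (swp i t) * w t"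
      unfolding ss(1)[OF t] by simp
  qed (use ss(1) in \<open>auto simp: L'_def\<close>)
  then have "ip (S i v) w = ip (S i w) v"
    unfolding exp[OF v] exp[OF w] by (simp add: algebra_simps)
  then show ?thesis using sym by simp
qed

lemma ip_foldr:
  assumes "v \<in> V" "w \<in> V" "\<forall>i\<in>set is. 1 \<le> i \<and> i < n"
  shows "ip (foldr S is v) w = ip v (foldr S (rev is) w)"
  using assms
proof (induction "is" arbitrary: w)
  case (Cons i js)
  have "ip (S i (foldr S js v)) w = ip (foldr S js v) (S i w)"
    using Cons.prems foldr_S_in_V[OF Cons.prems(1)] by (intro ip_S) auto
  also have "\<dots> = ip v (foldr S (rev js) (S i w))" using Cons by auto
  finally show ?case by simp
qed simp

end

text \<open>Three systems are compared: \<open>M\<close> with \<open>b\<close> as a maximal cell,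
  \<open>W\<close> without \<open>b\<close>, and \<open>P\<close> with \<open>b\<close>
  isolated.\<close>

locale rem_sys = M: lin_sys "insert b E" R rho key eps
  for E :: "'c set" and R rho key and eps :: "'c \<Rightarrow> real" and b +
  assumes b_notin: "b \<notin> E" and b_max: "c \<in> E \<Longrightarrow> \<not> R b c"
begin

lemma L_snoc: "t @ [b] \<in> M.L \<longleftrightarrow> t \<in> lsys.L E R"
proof -
  have "distinct (t @ [b]) \<and> set (t @ [b]) = insert b E \<longleftrightarrow> distinct t \<and> set t = E"
    using b_notin by (auto simp: insert_ident)
  moreover have "sorted_wrt (\<lambda>a b. \<not> R b a) (t @ [b]) \<longleftrightarrow> sorted_wrt (\<lambda>a b. \<not> R b a) t" if "set t = E"
    using b_max that by (auto simp: sorted_wrt_append)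
  ultimately show ?thesis unfolding lsys.L_def by blast
qed

sublocale ext_sys E R rho key eps b
proof unfold_locales
  have L: "u @ a # c # (w @ [b]) \<in> M.L" if "u @ a # c # w \<in> lsys.L E R" for u a c w
    using that L_snoc[of "u @ a # c # w"] by simp
  show "finite E" using M.finite_D by simp
  show "inj_on key E" using M.inj_key by (rule inj_on_subset) blast
  show "\<not> R a a" for a by (rule M.R_irrefl)
  show "rho a c = (if key a < key c then 1 else - 1)"
    if "u @ a # c # w \<in> lsys.L E R" "R a c" for u a c w
    using M.rho_R[OF L[OF that(1)] that(2)] .
  show "\<bar>rho a c\<bar> < 1" if "a \<in> E" "c \<in> E" "\<not> R a c" "\<not> R c a" for a c
    using M.rho_less that by simp
  show "rho c a = - rho a c" for c a by (rule M.rho_antisym)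
  show "rho a c * rho c d = rho a d * (rho a c + rho c d)"
    if "u @ a # c # d # w \<in> lsys.L E R" for u a c d w
    using M.rho_rel[of u a c d "w @ [b]"] that L_snoc[of "u @ a # c # d # w"] by simp
  show "rho a c = 0" if "u @ a # c # w \<in> lsys.L E R" "eps a \<noteq> eps c" for u a c w
    using M.rho_eps[OF L[OF that(1)] that(2)] .
  show "eps a * eps a = 1" for a by (rule M.eps_sq)
  show "b \<notin> E" by (rule b_notin)
  show "inj_on key (insert b E)" by (rule M.inj_key)
qed

definition res_last :: "('c list \<Rightarrow> real) \<Rightarrow> 'c list \<Rightarrow> real" where
  "res_last v t = (if t \<in> W.L then v (t @ [b]) else 0)"

definition ext_last :: "('c list \<Rightarrow> real) \<Rightarrow> 'c list \<Rightarrow> real" where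
  "ext_last y t = (if t \<in> M.L \<and> last t = b then y (butlast t) else 0)"

text \<open>The product \<open>S N ... S q\<close>, a coset representative that carries position
  \<open>q\<close> to the end. The reversed product \<open>from_end q\<close> is both its inverse on
  \<open>M.V\<close> and its adjoint for \<open>ip\<close>.\<close>

definition to_end :: "nat \<Rightarrow> ('c list \<Rightarrow> real) \<Rightarrow> 'c list \<Rightarrow> real" where
  "to_end q = foldr M.S (rev [q..<Suc N])"

definition from_end :: "nat \<Rightarrow> ('c list \<Rightarrow> real) \<Rightarrow> 'c list \<Rightarrow> real" where
  "from_end q = foldr M.S [q..<Suc N]"

text \<open>
  Equivariant maps in both directions between the module of \<open>insert b E\<close> and the one where \<open>b\<close> is isolated. As
  \<open>pi0\<close> is essentially the adjoint of \<open>iota\<close>, the composite \<open>pi0 \<circ> iota\<close> is injective, which transfers exactness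
  from the isolated to the maximal cell.
\<close>

definition iota :: "('c list \<Rightarrow> real) \<Rightarrow> 'c list \<Rightarrow> real" where
  "iota v t = (if t \<in> P.L then to_end (Suc (length (takeWhile (\<lambda>a. a \<noteq> b) t))) v (remove1 b t @ [b]) else 0)"

definition pi0 :: "('c list \<Rightarrow> real) \<Rightarrow> 'c list \<Rightarrow> real" where
  "pi0 f = (\<Sum>q\<in>{1..Suc N}. from_end q (ext_last (pos q f)))"

lemma to_end_in_V: "v \<in> M.V \<Longrightarrow> to_end q v \<in> M.V"
  unfolding to_end_def by (rule M.foldr_S_in_V)

lemma from_end_in_V: "v \<in> M.V \<Longrightarrow> from_end q v \<in> M.V"
  unfolding from_end_def by (rule M.foldr_S_in_V)

lemma ext_last_in_V [simp]: "ext_last y \<in> M.V"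
  unfolding ext_last_def M.V_def by simp

lemma res_last_in_V [simp]: "res_last v \<in> W.V"
  unfolding res_last_def W.V_def by simp

lemma res_last_snoc: "v \<in> M.V \<Longrightarrow> res_last v t = v (t @ [b])"
  unfolding res_last_def using M.V_outside[of v "t @ [b]"] L_snoc by auto

lemma ext_last_snoc: "y \<in> W.V \<Longrightarrow> ext_last y (t @ [b]) = y t"
  unfolding ext_last_def using W.V_outside[of y t] L_snoc by auto

lemma res_last_S:
  assumes v: "v \<in> M.V" and i: "1 \<le> i" "i < N"
  shows "res_last (M.S i v) = W.S i (res_last v)"
proof
  fix t
  show "res_last (M.S i v) t = W.S i (res_last v) t"
  proof (cases "t \<in> W.L")
    case True
    obtain u a c w where t: "t = u @ a # c # w" and iu: "i = Suc (length u)"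
      using W.split_L[OF True i] by metis
    have mL: "u @ a # c # (w @ [b]) \<in> M.L" using L_snoc[of t] True unfolding t by simp
    show ?thesis using M.S_append[OF mL, of v] W.S_append[OF True[unfolded t], of "res_last v"] True
      res_last_snoc[OF v] res_last_snoc[OF M.S_in_V] unfolding t iu by simp
  qed (simp add: res_last_def W.S_outside)
qed

lemma ext_last_S:
  assumes y: "y \<in> W.V" and i: "1 \<le> i" "i < N"
  shows "ext_last (W.S i y) = M.S i (ext_last y)"
proof
  fix t
  show "ext_last (W.S i y) t = M.S i (ext_last y) t"
  proof (cases "t \<in> M.L")
    case True
    have "i < card (insert b E)" using i by simp
    then obtain u a c w where t: "t = u @ a # c # w" and iu: "i = Suc (length u)"
      using M.split_L[OF True i(1)] by metis
    have "w \<noteq> []" using M.length_L[OF True] i unfolding t iu by auto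
    then obtain x d where w: "w = x @ [d]" by (metis rev_exhaust)
    have mL: "u @ a # c # (x @ [d]) \<in> M.L" using True unfolding t w .
    note S = M.S_append[OF mL, of "ext_last y"]
    show ?thesis
    proof (cases "d = b")
      case False
      then have "ext_last f (u @ a # c # x @ [d]) = 0" "ext_last f (u @ c # a # x @ [d]) = 0" for f unfolding ext_last_def by auto
      then show ?thesis using S unfolding t w iu by simp
    next
      case True
      have WL: "u @ a # c # x \<in> W.L" using mL L_snoc[of "u @ a # c # x"] True by simp
      show ?thesis using S W.S_append[OF WL, of y] ext_last_snoc[OF y, of "u @ a # c # x"]
        ext_last_snoc[OF y, of "u @ c # a # x"] ext_last_snoc[OF W.S_in_V, of i y "u @ a # c # x"]
        unfolding t w iu True by simp
    qed
  qed (simp add: ext_last_def M.S_outside)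
qed

lemma linear_ext_last: "linear ext_last"
  by (rule linearI) (auto simp: ext_last_def fun_eq_iff)

lemma linear_to_end: "linear (to_end q)"
  unfolding to_end_def by (rule M.linear_foldr_S)

lemma linear_from_end: "linear (from_end q)"
  unfolding from_end_def by (rule M.linear_foldr_S)

lemma linear_iota: "linear iota"
  by (rule linearI) (auto simp: iota_def fun_eq_iff linear_add[OF linear_to_end] linear_scale[OF linear_to_end])

lemma linear_pi0: "linear pi0"
  unfolding pi0_def
proof (rule linear_compose_sum, rule ballI)
  fix q
  show "linear (\<lambda>f. from_end q (ext_last (pos q f)))"
    using linear_compose[OF linear_compose[OF linear_pos linear_ext_last] linear_from_end] by (simp add: o_def)
qed

lemma iota_in_V [simp]: "iota v \<in> P.V"
  unfolding iota_def P.V_def by simp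

lemma pi0_in_V [simp]: "pi0 f \<in> M.V"
  unfolding pi0_def by (intro subspace_sum[OF M.subspace_V] from_end_in_V ext_last_in_V)

lemma pos_iota:
  assumes "v \<in> M.V" "1 \<le> q" "q \<le> Suc N"
  shows "pos q (iota v) = res_last (to_end q v)"
proof
  fix t
  show "pos q (iota v) t = res_last (to_end q v) t"
  proof (cases "t \<in> W.L")
    case True
    obtain x y where t: "t = x @ y" and q: "q = Suc (length x)" using W_split_q[OF True assms(2,3)] by metis
    have bn: "b \<notin> set x" "b \<notin> set y" using True b_notin unfolding t W.L_def by auto
    have "\<forall>a\<in>set x. a \<noteq> b" using bn by blast
    then have "takeWhile (\<lambda>a. a \<noteq> b) (x @ b # y) = x" by (simp add: takeWhile_append2)
    then show ?thesis using True bn q PL_iff[of x y] unfolding t pos_def res_last_def iota_def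
      by (simp add: remove1_append)
  qed (simp add: pos_def res_last_def)
qed

section \<open>Coset representatives and the equivariance of \<open>iota\<close> and
  \<open>pi0\<close>\<close>

lemma to_end_Suc: "1 \<le> q \<Longrightarrow> q \<le> N \<Longrightarrow> to_end q v = to_end (Suc q) (M.S q v)"
  unfolding to_end_def by (subst upt_conv_Cons) auto

lemma from_end_Suc: "1 \<le> q \<Longrightarrow> q \<le> N \<Longrightarrow> from_end q v = M.S q (from_end (Suc q) v)"
  unfolding from_end_def by (subst upt_conv_Cons) auto

lemma upt_split_at:
  assumes "q < k" "k \<le> N"
  shows "[q..<Suc N] = [q..<k - 1] @ (k - 1) # k # [Suc k..<Suc N]"
proof -
  have "[q..<Suc N] = [q..<k - 1] @ [k - 1..<Suc N]"
    using assms upt_add_eq_append[of q "k - 1" "Suc N - (k - 1)"] by simp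
  also have "[k - 1..<Suc N] = (k - 1) # k # [Suc k..<Suc N]"
    using assms by (simp add: upt_conv_Cons del: upt_Suc)
  finally show ?thesis .
qed

text \<open>\<open>S k\<close> permutes the coset representatives up to a generator acting on the
  first \<open>N\<close> positions. The four cases are those of \<open>pos_S\<close>, which is what
  makes \<open>iota\<close> equivariant.\<close>

lemma to_end_S:
  assumes v: "v \<in> M.V" and k: "1 \<le> k" "k \<le> N" and q: "1 \<le> q" "q \<le> Suc N"
  shows "Suc k < q \<Longrightarrow> to_end q (M.S k v) = M.S k (to_end q v)"
    and "q < k \<Longrightarrow> to_end q (M.S k v) = M.S (k - 1) (to_end q v)"
    and "q = k \<Longrightarrow> to_end q (M.S k v) = to_end (Suc k) v"
    and "q = Suc k \<Longrightarrow> to_end q (M.S k v) = to_end k v"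
proof -
  show "to_end q (M.S k v) = M.S k (to_end q v)" if "Suc k < q"
    unfolding to_end_def using k that by (intro M.foldr_S_comm[symmetric] v) auto
  show "to_end q (M.S k v) = to_end (Suc k) v" if "q = k"
    using to_end_Suc[of k "M.S k v"] M.S_invol[OF v k(1)] k that by simp
  show "to_end q (M.S k v) = to_end k v" if "q = Suc k" using to_end_Suc[OF k] that by simp
  show "to_end q (M.S k v) = M.S (k - 1) (to_end q v)" if qk: "q < k"
  proof -
    define z where "z = foldr M.S (rev [q..<k - 1]) v"
    have z: "z \<in> M.V" unfolding z_def by (rule M.foldr_S_in_V[OF v])
    have gq: "to_end q x = foldr M.S (rev [Suc k..<Suc N]) (M.S k (M.S (k - 1) (foldr M.S (rev [q..<k - 1]) x)))" for x
      unfolding to_end_def upt_split_at[OF qk k(2)] by simp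
    have "foldr M.S (rev [q..<k - 1]) (M.S k v) = M.S k z"
      unfolding z_def using k q qk by (intro M.foldr_S_comm[symmetric] v) auto
    then have "to_end q (M.S k v) = foldr M.S (rev [Suc k..<Suc N]) (M.S k (M.S (k - 1) (M.S k z)))"
      unfolding gq by simp
    also have "M.S k (M.S (k - 1) (M.S k z)) = M.S (k - 1) (M.S k (M.S (k - 1) z))"
      using M.S_braid[OF z, of "k - 1"] k q qk by simp
    also have "foldr M.S (rev [Suc k..<Suc N]) \<dots> = M.S (k - 1) (foldr M.S (rev [Suc k..<Suc N]) (M.S k (M.S (k - 1) z)))"
      using k q qk by (intro M.foldr_S_comm[symmetric]) auto
    finally show ?thesis unfolding gq z_def .
  qed
qed

lemma from_end_S:
  assumes v: "v \<in> M.V" and k: "1 \<le> k" "k \<le> N" and q: "1 \<le> q" "q \<le> Suc N"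
  shows "Suc k < q \<Longrightarrow> M.S k (from_end q v) = from_end q (M.S k v)"
    and "q < k \<Longrightarrow> M.S k (from_end q v) = from_end q (M.S (k - 1) v)"
    and "q = k \<Longrightarrow> M.S k (from_end q v) = from_end (Suc k) v"
    and "q = Suc k \<Longrightarrow> M.S k (from_end q v) = from_end k v"
proof -
  show "M.S k (from_end q v) = from_end q (M.S k v)" if "Suc k < q"
    unfolding from_end_def using k that by (intro M.foldr_S_comm v) auto
  show "M.S k (from_end q v) = from_end (Suc k) v" if "q = k"
    using from_end_Suc[OF k] M.S_invol[OF from_end_in_V[OF v] k(1)] k that by simp
  show "M.S k (from_end q v) = from_end k v" if "q = Suc k" using from_end_Suc[OF k] that by simp
  show "M.S k (from_end q v) = from_end q (M.S (k - 1) v)" if qk: "q < k"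
  proof -
    define z where "z = foldr M.S [Suc k..<Suc N] v"
    have z: "z \<in> M.V" unfolding z_def by (rule M.foldr_S_in_V[OF v])
    have hq: "from_end q x = foldr M.S [q..<k - 1] (M.S (k - 1) (M.S k (foldr M.S [Suc k..<Suc N] x)))" for x
      unfolding from_end_def upt_split_at[OF qk k(2)] by simp
    have "foldr M.S [Suc k..<Suc N] (M.S (k - 1) v) = M.S (k - 1) z"
      unfolding z_def using k q qk by (intro M.foldr_S_comm[symmetric] v) auto
    then have "from_end q (M.S (k - 1) v) = foldr M.S [q..<k - 1] (M.S (k - 1) (M.S k (M.S (k - 1) z)))"
      unfolding hq by simp
    also have "M.S (k - 1) (M.S k (M.S (k - 1) z)) = M.S k (M.S (k - 1) (M.S k z))"
      using M.S_braid[OF z, of "k - 1"] k q qk by simp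
    also have "foldr M.S [q..<k - 1] \<dots> = M.S k (foldr M.S [q..<k - 1] (M.S (k - 1) (M.S k z)))"
      using k q qk by (intro M.foldr_S_comm[symmetric]) auto
    finally show ?thesis unfolding hq z_def by simp
  qed
qed

lemma iota_S:
  assumes v: "v \<in> M.V" and k: "1 \<le> k" "k \<le> N"
  shows "iota (M.S k v) = P.S k (iota v)"
proof (rule P_ext)
  fix q assume q: "1 \<le> q" "q \<le> Suc N"
  note g = to_end_S[OF v k q] and p = pos_S[OF iota_in_V k q, of v]
  have pq: "pos q (iota (M.S k v)) = res_last (to_end q (M.S k v))" by (rule pos_iota[OF M.S_in_V q])
  have pi: "pos r (iota v) = res_last (to_end r v)" if "1 \<le> r" "r \<le> Suc N" for r by (rule pos_iota[OF v that])
  have gV: "to_end q v \<in> M.V" by (rule to_end_in_V[OF v])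
  consider "Suc k < q" | "q < k" | "q = k" | "q = Suc k" by linarith
  then show "pos q (iota (M.S k v)) = pos q (P.S k (iota v))"
  proof cases
    case 1
    then show ?thesis unfolding pq g(1)[OF 1] p(1)[OF 1] pi[OF q] using res_last_S[OF gV k(1)] q by simp
  next
    case 2
    then show ?thesis unfolding pq g(2)[OF 2] p(2)[OF 2] pi[OF q] using res_last_S[OF gV, of "k - 1"] q k by simp
  next
    case 3
    then show ?thesis unfolding pq g(3)[OF 3] p(3)[OF 3] using pi[of "Suc k"] k by simp
  next
    case 4
    then show ?thesis unfolding pq g(4)[OF 4] p(4)[OF 4] using pi[of k] k by simp
  qed
qed auto

lemma to_end_X:
  assumes v: "v \<in> M.V" and q: "1 \<le> q" "q \<le> Suc N"
  shows "to_end q (M.X 1 v) = (if q = 1 then M.X (Suc N) (to_end q v) else M.X 1 (to_end q v))"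
proof (cases "q = 1")
  case False
  then show ?thesis unfolding to_end_def using q M.foldr_S_X[of 1 "rev [q..<Suc N]" v] by auto
next
  case True
  have "foldr M.S (rev [1..<Suc m]) (M.X 1 v) = M.X (Suc m) (foldr M.S (rev [1..<Suc m]) v)" if "m \<le> N" for m
    using that
  proof (induction m)
    case (Suc m)
    have "foldr M.S (rev [1..<Suc m]) v \<in> M.V" by (rule M.foldr_S_in_V[OF v])
    then show ?case using Suc M.S_X(2)[of "foldr M.S (rev [1..<Suc m]) v" "Suc m"] by simp
  qed simp
  from this[of N] show ?thesis unfolding to_end_def True by simp
qed

lemma from_end_X:
  assumes v: "v \<in> M.V" and q: "1 \<le> q" "q \<le> Suc N"
  shows "M.X 1 (from_end q v) = (if q = 1 then from_end q (M.X (Suc N) v) else from_end q (M.X 1 v))"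
proof (cases "q = 1")
  case False
  then show ?thesis unfolding from_end_def using q M.foldr_S_X[of 1 "[q..<Suc N]" v] by auto
next
  case True
  have "M.X 1 (foldr M.S [1..<Suc m] v) = foldr M.S [1..<Suc m] (M.X (Suc m) v)" if "m \<le> N" "v \<in> M.V" for m v
    using that
  proof (induction m arbitrary: v)
    case (Suc m)
    have "M.X 1 (foldr M.S [1..<Suc m] (M.S (Suc m) v)) = foldr M.S [1..<Suc m] (M.X (Suc m) (M.S (Suc m) v))"
      using Suc by simp
    also have "M.X (Suc m) (M.S (Suc m) v) = M.S (Suc m) (M.X (Suc (Suc m)) v)"
      using M.S_X(1)[OF Suc.prems(2), of "Suc m"] Suc.prems(1) by simp
    finally show ?case by simp
  qed simp
  from this[of N, OF _ v] show ?thesis unfolding from_end_def True by simp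
qed

lemma hd_ins:
  assumes "q \<noteq> 1" "1 \<le> q" "t \<noteq> []"
  shows "(t @ [b]) ! 0 = t ! 0" "ins q t ! 0 = t ! 0"
proof -
  obtain k where k: "q - 1 = Suc k" using assms(1,2) by (cases "q - 1") auto
  obtain a x where "t = a # x" using assms(3) by (cases t) auto
  then show "(t @ [b]) ! 0 = t ! 0" "ins q t ! 0 = t ! 0" unfolding ins_def k by simp_all
qed

lemma iota_X:
  assumes v: "v \<in> M.V"
  shows "iota (M.X 1 v) = P.X 1 (iota v)"
proof (rule P_ext)
  show "P.X 1 (iota v) \<in> P.V" using P.X_in_V[OF iota_in_V] .
  fix q assume q: "1 \<le> q" "q \<le> Suc N"
  have pq: "pos q (iota (M.X 1 v)) = res_last (to_end q (M.X 1 v))" using pos_iota[OF M.X_in_V[OF v] q] .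
  have pv: "pos q (iota v) = res_last (to_end q v)" by (rule pos_iota[OF v q])
  show "pos q (iota (M.X 1 v)) = pos q (P.X 1 (iota v))"
  proof
    fix t
    show "pos q (iota (M.X 1 v)) t = pos q (P.X 1 (iota v)) t"
    proof (cases "t \<in> W.L")
      case True
      have len: "length t = N" by (rule W.length_L[OF True])
      have v': "iota v (ins q t) = to_end q v (t @ [b])"
        using fun_cong[OF pv, of t] True unfolding pos_def res_last_def by simp
      show ?thesis
      proof (cases "q = 1")
        case True
        have "(t @ [b]) ! N = b" using len by (simp add: nth_append)
        then show ?thesis using \<open>t \<in> W.L\<close> v' unfolding pq to_end_X[OF v q] res_last_def pos_def
          by (simp add: M.X_def P.X_def True ins_def)
      next
        case False
        then have "t \<noteq> []" using q len by auto
        then have "(t @ [b]) ! 0 = t ! 0" "ins q t ! 0 = t ! 0"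
          using hd_ins[OF False q(1)] by auto
        then show ?thesis using \<open>t \<in> W.L\<close> v' False unfolding pq to_end_X[OF v q] res_last_def pos_def
          by (simp add: M.X_def P.X_def)
      qed
    qed (simp add: pos_def)
  qed
qed auto

lemma pi0_S:
  assumes f: "f \<in> P.V" and k: "1 \<le> k" "k \<le> N"
  shows "pi0 (P.S k f) = M.S k (pi0 f)"
proof -
  let ?Q = "{1..Suc N} - {k, Suc k}"
  let ?a = "\<lambda>q. from_end q (ext_last (pos q (P.S k f)))" and ?c = "\<lambda>q. M.S k (from_end q (ext_last (pos q f)))"
  have Q: "{1..Suc N} = insert k (insert (Suc k) ?Q)" using k by auto
  have sum: "(\<Sum>q\<in>{1..Suc N}. h q) = h k + (h (Suc k) + (\<Sum>q\<in>?Q. h q))" for h :: "nat \<Rightarrow> 'c list \<Rightarrow> real"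
    by (subst Q) simp
  have "?a q = ?c q" if "q \<in> ?Q" for q
  proof -
    have q: "1 \<le> q" "q \<le> Suc N" "q \<noteq> k" "q \<noteq> Suc k" using that by auto
    show ?thesis
    proof (cases "q < k")
      case True
      then show ?thesis using pos_S(2)[OF f k q(1,2)] from_end_S(2)[OF ext_last_in_V k q(1,2)]
          ext_last_S[OF pos_in_V, of "k - 1"] q k by simp
    next
      case False
      then have "Suc k < q" using q by simp
      then show ?thesis using pos_S(1)[OF f k q(1,2)] from_end_S(1)[OF ext_last_in_V k q(1,2)]
          ext_last_S[OF pos_in_V, of k] q k by simp
    qed
  qed
  then have "(\<Sum>q\<in>?Q. ?a q) = (\<Sum>q\<in>?Q. ?c q)" by (rule sum.cong[OF refl])
  moreover have "?a k = ?c (Suc k)"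
    using pos_S(3)[OF f k, of k] from_end_S(4)[OF ext_last_in_V k, of "Suc k"] k by simp
  moreover have "?a (Suc k) = ?c k"
    using pos_S(4)[OF f k, of "Suc k"] from_end_S(3)[OF ext_last_in_V k, of k] k by simp
  ultimately have "(\<Sum>q\<in>{1..Suc N}. ?a q) = (\<Sum>q\<in>{1..Suc N}. ?c q)"
    unfolding sum by (simp only: add.left_commute)
  then show ?thesis unfolding pi0_def linear_sum[OF M.linear_S] .
qed

lemma pi0_X:
  assumes f: "f \<in> P.V"
  shows "pi0 (P.X 1 f) = M.X 1 (pi0 f)"
proof -
  have "from_end q (ext_last (pos q (P.X 1 f))) = M.X 1 (from_end q (ext_last (pos q f)))" if "q \<in> {1..Suc N}" for q
  proof -
    have q: "1 \<le> q" "q \<le> Suc N" using that by auto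
    have "ext_last (pos q (P.X 1 f)) = (if q = 1 then M.X (Suc N) (ext_last (pos q f)) else M.X 1 (ext_last (pos q f)))"
    proof
      fix t
      show "ext_last (pos q (P.X 1 f)) t = (if q = 1 then M.X (Suc N) (ext_last (pos q f)) else M.X 1 (ext_last (pos q f))) t"
      proof (cases "t \<in> M.L \<and> last t = b")
        case False
        then show ?thesis by (auto simp: ext_last_def M.X_def)
      next
        case True
        then obtain x where t: "t = x @ [b]" using M.length_L[of t] by (cases t rule: rev_cases) auto
        have xL: "x \<in> W.L" using True L_snoc unfolding t by blast
        have len: "length x = N" by (rule W.length_L[OF xL])
        show ?thesis
        proof (cases "q = 1")
          case q1: True
          show ?thesis using True xL len unfolding t
            by (simp add: ext_last_def M.X_def P.X_def pos_def q1 ins_def nth_append)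
        next
          case q1: False
          then have "x \<noteq> []" using q len by auto
          then have "(x @ [b]) ! 0 = x ! 0" "ins q x ! 0 = x ! 0"
            using hd_ins[OF q1 q(1)] by auto
          then show ?thesis using True xL q1 unfolding t
            by (simp add: ext_last_def M.X_def P.X_def pos_def)
        qed
      qed
    qed
    then show ?thesis using from_end_X[OF ext_last_in_V q] by simp
  qed
  then have "pi0 (P.X 1 f) = (\<Sum>q\<in>{1..Suc N}. M.X 1 (from_end q (ext_last (pos q f))))"
    unfolding pi0_def by (rule sum.cong[OF refl])
  then show ?thesis unfolding pi0_def linear_sum[OF M.linear_X] .
qed

text \<open>\<open>from_end q\<close> is adjoint to \<open>to_end q\<close>, and
  \<open>ext_last\<close> undoes \<open>res_last\<close> on lists ending in \<open>b\<close>. So the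
  quadratic form of the composite is a sum of weighted squares.\<close>

lemma ip_pi0_iota:
  assumes v: "v \<in> M.V"
  shows "M.ip (pi0 (iota v)) v = (\<Sum>q\<in>{1..Suc N}. \<Sum>t\<in>{t \<in> M.L. last t = b}. M.wt t * (to_end q v t)\<^sup>2)"
proof -
  have "M.ip (pi0 (iota v)) v = (\<Sum>q\<in>{1..Suc N}. M.ip (from_end q (ext_last (pos q (iota v)))) v)"
  proof -
    have "M.ip (\<Sum>q\<in>Q. f q) v = (\<Sum>q\<in>Q. M.ip (f q) v)" for f and Q :: "nat set"
      unfolding M.ip_def sum_fun_apply
      by (simp only: sum_distrib_left sum_distrib_right) (rule sum.swap)
    then show ?thesis unfolding pi0_def .
  qed
  also have "\<dots> = (\<Sum>q\<in>{1..Suc N}. \<Sum>t\<in>{t \<in> M.L. last t = b}. M.wt t * (to_end q v t)\<^sup>2)"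
  proof (rule sum.cong[OF refl])
    fix q assume "q \<in> {1..Suc N}"
    then have q: "1 \<le> q" "q \<le> Suc N" by auto
    have "M.ip (from_end q (ext_last (pos q (iota v)))) v = M.ip (ext_last (pos q (iota v))) (to_end q v)"
      unfolding from_end_def to_end_def using q by (intro M.ip_foldr ext_last_in_V v) auto
    also have "\<dots> = M.ip (ext_last (res_last (to_end q v))) (to_end q v)" unfolding pos_iota[OF v q] ..
    also have "\<dots> = (\<Sum>t\<in>{t \<in> M.L. last t = b}. M.wt t * (to_end q v t)\<^sup>2)"
      unfolding M.ip_def
    proof (rule sum.mono_neutral_cong_right)
      show "finite M.L" by (rule M.finite_L)
      fix t assume "t \<in> {t \<in> M.L. last t = b}"
      then have t: "t \<in> M.L" "last t = b" by auto
      then obtain x where tx: "t = x @ [b]" using M.length_L[of t] by (cases t rule: rev_cases) auto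
      have "ext_last (res_last (to_end q v)) t = to_end q v t"
        unfolding tx using ext_last_snoc[OF res_last_in_V] res_last_snoc[OF to_end_in_V[OF v]] by simp
      then show "M.wt t * ext_last (res_last (to_end q v)) t * to_end q v t = M.wt t * (to_end q v t)\<^sup>2"
        by (simp add: power2_eq_square)
    qed (auto simp: ext_last_def)
    finally show "M.ip (from_end q (ext_last (pos q (iota v)))) v = (\<Sum>t\<in>{t \<in> M.L. last t = b}. M.wt t * (to_end q v t)\<^sup>2)" .
  qed
  finally show ?thesis .
qed

lemma M_L_move: "x @ b # y @ z \<in> M.L \<Longrightarrow> x @ y @ b # z \<in> M.L"
proof -
  assume a: "x @ b # y @ z \<in> M.L"
  then have "set y \<subseteq> insert b E" "b \<notin> set y" unfolding M.L_def by auto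
  then have "\<forall>c\<in>set y. \<not> R b c" using b_max by blast
  with a show ?thesis unfolding M.L_def by (auto simp: sorted_wrt_append)
qed

text \<open>By induction on the number of entries behind \<open>b\<close>. If \<open>b\<close>
  stands at position \<open>q\<close>, moving it to the end by \<open>to_end q\<close> multiplies
  the value by positive factors \<open>1 - rho a b\<close>. The other terms come from values of
  \<open>v\<close> at lists with \<open>b\<close> further right, which vanish by induction.\<close>

lemma to_end_zero_imp:
  assumes v: "v \<in> M.V" and 0: "\<And>q t. 1 \<le> q \<Longrightarrow> q \<le> Suc N \<Longrightarrow> t @ [b] \<in> M.L \<Longrightarrow> to_end q v (t @ [b]) = 0"
  shows "v = 0"
proof -
  have main: "v (x @ b # y) = 0" if "x @ b # y \<in> M.L" for x y
    using that
  proof (induction "length y" arbitrary: x y rule: less_induct)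
    case less
    define q where "q = Suc (length x)"
    have len: "length x + length y = N" using M.length_L[OF less.prems] by simp
    define w where "w k = foldr M.S (rev [q..<k]) v" for k
    have w0: "w q = v" unfolding w_def by simp
    have wS: "w (Suc k) = M.S k (w k)" if "q \<le> k" for k unfolding w_def using that by simp
    have wV: "w k \<in> M.V" for k unfolding w_def by (rule M.foldr_S_in_V[OF v])
    \<comment> \<open>Swaps at positions before \<open>b\<close> do not move it, so these values
      remain combinations of values of \<open>v\<close> with fewer entries behind
      \<open>b\<close>.\<close>
    have late: "w k (x' @ b # y') = 0" if "q \<le> k" "k \<le> Suc N" "k \<le> length x'" for k x' y'
      using that
    proof (induction k arbitrary: x' y' rule: dec_induct)
      case base
      show ?case
      proof (cases "x' @ b # y' \<in> M.L")
        case True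
        then have "length y' < length y" using M.length_L[OF True] len base unfolding q_def by simp
        then show ?thesis using less.hyps[OF _ True] w0 by simp
      next
        case False
        then show ?thesis using M.V_outside[OF wV] by simp
      qed
    next
      case (step k)
      show ?case
      proof (cases "x' @ b # y' \<in> M.L")
        case True
        have "1 \<le> k" "k < length x'" using step unfolding q_def by auto
        then obtain u a c x'' where x': "x' = u @ a # c # x''" and k: "k = Suc (length u)"
          using split_at_pair by metis
        have "u @ a # c # (x'' @ b # y') \<in> M.L" using True unfolding x' by simp
        then have "M.S k (w k) (x' @ b # y') = rho a c * w k (x' @ b # y') + (1 - rho a c) * w k ((u @ c # a # x'') @ b # y')"
          using M.S_append[of u a c "x'' @ b # y'" "w k"] unfolding x' k by simp
        then show ?thesis using wS[OF step.hyps(1)] step.IH[of x' y'] step.IH[of "u @ c # a # x''" y'] step.prems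
          unfolding x' by simp
      next
        case False
        then show ?thesis using M.V_outside[OF wV] by simp
      qed
    qed
    have "\<exists>c>0. w (q + length y1) (x @ y1 @ b # y2) = c * v (x @ b # y1 @ y2)" if "x @ b # y1 @ y2 \<in> M.L" for y1 y2
      using that
    proof (induction y1 arbitrary: y2 rule: rev_induct)
      case Nil
      then show ?case using w0 by (intro exI[of _ 1]) simp
    next
      case (snoc a y1)
      let ?k = "q + length y1"
      have len2: "length x + length y1 + length y2 + 1 = N" using M.length_L[OF snoc.prems] by simp
      obtain c where c: "c > 0" "w ?k (x @ y1 @ b # a # y2) = c * v (x @ b # y1 @ a # y2)"
        using snoc.IH[of "a # y2"] snoc.prems by auto
      have l1: "(x @ y1) @ b # a # y2 \<in> M.L" using M_L_move[of x y1 "a # y2"] snoc.prems by simp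
      have l2: "(x @ y1) @ a # b # y2 \<in> M.L" using M_L_move[of x "y1 @ [a]" y2] snoc.prems by simp
      have k: "?k = Suc (length (x @ y1))" unfolding q_def by simp
      have "w (Suc ?k) ((x @ y1) @ a # b # y2) =
          rho a b * w ?k ((x @ y1) @ a # b # y2) + (1 - rho a b) * w ?k ((x @ y1) @ b # a # y2)"
        using wS[of ?k] M.S_append[OF l2, of "w ?k"] k by simp
      moreover have "w ?k ((x @ y1 @ [a]) @ b # y2) = 0"
        by (rule late) (use len2 in \<open>auto simp: q_def\<close>)
      ultimately have "w (q + length (y1 @ [a])) (x @ (y1 @ [a]) @ b # y2) = ((1 - rho a b) * c) * v (x @ b # (y1 @ [a]) @ y2)"
        using c(2) by simp
      moreover have "(1 - rho a b) * c > 0" using M.rho_neq_1[OF l2 l1] c(1) by simp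
      ultimately show ?case by blast
    qed
    from this[of y "[]"] less.prems obtain c where c: "c > 0" "w (q + length y) (x @ y @ [b]) = c * v (x @ b # y)"
      by auto
    have "q + length y = Suc N" using len unfolding q_def by simp
    then have "to_end q v ((x @ y) @ [b]) = c * v (x @ b # y)" using c(2) unfolding w_def to_end_def by simp
    moreover have "(x @ y) @ [b] \<in> M.L" using M_L_move[of x y "[]"] less.prems by simp
    ultimately show ?case using 0[of q "x @ y"] c(1) len unfolding q_def by simp
  qed
  show ?thesis
  proof
    fix t
    show "v t = 0 t"
    proof (cases "t \<in> M.L")
      case True
      then have "b \<in> set t" unfolding M.L_def by auto
      then obtain x y where "t = x @ b # y" by (meson split_list)
      then show ?thesis using main True by simp
    qed (use M.V_outside[OF v] in simp)
  qed
qed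

lemma pi0_iota_inj:
  assumes v: "v \<in> M.V" and "pi0 (iota v) = 0"
  shows "v = 0"
proof (rule to_end_zero_imp[OF v])
  let ?B = "{t \<in> M.L. last t = b}"
  have fB: "finite ?B" using M.finite_L by simp
  have pos: "0 \<le> M.wt t * (to_end q v t)\<^sup>2" if "t \<in> ?B" for q t using M.wt_pos[of t] that by simp
  have "(\<Sum>q\<in>{1..Suc N}. \<Sum>t\<in>?B. M.wt t * (to_end q v t)\<^sup>2) = 0"
    using ip_pi0_iota[OF v] assms(2) by (simp add: M.ip_def)
  then have z: "\<forall>q\<in>{1..Suc N}. (\<Sum>t\<in>?B. M.wt t * (to_end q v t)\<^sup>2) = 0"
    using pos by (subst (asm) sum_nonneg_eq_0_iff) (auto intro: sum_nonneg)
  fix q t assume q: "1 \<le> q" "q \<le> Suc N" and t: "t @ [b] \<in> M.L"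
  have "\<forall>t\<in>?B. M.wt t * (to_end q v t)\<^sup>2 = 0"
    using z q pos fB by (subst sum_nonneg_eq_0_iff[symmetric]) auto
  then show "to_end q v (t @ [b]) = 0" using t M.wt_pos[OF t] by auto
qed

lemma exact_rem:
  assumes lower: "P.lower_exact" and top: "P.top_exact"
  shows "M.lower_exact" "M.top_exact"
proof -
  have io: "iota ` M.Inv I \<subseteq> P.Inv I" "iota ` M.Merged I \<subseteq> P.Merged I" for I
    using Inv_transfer[OF M.lin_sys_axioms P.lin_sys_axioms linear_iota iota_in_V iota_S iota_X, of I] by auto
  have pi: "pi0 ` P.Inv I \<subseteq> M.Inv I" "pi0 ` P.Merged I \<subseteq> M.Merged I" for I
    using Inv_transfer[OF P.lin_sys_axioms M.lin_sys_axioms linear_pi0 pi0_in_V pi0_S pi0_X, of I] by auto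
  have lin: "linear (\<lambda>v. pi0 (iota v))"
    using linear_compose[OF linear_iota linear_pi0] by (simp add: o_def)
  \<comment> \<open>The injective composite maps \<open>B\<close> into \<open>M.Merged I\<close>, so
    \<open>dim B\<close> cannot exceed the dimension of this subspace of \<open>B\<close>.\<close>
  have conclude: "B \<subseteq> M.Merged I" if "B \<subseteq> M.V" "subspace B" "M.Merged I \<subseteq> B" "iota ` B \<subseteq> P.Merged I" for B I
  proof -
    have fB: "fin_dim B" using M.fin_dim_V fin_dim_mono that(1) by blast
    have "dim ((\<lambda>v. pi0 (iota v)) ` B) = dim B"
      using that(1) pi0_iota_inj by (intro fin_dim_dim_image_eq[OF lin fB that(2)]) blast
    moreover have "(\<lambda>v. pi0 (iota v)) ` B \<subseteq> M.Merged I" using that(4) pi(2) by blast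
    ultimately have "dim B \<le> dim (M.Merged I)" using fin_dim_dim_mono[OF M.fin_dim_Merged] by metis
    then show ?thesis using fin_dim_subspace_eq[OF fB that(3) M.subspace_Merged] by blast
  qed
  show "M.lower_exact"
    unfolding M.lower_exact_def
  proof (intro allI impI)
    fix J assume J: "J \<subseteq> {1..M.n}" "M.n \<in> J" "J \<noteq> {M.n}"
    let ?K = "J - {M.n}"
    let ?A = "span (\<Union>j\<in>?K. M.Inv (J - {j}))"
    let ?A' = "span (\<Union>j\<in>?K. P.Inv (J - {j}))"
    show "M.Inv ?K \<inter> ?A \<subseteq> M.Merged ?K"
    proof (rule conclude)
      show "M.Inv ?K \<inter> ?A \<subseteq> M.V" using M.Inv_subset by blast
      show "subspace (M.Inv ?K \<inter> ?A)" by (intro subspace_inter M.subspace_Inv subspace_span)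
      show "M.Merged ?K \<subseteq> M.Inv ?K \<inter> ?A" by (rule M.new_dim_pair(1)[OF J(2,3)])
      have "iota ` ?A = span (\<Union>j\<in>?K. iota ` M.Inv (J - {j}))"
        unfolding linear_span_image[OF linear_iota, symmetric] image_UN ..
      also have "\<dots> \<subseteq> ?A'" using io(1) by (intro span_mono) blast
      finally have "iota ` (M.Inv ?K \<inter> ?A) \<subseteq> P.Inv ?K \<inter> ?A'" using io(1)[of ?K] by blast
      also have "\<dots> \<subseteq> P.Merged ?K" using lower J unfolding P.lower_exact_def by blast
      finally show "iota ` (M.Inv ?K \<inter> ?A) \<subseteq> P.Merged ?K" .
    qed
  qed
  have "M.V \<subseteq> M.Merged {1..M.n}"
  proof (rule conclude)
    show "M.Merged {1..M.n} \<subseteq> M.V" using M.Merged_subset_Inv M.Inv_subset by blast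
    show "iota ` M.V \<subseteq> P.Merged {1..M.n}" using top iota_in_V unfolding P.top_exact_def by blast
  qed (use M.subspace_V in auto)
  then show "M.top_exact" using top unfolding M.top_exact_def P.top_exact_def by simp
qed

theorem exact_step:
  assumes "W.lower_exact" "W.top_exact"
  shows "M.lower_exact" "M.top_exact"
  using exact_rem lower_exact_ext top_exact_ext assms by auto

end

section \<open>Reversal of linear extensions\<close>

locale rev_sys = A: lin_sys D R rho key eps
  for D :: "'c set" and R rho key and eps :: "'c \<Rightarrow> real" +
  assumes two_le: "2 \<le> card D"
begin

abbreviation n :: nat where "n \<equiv> card D"

lemma L_rev: "t \<in> lsys.L D (\<lambda>a c. R c a) \<longleftrightarrow> rev t \<in> A.L"
  unfolding lsys.L_def by (simp add: sorted_wrt_rev)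

sublocale B: lin_sys D "\<lambda>a c. R c a" "\<lambda>a c. rho c a" "\<lambda>a. - key a" eps
proof unfold_locales
  have L: "rev w @ c # a # rev u \<in> A.L" if "u @ a # c # w \<in> lsys.L D (\<lambda>a c. R c a)" for u a c w
    using that L_rev by simp
  show "finite D" by (rule A.finite_D)
  show "inj_on (\<lambda>a. - key a) D" using A.inj_key by (auto simp: inj_on_def)
  show "\<not> R a a" for a by (rule A.R_irrefl)
  show "rho c a = (if - key a < - key c then 1 else - 1)"
    if "u @ a # c # w \<in> lsys.L D (\<lambda>a c. R c a)" "R c a" for u a c w
    using A.rho_R[OF L[OF that(1)] that(2)] by simp
  show "\<bar>rho c a\<bar> < 1" if "a \<in> D" "c \<in> D" "\<not> R c a" "\<not> R a c" for a c
    using A.rho_less that by simp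
  show "rho a c = - rho c a" for c a by (rule A.rho_antisym)
  show "rho c a * rho d c = rho d a * (rho c a + rho d c)"
    if "u @ a # c # d # w \<in> lsys.L D (\<lambda>a c. R c a)" for u a c d w
    using A.rho_rel[of "rev w" d c a "rev u"] that L_rev[of "u @ a # c # d # w"]
    by (simp add: algebra_simps)
  show "rho c a = 0" if "u @ a # c # w \<in> lsys.L D (\<lambda>a c. R c a)" "eps a \<noteq> eps c" for u a c w
    using A.rho_eps[OF L[OF that(1)]] that(2) by simp
  show "eps a * eps a = 1" for a by (rule A.eps_sq)
qed

definition Rv :: "('c list \<Rightarrow> real) \<Rightarrow> 'c list \<Rightarrow> real" where
  "Rv v t = v (rev t)"

definition neg :: "nat \<Rightarrow> nat" where
  "neg i = (if i = n then n else n - i)"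

lemma Rv_Rv [simp]: "Rv (Rv v) = v"
  by (simp add: Rv_def fun_eq_iff)

lemma inj_Rv: "inj Rv"
  by (rule inj_on_inverseI[where g = Rv]) simp

lemma linear_Rv: "linear Rv"
  by (rule linearI) (auto simp: Rv_def fun_eq_iff)

lemma Rv_in_V [simp]: "Rv v \<in> B.V \<longleftrightarrow> v \<in> A.V"
proof -
  have "(\<forall>t. rev t \<notin> A.L \<longrightarrow> v (rev t) = 0) \<longleftrightarrow> (\<forall>t. t \<notin> A.L \<longrightarrow> v t = 0)"
    by (metis rev_rev_ident)
  then show ?thesis unfolding A.V_def B.V_def Rv_def by (simp add: L_rev)
qed

lemma Rv_V: "Rv ` A.V = B.V"
proof
  show "Rv ` A.V \<subseteq> B.V" by auto
  show "B.V \<subseteq> Rv ` A.V"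
  proof
    fix v assume "v \<in> B.V"
    then have "Rv v \<in> A.V" using Rv_in_V[of "Rv v"] by simp
    then show "v \<in> Rv ` A.V" by (intro image_eqI[of _ _ "Rv v"]) auto
  qed
qed

lemma Rv_S:
  assumes "1 \<le> i" "i < n"
  shows "Rv (A.S (n - i) v) = B.S i (Rv v)"
proof
  fix t
  show "Rv (A.S (n - i) v) t = B.S i (Rv v) t"
  proof (cases "t \<in> B.L")
    case True
    obtain u a c w where t: "t = u @ a # c # w" and iu: "i = Suc (length u)"
      using B.split_L[OF True assms] by metis
    have len: "n - Suc (length u) = Suc (length w)" using B.length_L[OF True] unfolding t by simp
    have "rev w @ c # a # rev u \<in> A.L" using True unfolding L_rev t by simp
    from A.S_append[OF this, of v] B.S_append[OF True[unfolded t], of "Rv v"]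
    show ?thesis unfolding t iu len Rv_def by simp
  next
    case False
    then show ?thesis by (simp add: Rv_def L_rev A.S_outside B.S_outside)
  qed
qed

lemma Rv_foldr:
  assumes "\<forall>i\<in>set is. 1 \<le> i \<and> i < n"
  shows "Rv (foldr A.S (map (\<lambda>i. n - i) is) v) = foldr B.S is (Rv v)"
  using assms by (induction "is") (auto simp: Rv_S)

lemma Rv_X:
  assumes "v \<in> A.V"
  shows "Rv (A.X n v) = B.X 1 (Rv v)"
proof
  fix t
  show "Rv (A.X n v) t = B.X 1 (Rv v) t"
  proof (cases "rev t \<in> A.L")
    case True
    then have "length t = n" using A.length_L by fastforce
    then show ?thesis using two_le by (simp add: Rv_def A.X_def B.X_def rev_nth)
  qed (use A.V_outside[OF assms] in \<open>simp add: Rv_def A.X_def B.X_def\<close>)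
qed

lemma om_alt:
  assumes "v \<in> A.V"
  shows "A.om v = A.cox (A.X n v)"
proof -
  have "foldr A.S [k..<n] (A.X n v) = A.X k (foldr A.S [k..<n] v)" if "1 \<le> k" "k \<le> n" for k
    using that(2,1)
  proof (induction k rule: inc_induct)
    case (step k)
    have "[k..<n] = k # [Suc k..<n]" using step by (simp add: upt_conv_Cons)
    then show ?case using step A.S_X(1)[OF A.foldr_S_in_V[OF assms], of k] by simp
  qed simp
  from this[of 1] two_le show ?thesis unfolding A.om_def A.cox_def by simp
qed

text \<open>Reversal turns \<open>om\<close> into its inverse: it reverses the order of the factors
  of \<open>cox\<close>, and \<open>X\<close> at the last position becomes \<open>X 1\<close>. Hence
  it reflects the cycle of fixed spaces with \<open>U n\<close> in its place, as \<open>neg\<close>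
  records.\<close>

lemma om_Rv_om:
  assumes w: "w \<in> A.V"
  shows "B.om (Rv (A.om w)) = Rv w"
proof -
  have m: "map (\<lambda>i. n - i) [1..<n] = rev [1..<n]"
    by (rule nth_equalityI) (auto simp: rev_nth)
  have "B.cox (Rv (A.om w)) = Rv (foldr A.S (rev [1..<n]) (A.om w))"
    unfolding B.cox_def m[symmetric] by (rule Rv_foldr[symmetric]) auto
  also have "foldr A.S (rev [1..<n]) (A.om w) = A.X n w"
    unfolding om_alt[OF w] A.cox_def
    using A.foldr_S_rev[of "A.X n w" "rev [1..<n]"] w by simp
  finally show ?thesis unfolding B.om_def using Rv_X[of "A.X n w"] w by simp
qed

lemma Rv_U:
  assumes i: "i \<in> {1..n}"
  shows "B.U i = Rv ` A.U (neg i)"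
proof -
  have eq: "{v \<in> B.V. B.S i v = v} = Rv ` {v \<in> A.V. A.S (n - i) v = v}" if "1 \<le> i" "i < n" for i
  proof -
    have "B.S i (Rv v) = Rv v \<longleftrightarrow> A.S (n - i) v = v" for v
      unfolding Rv_S[OF that, symmetric] using inj_Rv by (simp add: inj_eq)
    then show ?thesis unfolding Rv_V[symmetric] by auto
  qed
  show ?thesis
  proof (cases "i = n")
    case False
    then show ?thesis using eq[of i] i unfolding B.U_def A.U_def neg_def by auto
  next
    case True
    have "B.U n = B.om ` Rv ` {v \<in> A.V. A.S 1 v = v}"
      unfolding B.U_def using eq[of "n - 1"] two_le by simp
    also have "{v \<in> A.V. A.S 1 v = v} = A.U 1"
      unfolding A.U_def using two_le by simp
    also have "A.U 1 = A.om ` A.U n"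
      by (rule A.om_U_n[OF two_le, symmetric])
    also have "B.om ` Rv ` A.om ` A.U n = Rv ` A.U n"
      unfolding image_image using om_Rv_om A.U_subset[of n] by (intro image_cong) auto
    finally show ?thesis using True unfolding neg_def by simp
  qed
qed

lemma neg_in: "i \<in> {1..n} \<Longrightarrow> neg i \<in> {1..n}"
  unfolding neg_def by auto

lemma neg_neg: "i \<in> {1..n} \<Longrightarrow> neg (neg i) = i"
  unfolding neg_def by auto

lemma inj_neg: "inj_on neg {1..n}"
  by (rule inj_on_inverseI[where g = neg]) (rule neg_neg)

lemma neg_surj: "neg ` {1..n} = {1..n}"
  using neg_in inj_neg by (intro endo_inj_surj) auto

lemma Rv_Inv:
  assumes I: "I \<subseteq> {1..n}"
  shows "B.Inv I = Rv ` A.Inv (neg ` I)"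
proof -
  have c: "neg ` ({1..n} - I) = {1..n} - neg ` I"
    using inj_on_image_set_diff[OF inj_neg _ I, of "{1..n}"] neg_surj by simp
  have "Rv v \<in> B.Inv I \<longleftrightarrow> v \<in> A.Inv (neg ` I)" for v
  proof -
    have "Rv v \<in> B.U i \<longleftrightarrow> v \<in> A.U (neg i)" if "i \<in> {1..n}" for i
      unfolding Rv_U[OF that] using inj_Rv by (simp add: inj_image_mem_iff)
    then show ?thesis unfolding A.Inv_def B.Inv_def c[symmetric] by auto
  qed
  note iff = this
  show ?thesis
  proof (intro set_eqI)
    fix v
    show "v \<in> B.Inv I \<longleftrightarrow> v \<in> Rv ` A.Inv (neg ` I)"
      using iff[of "Rv v"] inj_image_mem_iff[OF inj_Rv, of "Rv v"] by simp
  qed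
qed

lemma neg_diff: "J \<subseteq> {1..n} \<Longrightarrow> j \<in> J \<Longrightarrow> neg ` (J - {j}) = neg ` J - {neg j}"
  by (subst inj_on_image_set_diff[OF inj_neg]) auto

lemma Rv_span_Inv:
  assumes "J \<subseteq> {1..n}" "K \<subseteq> J"
  shows "span (\<Union>j\<in>K. B.Inv (J - {j})) = Rv ` span (\<Union>j\<in>neg ` K. A.Inv (neg ` J - {j}))"
proof -
  have "B.Inv (J - {j}) = Rv ` A.Inv (neg ` J - {neg j})" if "j \<in> K" for j
  proof -
    have "j \<in> J" "J - {j} \<subseteq> {1..n}" using assms that by blast+
    then show ?thesis using Rv_Inv[of "J - {j}"] neg_diff[OF assms(1), of j] by metis
  qed
  then have "(\<Union>j\<in>K. B.Inv (J - {j})) = Rv ` (\<Union>j\<in>neg ` K. A.Inv (neg ` J - {j}))"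
    by auto
  then show ?thesis using linear_span_image[OF linear_Rv] by simp
qed

lemma Rv_Merged:
  assumes J: "J \<subseteq> {1..n}"
  shows "B.Merged J = Rv ` A.Merged (neg ` J)"
proof -
  have "neg ` J - {neg j} \<noteq> {} \<longleftrightarrow> J - {j} \<noteq> {}" if "j \<in> J" for j
    unfolding neg_diff[OF J that, symmetric] by simp
  then have "neg ` {j \<in> J. J - {j} \<noteq> {}} = {j \<in> neg ` J. neg ` J - {j} \<noteq> {}}" by auto
  moreover have "span (\<Union>j\<in>{j \<in> J. J - {j} \<noteq> {}}. B.Inv (J - {j})) =
      Rv ` span (\<Union>j\<in>neg ` {j \<in> J. J - {j} \<noteq> {}}. A.Inv (neg ` J - {j}))"
    by (rule Rv_span_Inv[OF J]) auto
  ultimately show ?thesis unfolding A.Merged_def B.Merged_def by simp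
qed

lemma exact_rev:
  assumes lower: A.lower_exact and top: A.top_exact
  shows B.lower_exact B.top_exact
proof -
  show B.lower_exact
    unfolding B.lower_exact_def
  proof (intro allI impI)
    fix J assume J: "J \<subseteq> {1..n}" "n \<in> J" "J \<noteq> {n}"
    have nn: "neg n = n" unfolding neg_def by simp
    have d: "neg ` (J - {n}) = neg ` J - {n}" using neg_diff[OF J(1,2)] nn by simp
    have "neg ` J - {n} \<noteq> {}" unfolding d[symmetric] using J by auto
    then have J': "neg ` J \<noteq> {n}" by blast
    have "n \<in> neg ` J" using J(2) nn by (metis imageI)
    moreover have "neg ` J \<subseteq> {1..n}" using J(1) neg_surj by blast
    ultimately have "A.Inv (neg ` J - {n}) \<inter> span (\<Union>j\<in>neg ` J - {n}. A.Inv (neg ` J - {j})) \<subseteq> A.Merged (neg ` J - {n})"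
      using lower J' unfolding A.lower_exact_def by blast
    then have "Rv ` A.Inv (neg ` J - {n}) \<inter> Rv ` span (\<Union>j\<in>neg ` J - {n}. A.Inv (neg ` J - {j})) \<subseteq> Rv ` A.Merged (neg ` J - {n})"
      unfolding image_Int[OF inj_Rv, symmetric] by (rule image_mono)
    note im = this
    have s: "J - {n} \<subseteq> {1..n}" using J by auto
    show "B.Inv (J - {n}) \<inter> span (\<Union>j\<in>J - {n}. B.Inv (J - {j})) \<subseteq> B.Merged (J - {n})"
      unfolding Rv_Inv[OF s] Rv_Merged[OF s] Rv_span_Inv[OF J(1) Diff_subset] d by (rule im)
  qed
  have "B.V \<subseteq> B.Merged {1..n}"
    unfolding Rv_Merged[OF order_refl] neg_surj Rv_V[symmetric]
    using top unfolding A.top_exact_def by (intro image_mono) simp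
  then show B.top_exact unfolding B.top_exact_def using two_le by simp
qed

end

section \<open>Coloured convex sets of cells\<close>

context lin_sys
begin

text \<open>The spaces alternate round the cycle between two complements, so \<open>Inv I\<close>
  vanishes as soon as the complement of \<open>I\<close> contains an odd and an even position. This
  leaves only \<open>J = {1, 2, 3, 4}\<close> and \<open>J = {1, 3, 4}\<close> to be
  examined.\<close>

lemma exact_core_square:
  assumes n: "n = 4" and U: "U 3 = U 1" "U 4 = U 2" "U 1 \<inter> U 2 \<subseteq> {0}" "V \<subseteq> span (U 1 \<union> U 2)"
  shows lower_exact top_exact
proof -
  have set4: "{1..n} = {1, 2, 3, 4}" unfolding n by auto
  have W: "Inv I = {0}" if "i \<in> {1..n} - I" "j \<in> {1..n} - I" "i \<in> {1, 3}" "j \<in> {2, 4}" for I i j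
  proof -
    have "Inv I \<subseteq> U i \<inter> U j" using that(1,2) unfolding Inv_def by blast
    also have "\<dots> \<subseteq> {0}" using U that(3,4) by auto
    finally show ?thesis using subspace_0[OF subspace_Inv, of I] by blast
  qed
  have MM0: "0 \<in> Merged J" for J by (rule subspace_0[OF subspace_Merged])
  show lower_exact
    unfolding lower_exact_def
  proof (intro allI impI)
    fix J assume J: "J \<subseteq> {1..n}" "n \<in> J" "J \<noteq> {n}"
    show "Inv (J - {n}) \<inter> span (\<Union>j\<in>J - {n}. Inv (J - {j})) \<subseteq> Merged (J - {n})"
    proof (cases "1 \<in> J \<and> 3 \<in> J")
      case False
      then obtain i where "i \<in> {1, 3}" "i \<notin> J" by blast
      then have "Inv (J - {n}) = {0}" by (intro W[of i _ 4]) (use n in auto)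
      then show ?thesis using MM0 by auto
    next
      case 13: True
      show ?thesis
      proof (cases "2 \<in> J")
        case True
        moreover have "J \<subseteq> {1, 2, 3, 4}" "4 \<in> J" using J(1,2) unfolding set4 unfolding n by simp_all
        ultimately have "J = {1..n}" using 13 unfolding set4 by blast
        then have Jn: "J - {n} = {1, 2, 3}" unfolding set4 n by auto
        have "Inv {1, 2, 3} \<subseteq> Inv {1, 3}" using U(2) unfolding Inv_def set4 by auto
        also have "{1, 3} = {1, 2, 3} - {2::nat}" by auto
        also have "Inv ({1, 2, 3} - {2}) \<subseteq> Merged {1, 2, 3}"
          unfolding Merged_def by (rule order_trans[OF _ span_superset]) auto
        finally show ?thesis unfolding Jn by blast
      next
        case False
        moreover have "J \<subseteq> {1, 2, 3, 4}" "4 \<in> J" using J(1,2) unfolding set4 unfolding n by simp_all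
        ultimately have Je: "J = {1, 3, 4}" using 13 by blast
        then have Jn: "J - {n} = {1, 3}" unfolding n by auto
        have "Inv (J - {j}) = {0}" if "j \<in> J - {n}" for j
          by (rule W[of j _ 2]) (use that n Je in auto)
        then have "span (\<Union>j\<in>J - {n}. Inv (J - {j})) = span {0}" using Jn by auto
        then show ?thesis using MM0 by auto
      qed
    qed
  qed
  have "U i \<subseteq> Merged {1..n}" if "i \<in> {1, 2}" for i
  proof -
    have "{1..n} - {i} \<noteq> {}" "i \<in> {1..n}" using that unfolding set4 by auto
    moreover from this have "U i \<subseteq> Inv ({1..n} - {i})" unfolding Inv_def using U_subset by auto
    ultimately show ?thesis
      unfolding Merged_def by (intro order_trans[OF _ span_superset]) (rule order_trans[OF _ UN_upper[of i]], simp_all)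
  qed
  then have "span (U 1 \<union> U 2) \<subseteq> Merged {1..n}" by (intro span_minimal subspace_Merged) auto
  then show top_exact unfolding top_exact_def using U(4) n by auto
qed

lemma exact_core_pair:
  assumes n: "n = 2" and U: "U 1 \<inter> U 2 \<subseteq> {0}" "V \<subseteq> span (U 1 \<union> U 2)"
  shows lower_exact top_exact
proof -
  have set2: "{1..n} = {1, 2}" unfolding n by auto
  have W: "Inv {1} = U 2" "Inv {2} = U 1" unfolding Inv_def set2 using U_subset by auto
  show lower_exact
    unfolding lower_exact_def
  proof (intro allI impI)
    fix J assume "J \<subseteq> {1..n}" "n \<in> J" "J \<noteq> {n}"
    then have "J \<subseteq> {1, 2}" "2 \<in> J" "J \<noteq> {2}" unfolding set2 unfolding n .
    then have J: "J = {1, 2}" by auto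
    then have J': "J - {n} = {1}" "J - {1} = {2}" using n by auto
    have "(\<Union>j\<in>J - {n}. Inv (J - {j})) = U 1" unfolding J'(1) using J'(2) W(2) by simp
    then have "span (\<Union>j\<in>J - {n}. Inv (J - {j})) = U 1" using span_eq_iff[of "U 1"] subspace_U by metis
    then have "Inv (J - {n}) \<inter> span (\<Union>j\<in>J - {n}. Inv (J - {j})) \<subseteq> {0}"
      unfolding J'(1) W using U(1) by (simp only: Int_commute)
    then show "Inv (J - {n}) \<inter> span (\<Union>j\<in>J - {n}. Inv (J - {j})) \<subseteq> Merged (J - {n})"
      using subspace_0[OF subspace_Merged, of "J - {n}"] by blast
  qed
  have "{1, 2} - {1} = {2::nat}" "{1, 2} - {2} = {1::nat}" by auto
  then have "U 1 \<union> U 2 \<subseteq> Merged {1..n}"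
    unfolding Merged_def set2 using W by (intro order_trans[OF _ span_superset]) auto
  then have "span (U 1 \<union> U 2) \<subseteq> Merged {1..n}" by (rule span_minimal[OF _ subspace_Merged])
  then show top_exact unfolding top_exact_def using U(2) n by auto
qed

end

section \<open>Cells, contents and colours\<close>

type_synonym cell = "nat \<times> nat"

definition nw :: "cell \<Rightarrow> cell \<Rightarrow> bool" where
  "nw a c \<longleftrightarrow> a \<noteq> c \<and> fst a \<le> fst c \<and> snd a \<le> snd c"

definition content :: "cell \<Rightarrow> real" where
  "content a = real (snd a) - real (fst a)"

definition crho :: "(cell \<Rightarrow> real) \<Rightarrow> cell \<Rightarrow> cell \<Rightarrow> real" where
  "crho eps a c = (if eps a = eps c then 1 / (content c - content a) else 0)"

text \<open>
  Labels increase from left to right and, within a column, upwards. Equal entries of a tableau are then met in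
  the order of the labels.
\<close>

definition ckey :: "nat \<Rightarrow> cell \<Rightarrow> int" where
  "ckey K a = int (snd a) * int K - int (fst a)"

lemma ckey_less_iff:
  assumes "fst a < K" "fst c < K"
  shows "ckey K a < ckey K c \<longleftrightarrow> snd a < snd c \<or> (snd a = snd c \<and> fst c < fst a)"
proof -
  have l: "ckey K a < ckey K c" if "snd a < snd c" "fst a < K" "fst c < K" for a c
  proof -
    have "(int (snd a) + 1) * int K \<le> int (snd c) * int K"
      using that(1) by (intro mult_right_mono) auto
    then show ?thesis unfolding ckey_def using that(2,3) by (simp add: distrib_right)
  qed
  have "snd a = snd c \<Longrightarrow> ckey K a < ckey K c \<longleftrightarrow> fst c < fst a" unfolding ckey_def by auto
  then show ?thesis using l[of a c] l[of c a] assms by (cases "snd a" "snd c" rule: linorder_cases) auto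
qed

locale coloured_shape =
  fixes D :: "cell set" and eps :: "cell \<Rightarrow> real" and K :: nat
  assumes finite: "finite D"
    and convex: "a \<in> D \<Longrightarrow> c \<in> D \<Longrightarrow> fst a \<le> i \<Longrightarrow> i \<le> fst c \<Longrightarrow> snd a \<le> j \<Longrightarrow> j \<le> snd c \<Longrightarrow> (i, j) \<in> D"
    and K: "a \<in> D \<Longrightarrow> fst a < K"
    and eps2: "eps a * eps a = 1"
    and eps_adj: "a \<in> D \<Longrightarrow> c \<in> D \<Longrightarrow> adjacent_cells a c \<Longrightarrow> eps a = eps c"
begin

lemma between_in:
  assumes "u @ a # w \<in> lsys.L D nw" "m \<in> D" "nw a m"
  shows "m \<in> set w"
  using assms unfolding lsys.L_def by (auto simp: sorted_wrt_append nw_def)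

lemma between_in':
  assumes "u @ a # w \<in> lsys.L D nw" "m \<in> D" "nw m a"
  shows "m \<in> set u"
  using assms unfolding lsys.L_def by (auto simp: sorted_wrt_append nw_def)

lemma L_in_D: "t \<in> lsys.L D nw \<Longrightarrow> set t = D \<and> distinct t"
  unfolding lsys.L_def by auto

text \<open>A cell strictly between \<open>a\<close> and \<open>c\<close> in the order would stand
  between them in the list as well; by convexity there is one unless \<open>a\<close> and
  \<open>c\<close> are adjacent.\<close>

lemma consecutive:
  assumes t: "u @ a # c # w \<in> lsys.L D nw" and ac: "nw a c"
  shows "(fst c = fst a \<and> snd c = Suc (snd a)) \<or> (snd c = snd a \<and> fst c = Suc (fst a))"
proof -
  have in_D: "a \<in> D" "c \<in> D" using L_in_D[OF t] by auto
  have no: "\<not> (nw a m \<and> nw m c)" if "m \<in> D" for m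
  proof
    assume m: "nw a m \<and> nw m c"
    have "m \<in> set (c # w)" using between_in[OF t that] m by blast
    moreover have "m \<in> set (u @ [a])" using between_in'[of "u @ [a]" c w m] t m that by simp
    ultimately show False using L_in_D[OF t] by auto
  qed
  show ?thesis
  proof (cases "fst a = fst c")
    case True
    then have "snd a < snd c" using ac unfolding nw_def by (cases a, cases c) auto
    moreover have "(fst a, Suc (snd a)) \<in> D" using convex[OF in_D] True calculation by auto
    from no[OF this] have "snd c = Suc (snd a)" using True calculation unfolding nw_def by (cases a, cases c) auto
    ultimately show ?thesis using True by simp
  next
    case False
    then have l: "fst a < fst c" "snd a \<le> snd c" using ac unfolding nw_def by auto
    have "(Suc (fst a), snd a) \<in> D" using convex[OF in_D] l by auto
    from no[OF this] show ?thesis using l unfolding nw_def by (cases a, cases c) auto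
  qed
qed

lemma incomparable_content:
  "a \<noteq> c \<Longrightarrow> \<not> nw a c \<Longrightarrow> \<not> nw c a \<Longrightarrow> \<bar>content c - content a\<bar> \<ge> 2"
  unfolding nw_def content_def by auto

text \<open>Cells with equal contents are comparable, so \<open>a\<close> and \<open>d\<close> would
  lie on one diagonal. By convexity the right and the lower neighbour of \<open>a\<close> both come
  strictly between them, but the list has room for \<open>c\<close> only.\<close>

lemma content_near:
  assumes t: "u @ a # c # d # w \<in> lsys.L D nw"
  shows "content a \<noteq> content c" "content c \<noteq> content d" "content a \<noteq> content d"
proof -
  have near: "content a \<noteq> content c" if "u @ a # c # w \<in> lsys.L D nw" for u a c w
  proof (cases "nw a c")
    case True
    then show ?thesis using consecutive[OF that] unfolding content_def by auto
  next
    case False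
    moreover have "a \<noteq> c" using L_in_D[OF that] by auto
    moreover have "\<not> nw c a" using that unfolding lsys.L_def by (auto simp: sorted_wrt_append)
    ultimately show ?thesis using incomparable_content[of a c] by auto
  qed
  show "content a \<noteq> content c" using near[OF t] .
  show "content c \<noteq> content d" using near[of "u @ [a]" c d w] t by simp
  show "content a \<noteq> content d"
  proof
    assume eq: "content a = content d"
    have in_D: "a \<in> D" "d \<in> D" and ad: "a \<noteq> d" using L_in_D[OF t] by auto
    have "\<not> nw d a" using t unfolding lsys.L_def by (auto simp: sorted_wrt_append)
    then have "nw a d" using incomparable_content[of a d] eq ad by auto
    then have l: "fst a < fst d" "snd a < snd d"
      using eq unfolding nw_def content_def by (cases a, cases d, auto)+
    have "m = c" if "m \<in> D" "nw a m" "nw m d" for m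
    proof -
      have "m \<in> set (c # d # w)" using between_in[OF t that(1,2)] .
      moreover have "m \<in> set (u @ [a, c])" using between_in'[of "u @ [a, c]" d w m] t that by simp
      ultimately show ?thesis using L_in_D[OF t] by auto
    qed
    from this[of "(Suc (fst a), snd a)"] this[of "(fst a, Suc (snd a))"]
    show False using convex[OF in_D] l unfolding nw_def by (cases a, cases d) auto
  qed
qed

sublocale lin_sys D nw "crho eps" "ckey K" eps
proof unfold_locales
  show "finite D" by (rule finite)
  show "inj_on (ckey K) D"
  proof (rule inj_onI)
    fix a c assume "a \<in> D" "c \<in> D" "ckey K a = ckey K c"
    then show "a = c" using ckey_less_iff[of a K c] ckey_less_iff[of c K a] K by (cases a, cases c) auto
  qed
  show "\<not> nw a a" for a unfolding nw_def by simp
  show "crho eps a c = (if ckey K a < ckey K c then 1 else - 1)"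
    if t: "u @ a # c # w \<in> lsys.L D nw" and ac: "nw a c" for u a c w
  proof -
    have in_D: "a \<in> D" "c \<in> D" using L_in_D[OF t] by auto
    note cons = consecutive[OF t ac]
    then have "eps a = eps c" using eps_adj[OF in_D] unfolding adjacent_cells_def by auto
    then show ?thesis using cons ckey_less_iff[of a K c] K in_D unfolding crho_def content_def by auto
  qed
  \<comment> \<open>For \<open>a = c\<close> the content difference is 0 and so, by the convention
    on division, is the quotient.\<close>
  show "\<bar>crho eps a c\<bar> < 1" if "a \<in> D" "c \<in> D" "\<not> nw a c" "\<not> nw c a" for a c
    using incomparable_content[of a c] that by (cases "a = c") (auto simp: crho_def)
  show "crho eps c a = - crho eps a c" for c a
    unfolding crho_def using minus_divide_right[of 1 "content c - content a"] by simp
  show "crho eps a c * crho eps c d = crho eps a d * (crho eps a c + crho eps c d)"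
    if t: "u @ a # c # d # w \<in> lsys.L D nw" for u a c d w
  proof -
    have frac: "1 / p * (1 / q) = 1 / (p + q) * (1 / p + 1 / q)" if "p \<noteq> 0" "q \<noteq> 0" "p + q \<noteq> 0" for p q :: real
      using that by (simp add: add_frac_eq add.commute)
    show ?thesis
      using frac[of "content c - content a" "content d - content c"] content_near[OF t] unfolding crho_def by auto
  qed
  show "crho eps a c = 0" if "u @ a # c # w \<in> lsys.L D nw" "eps a \<noteq> eps c" for u a c w
    using that unfolding crho_def by simp
  show "eps a * eps a = 1" for a by (rule eps2)
qed

lemma eps_comparable:
  assumes "a \<in> D" "c \<in> D" "fst a \<le> fst c" "snd a \<le> snd c"
  shows "eps a = eps c"
  using assms
proof (induction "fst c - fst a + (snd c - snd a)" arbitrary: a rule: less_induct)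
  case less
  show ?case
  proof (cases "fst a = fst c \<and> snd a = snd c")
    case True
    then show ?thesis by (cases a, cases c) auto
  next
    case False
    define m where "m = (if fst a < fst c then (Suc (fst a), snd a) else (fst a, Suc (snd a)))"
    have "m \<in> D" unfolding m_def using convex[OF less.prems(1,2)] less.prems False by auto
    moreover have "adjacent_cells a m" unfolding m_def adjacent_cells_def by simp
    moreover have "eps m = eps c"
      using less.prems False calculation(1) by (intro less.hyps) (auto simp: m_def)
    ultimately show ?thesis using eps_adj[OF less.prems(1)] by simp
  qed
qed

end

section \<open>Building a shape from a core by extremal cells\<close>

definition exact_shape :: "cell set \<Rightarrow> (cell \<Rightarrow> real) \<Rightarrow> bool" where
  "exact_shape D eps \<longleftrightarrow> lsys.lower_exact D nw (crho eps) eps \<and> lsys.top_exact D nw (crho eps) eps"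

lemma exact_shape_insert_max:
  assumes "coloured_shape E eps K" "coloured_shape (insert b E) eps K" "b \<notin> E"
    and "\<And>c. c \<in> E \<Longrightarrow> \<not> nw b c" and "exact_shape E eps"
  shows "exact_shape (insert b E) eps"
proof -
  interpret M: coloured_shape "insert b E" eps K by fact
  interpret rem_sys E nw "crho eps" "ckey K" eps b
    using assms by unfold_locales auto
  show ?thesis using exact_step assms(5) unfolding exact_shape_def by blast
qed

text \<open>A minimal cell is maximal for the reversed order. Exactness of \<open>E\<close> is
  reversed, extended and reversed back; the notion does not involve the keys, so their double
  negation is harmless.\<close>

lemma exact_shape_insert_min:
  assumes "coloured_shape E eps K" "coloured_shape (insert b E) eps K" "b \<notin> E"
    and min: "\<And>c. c \<in> E \<Longrightarrow> \<not> nw c b" and ex: "exact_shape E eps"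
  shows "exact_shape (insert b E) eps"
proof -
  interpret E: coloured_shape E eps K by fact
  interpret M: coloured_shape "insert b E" eps K by fact
  have two: "2 \<le> card E" using ex unfolding exact_shape_def E.top_exact_def by blast
  then have two': "2 \<le> card (insert b E)" using assms(3) E.finite by simp
  interpret RE: rev_sys E nw "crho eps" "ckey K" eps
    using two by unfold_locales
  interpret RM: rev_sys "insert b E" nw "crho eps" "ckey K" eps
    using two' by unfold_locales
  interpret rem: rem_sys E "\<lambda>a c. nw c a" "\<lambda>a c. crho eps c a" "\<lambda>a. - ckey K a" eps b
    using assms(3) min by unfold_locales auto
  interpret RR: rev_sys "insert b E" "\<lambda>a c. nw c a" "\<lambda>a c. crho eps c a" "\<lambda>a. - ckey K a" eps
    using two' by unfold_locales
  have "RE.B.lower_exact" "RE.B.top_exact" using RE.exact_rev ex unfolding exact_shape_def by auto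
  then have "RM.B.lower_exact" "RM.B.top_exact" using rem.exact_step by auto
  then show ?thesis using RR.exact_rev unfolding exact_shape_def by auto
qed

lemma coloured_shape_remove:
  assumes "coloured_shape D eps K" and "(\<forall>c\<in>D. \<not> nw b c) \<or> (\<forall>c\<in>D. \<not> nw c b)"
  shows "coloured_shape (D - {b}) eps K"
proof -
  interpret coloured_shape D eps K by fact
  show ?thesis
  proof
    fix a c i j assume h: "a \<in> D - {b}" "c \<in> D - {b}" "fst a \<le> i" "i \<le> fst c" "snd a \<le> j" "j \<le> snd c"
    then have "(i, j) \<in> D" using convex[of a c i j] by auto
    moreover have "(i, j) \<noteq> b" using assms(2) h unfolding nw_def by (metis DiffE fst_conv singletonI snd_conv)
    ultimately show "(i, j) \<in> D - {b}" by simp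
  qed (use finite K eps2 eps_adj in auto)
qed

text \<open>Maximal or minimal cells of \<open>D\<close> outside \<open>C\<close> are removed one by
  one. When none is left, every cell of \<open>D\<close> lies between a minimal and a maximal cell,
  both in \<open>C\<close>, and convexity of \<open>C\<close> gives
  \<open>D \<subseteq> C\<close>.\<close>

lemma exact_shape_extend:
  assumes "coloured_shape D eps K" "C \<subseteq> D" "exact_shape C eps"
    and conv: "\<And>a c i j. a \<in> C \<Longrightarrow> c \<in> C \<Longrightarrow> fst a \<le> i \<Longrightarrow> i \<le> fst c \<Longrightarrow> snd a \<le> j \<Longrightarrow> j \<le> snd c \<Longrightarrow> (i, j) \<in> C"
  shows "exact_shape D eps"
  using assms(1,2)
proof (induction "card D" arbitrary: D rule: less_induct)
  case less
  interpret coloured_shape D eps K by fact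
  show ?case
  proof (cases "\<exists>b\<in>D - C. (\<forall>c\<in>D. \<not> nw b c) \<or> (\<forall>c\<in>D. \<not> nw c b)")
    case True
    then obtain b where b: "b \<in> D" "b \<notin> C" and ext: "(\<forall>c\<in>D. \<not> nw b c) \<or> (\<forall>c\<in>D. \<not> nw c b)" by blast
    have D: "insert b (D - {b}) = D" using b by auto
    have E: "coloured_shape (D - {b}) eps K" by (rule coloured_shape_remove[OF less.prems(1) ext])
    have "card (D - {b}) < card D" using b finite by (metis card_Diff1_less)
    then have ex: "exact_shape (D - {b}) eps" using less.hyps E less.prems(2) b by blast
    show ?thesis
      using exact_shape_insert_max[OF E, of b] exact_shape_insert_min[OF E, of b] less.prems(1) ex ext
      unfolding D by blast
  next
    case False
    have "D \<subseteq> C"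
    proof
      fix x assume x: "x \<in> D"
      let ?s = "\<lambda>a::cell. int (fst a) + int (snd a)"
      let ?le = "\<lambda>a c::cell. fst a \<le> fst c \<and> snd a \<le> snd c"
      have nws: "nw a c \<Longrightarrow> ?s a < ?s c" for a c unfolding nw_def by (cases a, cases c) auto
      let ?up = "{c \<in> D. ?le x c}" and ?dn = "{c \<in> D. ?le c x}"
      have "x \<in> ?up" "x \<in> ?dn" using x by auto
      then have "?s ` ?up \<noteq> {}" "?s ` ?dn \<noteq> {}" by blast+
      then have "Max (?s ` ?up) \<in> ?s ` ?up" "Min (?s ` ?dn) \<in> ?s ` ?dn"
        using finite by (intro Max_in Min_in; simp)+
      then obtain p where p: "p \<in> ?up" "?s p = Max (?s ` ?up)" by (metis (no_types, lifting) imageE)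
      have max0: "?s c \<le> ?s p" if "c \<in> ?up" for c unfolding p(2) using finite that by (intro Max_ge) auto
      have "\<forall>c\<in>D. \<not> nw p c"
      proof (intro ballI notI)
        fix c assume c: "c \<in> D" "nw p c"
        then have "c \<in> ?up" using p(1) unfolding nw_def by auto
        then show False using max0 nws[OF c(2)] by fastforce
      qed
      then have pC: "p \<in> C" using False p(1) by blast
      obtain q where q: "q \<in> ?dn" "?s q = Min (?s ` ?dn)"
        using \<open>Min (?s ` ?dn) \<in> ?s ` ?dn\<close> by (metis (no_types, lifting) imageE)
      have qm: "?s q \<le> ?s c" if "c \<in> ?dn" for c unfolding q(2) using finite that by (intro Min_le) auto
      have "\<forall>c\<in>D. \<not> nw c q"
      proof (intro ballI notI)
        fix c assume c: "c \<in> D" "nw c q"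
        then have "c \<in> ?dn" using q(1) unfolding nw_def by auto
        then show False using qm nws[OF c(2)] by fastforce
      qed
      then have qC: "q \<in> C" using False q(1) by blast
      show "x \<in> C" using conv[OF qC pC, of "fst x" "snd x"] p(1) q(1) by simp
    qed
    then show ?thesis using assms(3) less.prems(2) by (metis subset_antisym)
  qed
qed

text \<open>
  Here \<open>U 1 = U 3\<close> and \<open>U 2 = U 4\<close> are two different lines in a plane. This and the following lemma are the only
  places where a configuration absent from connected ribbons is needed.
\<close>

lemma exact_square:
  assumes "coloured_shape {(i, j), (i, Suc j), (Suc i, j), (Suc i, Suc j)} eps K"
  shows "exact_shape {(i, j), (i, Suc j), (Suc i, j), (Suc i, Suc j)} eps"
proof -
  define a b c d where abcd: "a = (i, j)" "b = (i, Suc j)" "c = (Suc i, j)" "d = (Suc i, Suc j)"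
  interpret coloured_shape "{a, b, c, d}" eps K unfolding abcd by (rule assms)
  have rel: "nw a b" "nw a c" "nw a d" "nw b d" "nw c d" "\<not> nw b c" "\<not> nw c b" "\<not> nw d b" "\<not> nw d c"
    "\<not> nw d a" "\<not> nw b a" "\<not> nw c a" and dist: "distinct [a, b, c, d]"
    unfolding nw_def abcd by auto
  define t1 t2 where t: "t1 = [a, b, c, d]" "t2 = [a, c, b, d]"
  have nL: "n = 4" using dist by simp
  have L: "L = {t1, t2}"
  proof
    show "{t1, t2} \<subseteq> L" unfolding L_def t using dist rel by auto
    show "L \<subseteq> {t1, t2}"
    proof
      fix s assume s: "s \<in> L"
      then have "length s = 4" using length_L nL by simp
      then obtain w x y z where s4: "s = [w, x, y, z]" by (auto simp: length_Suc_conv numeral_eq_Suc)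
      have ds: "distinct [w, x, y, z]" and set: "{w, x, y, z} = {a, b, c, d}"
        and srt: "sorted_wrt (\<lambda>a b. \<not> nw b a) [w, x, y, z]"
        using s unfolding L_def s4 by auto
      have min: "\<forall>e\<in>{a, b, c, d}. e \<noteq> a \<longrightarrow> nw a e" and max: "\<forall>e\<in>{a, b, c, d}. e \<noteq> d \<longrightarrow> nw e d"
        using rel by auto
      have "w = a"
      proof (rule ccontr)
        assume "w \<noteq> a"
        moreover have "w \<in> {a, b, c, d}" "a \<in> {w, x, y, z}" using set by auto
        ultimately have "nw a w" "a \<in> {x, y, z}" using min by auto
        then show False using srt by auto
      qed
      moreover have "z = d"
      proof (rule ccontr)
        assume "z \<noteq> d"
        moreover have "z \<in> {a, b, c, d}" "d \<in> {w, x, y, z}" using set by auto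
        ultimately have "nw z d" "d \<in> {w, x, y}" using max by auto
        then show False using srt by auto
      qed
      moreover have "x \<in> {a, b, c, d}" "y \<in> {a, b, c, d}" using set by auto
      ultimately show "s \<in> {t1, t2}" using ds unfolding s4 t by auto
    qed
  qed
  have "eps a = eps b" "eps a = eps c" "eps b = eps d"
    by (auto intro!: eps_adj simp: adjacent_cells_def abcd)
  then have rho: "crho eps a b = 1" "crho eps a c = - 1" "crho eps b c = - 1 / 2" "crho eps c b = 1 / 2"
    "crho eps b d = - 1" "crho eps c d = 1"
    unfolding crho_def content_def abcd by auto
  have out: "v [c, a, b, d] = 0" "v [a, c, d, b] = 0" if "v \<in> V" for v
    using V_outside[OF that] rel unfolding L_def by auto
  have neq: "t1 \<noteq> t2" using dist unfolding t by auto
  have inL: "t1 \<in> L" "t2 \<in> L" using L by auto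
  have fix_iff: "S k v = v \<longleftrightarrow> S k v t1 = v t1 \<and> S k v t2 = v t2" if "v \<in> V" for k v
  proof
    assume h: "S k v t1 = v t1 \<and> S k v t2 = v t2"
    show "S k v = v"
    proof
      fix s show "S k v s = v s" using h L S_outside[of s k v] V_outside[OF that, of s] by (cases "s \<in> L") auto
    qed
  qed simp
  have S: "S 1 v t1 = v t1" "S 1 v t2 = - v t2" "S 3 v t1 = v t1" "S 3 v t2 = - v t2"
    "S 2 v t1 = - v t1 / 2 + 3 / 2 * v t2" "S 2 v t2 = v t2 / 2 + v t1 / 2" if "v \<in> V" for v
    using inL out[OF that] unfolding S_def t by (simp_all add: swp_def numeral_eq_Suc rho[unfolded numeral_eq_Suc])
  have U1: "U 1 = {v \<in> V. v t2 = 0}" unfolding U_def using fix_iff S nL by auto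
  have U3: "U 3 = {v \<in> V. v t2 = 0}" unfolding U_def using fix_iff S nL by auto
  have U2: "U 2 = {v \<in> V. v t1 = v t2}" unfolding U_def using fix_iff S nL by auto
  have "om ` U 1 = U 2" using om_U_eq[of 1] nL by (simp add: numeral_2_eq_2)
  moreover have "om ` U 3 = U 4" using om_U_last nL by simp
  ultimately have U4: "U 4 = U 2" using U1 U3 by simp
  have "v = 0" if "v \<in> U 1 \<inter> U 2" for v
  proof
    fix s show "v s = 0 s" using that L V_outside[of v s] unfolding U1 U2 by (cases "s \<in> L") auto
  qed
  then have int: "U 1 \<inter> U 2 \<subseteq> {0}" by blast
  have "V \<subseteq> span (U 1 \<union> U 2)"
  proof
    fix v assume v: "v \<in> V"
    define v2 where "v2 s = (if s \<in> L then v t2 else 0)" for s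
    have v2: "v2 \<in> U 2" unfolding U2 V_def v2_def using inL by simp
    have "v - v2 \<in> U 1" unfolding U1 using v v2_def inL subspace_diff[OF subspace_V v, of v2] v2 U2 by simp
    then have "v - v2 + v2 \<in> span (U 1 \<union> U 2)" using v2 by (intro span_add span_base) auto
    then show "v \<in> span (U 1 \<union> U 2)" by simp
  qed
  then have "lower_exact" "top_exact" using exact_core_square[OF nL _ U4 int] U1 U3 by auto
  then show ?thesis unfolding exact_shape_def abcd by blast
qed

lemma exact_pair:
  assumes "coloured_shape {a, b} eps K" "eps a \<noteq> eps b"
  shows "exact_shape {a, b} eps"
proof -
  interpret coloured_shape "{a, b}" eps K by fact
  have ab: "a \<noteq> b" "\<not> nw a b" "\<not> nw b a"
    using eps_comparable[of a b] eps_comparable[of b a] assms(2) unfolding nw_def by auto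
  have nL: "n = 2" using ab by simp
  have L: "L = {[a, b], [b, a]}"
  proof
    show "{[a, b], [b, a]} \<subseteq> L" unfolding L_def using ab by auto
    show "L \<subseteq> {[a, b], [b, a]}"
    proof
      fix s assume s: "s \<in> L"
      then have "length s = 2" using length_L nL by simp
      then obtain x y where "s = [x, y]" by (auto simp: length_Suc_conv numeral_eq_Suc)
      then show "s \<in> {[a, b], [b, a]}" using s unfolding L_def by (auto simp: doubleton_eq_iff)
    qed
  qed
  have e: "eps b = - eps a" "eps a \<noteq> 0"
    using eps2[of a] eps2[of b] assms(2) square_eq_iff[of "eps a" "eps b"] by auto
  have S: "S 1 v [a, b] = v [b, a]" "S 1 v [b, a] = v [a, b]" for v
    using L assms(2) by (auto simp: S_def swp_def crho_def)
  have U1: "U 1 = {v \<in> V. v [a, b] = v [b, a]}"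
  proof -
    have "S 1 v = v \<longleftrightarrow> v [a, b] = v [b, a]" if "v \<in> V" for v
    proof
      assume h: "v [a, b] = v [b, a]"
      show "S 1 v = v"
      proof
        fix s show "S 1 v s = v s" using h S L S_outside[of s 1 v] V_outside[OF that, of s] by (cases "s \<in> L") auto
      qed
    qed (use S in metis)
    then show ?thesis unfolding U_def using nL by auto
  qed
  have om: "om v [a, b] = eps a * v [b, a]" "om v [b, a] = - eps a * v [a, b]" for v
    unfolding om_def cox_def nL using S[of v] e by (simp_all add: X_def numeral_2_eq_2)
  have U2: "om ` U 1 = U 2" using om_U_last nL by simp
  have eqI: "v = w" if "v \<in> V" "w \<in> V" "v [a, b] = w [a, b]" "v [b, a] = w [b, a]" for v w
  proof
    fix s show "v s = w s" using that L V_outside[of v s] V_outside[of w s] by (cases "s \<in> L") auto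
  qed
  have "v = 0" if "v \<in> U 1 \<inter> U 2" for v
  proof (rule eqI)
    have "v \<in> om ` U 1" unfolding U2 using that by simp
    then obtain w where w: "w \<in> U 1" "v = om w" by (rule imageE)
    have "v \<in> U 1" using that by simp
    then have eq: "w [a, b] = w [b, a]" "v [a, b] = v [b, a]" using w(1) unfolding U1 by simp_all
    have v: "v [a, b] = eps a * w [b, a]" "v [b, a] = - (eps a * w [a, b])"
      unfolding w(2) om by simp_all
    have "eps a * w [a, b] = 0" using eq v by simp
    then show "v [a, b] = 0 [a, b]" "v [b, a] = 0 [b, a]" unfolding v by (simp_all add: eq)
    show "v \<in> V" using that U1 by blast
    show "0 \<in> V" by (rule subspace_0[OF subspace_V])
  qed
  then have int: "U 1 \<inter> U 2 \<subseteq> {0}" by blast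
  have "V \<subseteq> span (U 1 \<union> U 2)"
  proof
    fix v assume v: "v \<in> V"
    define f where "f r s = (if s \<in> L then r else 0)" for r :: real and s :: "cell list"
    have f: "f r \<in> U 1" for r unfolding U1 V_def f_def using L by simp
    \<comment> \<open>In this plane \<open>U 1\<close> consists of the symmetric and
      \<open>U 2\<close> of the antisymmetric functions. The scalars describe the two parts of
      \<open>v\<close>, with \<open>eps a\<close> undoing the colour in \<open>om\<close>.\<close>
    define p q where "p = (v [a, b] + v [b, a]) / 2" and "q = eps a * (v [a, b] - v [b, a]) / 2"
    have "f p + om (f q) \<in> span (U 1 \<union> U 2)"
      using f U2 by (intro span_add span_base) blast+
    moreover have "v = f p + om (f q)"
    proof (rule eqI[OF v])
      show "f p + om (f q) \<in> V" using f U_subset by (intro subspace_add[OF subspace_V] om_in_V) blast+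
      have "eps a * q = (v [a, b] - v [b, a]) / 2" unfolding q_def using eps2[of a] by simp
      then show "v [a, b] = (f p + om (f q)) [a, b]" "v [b, a] = (f p + om (f q)) [b, a]"
        using om[of "f q"] L unfolding p_def by (simp_all add: f_def field_simps)
    qed
    ultimately show "v \<in> span (U 1 \<union> U 2)" by simp
  qed
  then have "lower_exact" "top_exact" using exact_core_pair[OF nL int] by auto
  then show ?thesis unfolding exact_shape_def by blast
qed

lemma skew_cells_convex:
  assumes "is_skew_shape lam mu" "a \<in> skew_cells lam mu" "c \<in> skew_cells lam mu"
    "fst a \<le> i" "i \<le> fst c" "snd a \<le> j" "j \<le> snd c"
  shows "(i, j) \<in> skew_cells lam mu"
proof -
  have "mu i \<le> mu (fst a)" "lam (fst c) \<le> lam i"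
    using assms unfolding is_skew_shape_def is_partition_def antimono_def by auto
  then show ?thesis using assms unfolding skew_cells_def by (cases a, cases c) auto
qed

text \<open>Either there is a square, and one colour suffices, or the shape is disconnected, and the
  component of one cell is coloured against the rest. The core has to be convex; for two cells of
  different colours this holds because comparable cells share their colour.\<close>

theorem exists_exact_colouring:
  assumes skew: "is_skew_shape lam mu" and fin: "finite (skew_cells lam mu)"
    and "\<not> (is_connected_shape (skew_cells lam mu) \<and> is_ribbon (skew_cells lam mu))"
  shows "\<exists>eps K. coloured_shape (skew_cells lam mu) eps K \<and> exact_shape (skew_cells lam mu) eps"
proof -
  let ?D = "skew_cells lam mu"
  define K where "K = Suc (Max (fst ` ?D))"
  have K: "fst a < K" if "a \<in> ?D" for a
    unfolding K_def using fin that by (simp add: less_Suc_eq_le)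
  have shape: "coloured_shape ?D eps K"
    if "\<And>a. eps a * eps a = 1" "\<And>a c. a \<in> ?D \<Longrightarrow> c \<in> ?D \<Longrightarrow> adjacent_cells a c \<Longrightarrow> eps a = eps c" for eps
    using fin skew_cells_convex[OF skew] K that by unfold_locales
  have sub: "coloured_shape C eps K"
    if "coloured_shape ?D eps K" "C \<subseteq> ?D"
      "\<And>a c i j. a \<in> C \<Longrightarrow> c \<in> C \<Longrightarrow> fst a \<le> i \<Longrightarrow> i \<le> fst c \<Longrightarrow> snd a \<le> j \<Longrightarrow> j \<le> snd c \<Longrightarrow> (i, j) \<in> C"
    for C eps
  proof -
    interpret coloured_shape ?D eps K by fact
    show ?thesis
    proof
      show "finite C" using that(2) fin by (rule finite_subset)
    qed (use that(2,3) K eps2 eps_adj in blast)+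
  qed
  show ?thesis
  proof (cases "is_ribbon ?D")
    case False
    then obtain i j where C: "{(i, j), (i, Suc j), (Suc i, j), (Suc i, Suc j)} \<subseteq> ?D"
      unfolding is_ribbon_def by blast
    define C where "C = {(i, j), (i, Suc j), (Suc i, j), (Suc i, Suc j)}"
    have conv: "(i', j') \<in> C"
      if "a \<in> C" "c \<in> C" "fst a \<le> i'" "i' \<le> fst c" "snd a \<le> j'" "j' \<le> snd c" for a c i' j'
    proof -
      have "i \<le> i'" "i' \<le> Suc i" "j \<le> j'" "j' \<le> Suc j" using that unfolding C_def by auto
      then have "i' \<in> {i, Suc i}" "j' \<in> {j, Suc j}" by auto
      then show ?thesis unfolding C_def by auto
    qed
    have D: "coloured_shape ?D (\<lambda>_. 1) K" by (rule shape) auto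
    have "exact_shape C (\<lambda>_. 1)"
      using exact_square sub[OF D, of C] C conv unfolding C_def by blast
    then show ?thesis using exact_shape_extend[OF D, of C] C conv D unfolding C_def by blast
  next
    case True
    then have "\<not> is_connected_shape ?D" using assms(3) by blast
    let ?r = "{(a, b). a \<in> ?D \<and> b \<in> ?D \<and> adjacent_cells a b}"
    obtain c d where cd: "c \<in> ?D" "d \<in> ?D" "(c, d) \<notin> ?r\<^sup>*"
      using \<open>\<not> is_connected_shape ?D\<close> unfolding is_connected_shape_def by blast
    define eps where "eps x = (if (c, x) \<in> ?r\<^sup>* then 1 else - 1 :: real)" for x
    have D: "coloured_shape ?D eps K"
    proof (rule shape)
      show "eps a * eps a = 1" for a unfolding eps_def by simp
      fix a b assume "a \<in> ?D" "b \<in> ?D" "adjacent_cells a b"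
      moreover have "adjacent_cells b a" using calculation(3) unfolding adjacent_cells_def by auto
      ultimately have "(a, b) \<in> ?r" "(b, a) \<in> ?r" by auto
      then have "(c, a) \<in> ?r\<^sup>* \<longleftrightarrow> (c, b) \<in> ?r\<^sup>*" by (meson rtrancl.rtrancl_into_rtrancl)
      then show "eps a = eps b" unfolding eps_def by simp
    qed
    interpret coloured_shape ?D eps K by (rule D)
    have ne: "eps c \<noteq> eps d" unfolding eps_def using cd(3) by simp
    have conv: "(i, j) \<in> {c, d}"
      if "x \<in> {c, d}" "y \<in> {c, d}" "fst x \<le> i" "i \<le> fst y" "snd x \<le> j" "j \<le> snd y" for x y i j
    proof -
      have "fst x \<le> fst y" "snd x \<le> snd y" using that by auto
      moreover have "x \<in> ?D" "y \<in> ?D" using that(1,2) cd by auto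
      ultimately have "eps x = eps y" using eps_comparable by blast
      then have "x = y" using that(1,2) ne by auto
      then show ?thesis using that by (cases x) auto
    qed
    have "exact_shape {c, d} eps"
      using exact_pair[OF sub[OF D, of "{c, d}"] ne] cd conv by blast
    then show ?thesis using exact_shape_extend[OF D, of "{c, d}"] cd conv D by blast
  qed
qed

section \<open>Semistandard tableaux and linear extensions\<close>

text \<open>The length is always included: for a sorted rotation it is the wrap from the largest
  letter back to the smallest, the position \<open>k - 1\<close> at which \<open>P_cyc\<close>
  demands no rise.\<close>

definition rises :: "nat list \<Rightarrow> nat set" where
  "rises ws = insert (length ws) {i. 1 \<le> i \<and> i < length ws \<and> ws ! (i - 1) < ws ! i}"

lemma ex_sorted_wrt:
  assumes "finite A" "\<And>a c. a \<in> A \<Longrightarrow> c \<in> A \<Longrightarrow> a \<noteq> c \<Longrightarrow> P a c \<or> P c a"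
    and trans: "\<And>a b c. P a b \<Longrightarrow> P b c \<Longrightarrow> P a c"
  shows "\<exists>t. set t = A \<and> distinct t \<and> sorted_wrt P t"
  using assms(1,2)
proof (induction A rule: finite_induct)
  case (insert x A)
  then obtain t where t: "set t = A" "distinct t" "sorted_wrt P t" by (metis insertCI)
  define s where "s = filter (\<lambda>a. P a x) t @ x # filter (\<lambda>a. \<not> P a x) t"
  have "P x a" if "a \<in> A" "\<not> P a x" for a using insert that by (metis insertCI)
  then have "sorted_wrt P s"
    unfolding s_def sorted_wrt_append using t insert.hyps
    by (auto intro: sorted_wrt_filter trans)
  moreover have "set s = insert x A" "distinct s" unfolding s_def using t insert.hyps by auto
  ultimately show ?case by blast
qed auto

context coloured_shape
begin

definition tab_less :: "(cell \<Rightarrow> nat) \<Rightarrow> cell \<Rightarrow> cell \<Rightarrow> bool" where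
  "tab_less T a c \<longleftrightarrow> T a < T c \<or> (T a = T c \<and> ckey K a < ckey K c)"

lemma SSYT_mono:
  assumes T: "T \<in> SSYT D" and ac: "a \<in> D" "c \<in> D" "nw a c"
  shows "T a \<le> T c" "fst a < fst c \<Longrightarrow> T a < T c"
proof -
  have m: "(fst a, snd c) \<in> D" using convex[OF ac(1,2)] ac(3) unfolding nw_def by auto
  have "T a \<le> T (fst a, snd c)"
    using T m ac unfolding SSYT_def nw_def by (cases a, cases c, cases "snd a = snd c") auto
  moreover have "T (fst a, snd c) < T c" if "fst a < fst c"
    using T m ac that unfolding SSYT_def by (cases a, cases c) auto
  moreover have "(fst a, snd c) = c" if "\<not> fst a < fst c"
    using that ac unfolding nw_def by (cases a, cases c) auto
  ultimately show "T a \<le> T c" "fst a < fst c \<Longrightarrow> T a < T c" by (cases "fst a < fst c"; force)+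
qed

definition tab_of :: "nat list \<Rightarrow> cell list \<Rightarrow> cell \<Rightarrow> nat" where
  "tab_of ws t = (\<lambda>c\<in>D. ws ! (SOME k. k < length t \<and> t ! k = c))"

lemma L_nth:
  assumes "t \<in> L" "c \<in> D"
  shows "\<exists>k<n. t ! k = c"
  using assms length_L[OF assms(1)] in_set_conv_nth[of c t] unfolding L_def by simp

lemma tab_of_nth:
  assumes t: "t \<in> L" and k: "k < n"
  shows "tab_of ws t (t ! k) = ws ! k"
proof -
  have d: "distinct t" "set t = D" and len: "length t = n" using t length_L unfolding L_def by auto
  have "(SOME l. l < length t \<and> t ! l = t ! k) = k"
    using d(1) k len by (intro some_equality) (auto simp: nth_eq_iff_index_eq)
  moreover have "t ! k \<in> D" using d(2) k len by auto
  ultimately show ?thesis unfolding tab_of_def by simp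
qed

lemma tab_of_sorted:
  assumes t: "t \<in> L" and ws: "length ws = n" "sorted ws" and des: "Des t \<subseteq> rises ws"
  shows "sorted_wrt (tab_less (tab_of ws t)) t"
  unfolding sorted_wrt_iff_nth_less
proof (intro allI impI)
  fix k l assume kl: "k < l" "l < length t"
  have len: "length t = n" by (rule length_L[OF t])
  have "ckey K (t ! k) < ckey K (t ! l)" if eq: "ws ! k = ws ! l"
  proof -
    have "ckey K (t ! k) \<le> ckey K (t ! l)"
    proof (rule key_le_if_no_descent)
      fix j assume j: "k < j" "j \<le> l"
      have "ws ! k \<le> ws ! (j - 1)" "ws ! j \<le> ws ! l"
        using j kl ws len by (auto intro!: sorted_nth_mono)
      then have "j \<notin> rises ws" using eq j kl ws len unfolding rises_def by auto
      then show "j \<notin> Des t" using des by blast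
    qed (use kl in auto)
    moreover have "ckey K (t ! k) \<noteq> ckey K (t ! l)"
    proof
      assume "ckey K (t ! k) = ckey K (t ! l)"
      then have "t ! k = t ! l" using inj_onD[OF inj_key] t kl unfolding L_def by fastforce
      then show False using t kl unfolding L_def by (auto simp: nth_eq_iff_index_eq)
    qed
    ultimately show ?thesis by simp
  qed
  moreover have "ws ! k \<le> ws ! l" using kl ws len by (auto intro!: sorted_nth_mono)
  ultimately show "tab_less (tab_of ws t) (t ! k) (t ! l)"
    unfolding tab_less_def using tab_of_nth[OF t] kl len by (auto simp: le_less)
qed

lemma map_tab_of:
  assumes "t \<in> L" "length ws = n"
  shows "map (tab_of ws t) t = ws"
  by (rule nth_equalityI) (use assms length_L tab_of_nth in auto)

lemma mset_L: "t \<in> L \<Longrightarrow> mset t = mset_set D"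
  unfolding L_def by (auto simp: mset_set_set)

lemma tab_of_SSYT:
  assumes t: "t \<in> L" and ws: "length ws = n" "sorted ws" "\<forall>a\<in>set ws. 1 \<le> a" and des: "Des t \<subseteq> rises ws"
  shows "tab_of ws t \<in> SSYT D"
proof -
  let ?T = "tab_of ws t"
  have len: "length t = n" by (rule length_L[OF t])
  have lt: "tab_less ?T a c" if ac: "a \<in> D" "c \<in> D" "nw a c" for a c
  proof -
    obtain k where k: "k < n" "t ! k = a" using L_nth[OF t ac(1)] by blast
    obtain l where l: "l < n" "t ! l = c" using L_nth[OF t ac(2)] by blast
    have srt: "sorted_wrt (\<lambda>a b. \<not> nw b a) t" using t unfolding L_def by blast
    have "\<not> l < k"
      using srt[unfolded sorted_wrt_iff_nth_less, rule_format, of l k] k l ac(3) len by auto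
    moreover have "k \<noteq> l" using k(2) l(2) ac(3) unfolding nw_def by metis
    ultimately have "k < l" by simp
    then show ?thesis
      using tab_of_sorted[OF t ws(1,2) des, unfolded sorted_wrt_iff_nth_less, rule_format, of k l] k l len by simp
  qed
  have "?T c \<ge> 1" if c: "c \<in> D" for c
  proof -
    obtain k where k: "k < n" "t ! k = c" using L_nth[OF t c] by blast
    then show ?thesis using tab_of_nth[OF t k(1)] ws by auto
  qed
  moreover have "?T \<in> extensional D" unfolding tab_of_def by simp
  ultimately have "?T \<in> D \<rightarrow>\<^sub>E {1..}" by (auto simp: PiE_def)
  moreover have "?T (i, j) \<le> ?T (i, j')" if "(i, j) \<in> D" "(i, j') \<in> D" "j < j'" for i j j'
    using lt[of "(i, j)" "(i, j')"] that unfolding nw_def tab_less_def by auto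
  moreover have "?T (i, j) < ?T (i', j)" if "(i, j) \<in> D" "(i', j) \<in> D" "i < i'" for i i' j
    using lt[of "(i, j)" "(i', j)"] that unfolding nw_def tab_less_def by (auto simp: ckey_def)
  ultimately show ?thesis unfolding SSYT_def by blast
qed

lemma SSYT_linear_extension:
  assumes T: "T \<in> SSYT D" and ws: "length ws = n" "sorted ws" "image_mset T (mset_set D) = mset ws"
  obtains t where "t \<in> L" "Des t \<subseteq> rises ws" "tab_of ws t = T"
proof -
  have "\<exists>t. set t = D \<and> distinct t \<and> sorted_wrt (tab_less T) t"
  proof (rule ex_sorted_wrt)
    fix a c assume ac: "a \<in> D" "c \<in> D" "a \<noteq> c"
    then have "ckey K a \<noteq> ckey K c" using inj_onD[OF inj_key] by blast
    then show "tab_less T a c \<or> tab_less T c a" unfolding tab_less_def by auto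
  qed (use finite in \<open>auto simp: tab_less_def\<close>)
  then obtain t where t: "set t = D" "distinct t" "sorted_wrt (tab_less T) t" by blast
  have "sorted_wrt (\<lambda>a b. \<not> nw b a) t"
  proof (rule sorted_wrt_mono_rel[OF _ t(3)])
    fix a c assume ac: "a \<in> set t" "c \<in> set t" "tab_less T a c"
    show "\<not> nw c a"
    proof
      assume nw: "nw c a"
      have in_D: "a \<in> D" "c \<in> D" using ac t by auto
      note m = SSYT_mono[OF T in_D(2,1) nw]
      have "\<not> fst c < fst a" "ckey K a < ckey K c"
        using m ac(3) unfolding tab_less_def by auto
      moreover have "fst c \<le> fst a" "snd c \<le> snd a" "c \<noteq> a" using nw unfolding nw_def by auto
      ultimately show False using ckey_less_iff[of a K c] K in_D by auto
    qed
  qed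
  then have tL: "t \<in> L" unfolding L_def using t by auto
  have len: "length t = n" by (rule length_L[OF tL])
  have "sorted (map T t)"
    unfolding sorted_wrt_map by (rule sorted_wrt_mono_rel[OF _ t(3)]) (auto simp: tab_less_def)
  moreover have "mset (map T t) = mset ws" using mset_L[OF tL] ws(3) by simp
  ultimately have map: "map T t = ws"
    using properties_for_sort[of "map T t" ws] sorted_sort_id[OF ws(2)] by simp
  have "Des t \<subseteq> rises ws"
  proof
    fix i assume "i \<in> Des t"
    then have i: "1 \<le> i" "i < n" "ckey K (t ! i) < ckey K (t ! (i - 1))" unfolding Des_def len by auto
    then have "tab_less T (t ! (i - 1)) (t ! i)"
      using t(3) len unfolding sorted_wrt_iff_nth_less by simp
    then have "T (t ! (i - 1)) < T (t ! i)" using i(3) unfolding tab_less_def by simp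
    then show "i \<in> rises ws" using i len unfolding rises_def map[symmetric] by simp
  qed
  moreover have "tab_of ws t = T"
  proof (rule extensionalityI)
    show "tab_of ws t \<in> extensional D" unfolding tab_of_def by simp
    show "T \<in> extensional D" using T unfolding SSYT_def by (auto simp: PiE_def)
    fix c assume "c \<in> D"
    then obtain k where k: "k < n" "t ! k = c" using L_nth[OF tL] by blast
    then show "tab_of ws t c = T c" using tab_of_nth[OF tL k(1), of ws] len unfolding map[symmetric] by simp
  qed
  ultimately show ?thesis using that tL by blast
qed

text \<open>Standardization reads the cells by entry and then by label. It matches the tableaux with
  the linear extensions whose descents lie in \<open>rises ws\<close>, and \<open>dim_Inv\<close>
  counts these because \<open>rises ws\<close> contains \<open>n\<close>.\<close>

lemma card_SSYT:
  assumes ws: "length ws = n" "sorted ws" "\<forall>a\<in>set ws. 1 \<le> a"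
  shows "card {T \<in> SSYT D. image_mset T (mset_set D) = mset ws} = dim (Inv (rises ws))"
proof -
  let ?A = "{t \<in> L. Des t \<subseteq> rises ws}"
  have "{T \<in> SSYT D. image_mset T (mset_set D) = mset ws} = tab_of ws ` ?A"
  proof
    show "{T \<in> SSYT D. image_mset T (mset_set D) = mset ws} \<subseteq> tab_of ws ` ?A"
    proof
      fix T assume "T \<in> {T \<in> SSYT D. image_mset T (mset_set D) = mset ws}"
      then obtain t where "t \<in> L" "Des t \<subseteq> rises ws" "tab_of ws t = T"
        using SSYT_linear_extension[OF _ ws(1,2)] by blast
      then show "T \<in> tab_of ws ` ?A" by blast
    qed
    have "image_mset (tab_of ws t) (mset_set D) = mset ws" if "t \<in> L" for t
      unfolding mset_L[OF that, symmetric] using map_tab_of[OF that ws(1)] by (metis mset_map)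
    then show "tab_of ws ` ?A \<subseteq> {T \<in> SSYT D. image_mset T (mset_set D) = mset ws}"
      using tab_of_SSYT[OF _ ws] by blast
  qed
  moreover have "inj_on (tab_of ws) ?A"
  proof (rule inj_onI)
    fix s t assume st: "s \<in> ?A" "t \<in> ?A" "tab_of ws s = tab_of ws t"
    show "s = t"
    proof (rule sorted_wrt_unique)
      show "sorted_wrt (tab_less (tab_of ws s)) s" "sorted_wrt (tab_less (tab_of ws s)) t"
        using tab_of_sorted[OF _ ws(1,2), of s] tab_of_sorted[OF _ ws(1,2), of t] st(1,2) unfolding st(3) by simp_all
    qed (use st in \<open>auto simp: L_def tab_less_def\<close>)
  qed
  ultimately have "card {T \<in> SSYT D. image_mset T (mset_set D) = mset ws} = card ?A" by (simp add: card_image)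
  also have "\<dots> = dim (Inv (rises ws))" using ws(1) by (intro dim_Inv[symmetric]) (simp add: rises_def)
  finally show ?thesis .
qed

end

section \<open>Coefficients of the cyclic fundamental functions\<close>

lemma rises_subset: "length ws = n \<Longrightarrow> n \<ge> 1 \<Longrightarrow> rises ws \<subseteq> {1..n}"
  unfolding rises_def by auto

text \<open>Position \<open>i\<close> of \<open>ws\<close> is position \<open>i + k - 1\<close> of
  \<open>w\<close> modulo \<open>n\<close>. The exempt position \<open>k - 1\<close> thus
  corresponds to \<open>n\<close>, which \<open>rises ws\<close> contains by definition.\<close>

lemma P_cyc_iff:
  assumes n: "n \<ge> 1" and J: "J \<subseteq> {1..n}" and k: "k \<in> {1..n}"
    and w: "length w = n" "\<forall>a\<in>set w. 1 \<le> a" and ws: "rotate (k - 1) w = ws" "sorted ws"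
  shows "(w, k) \<in> P_cyc n J \<longleftrightarrow> J \<subseteq> cyc_shift n (int k - 1) (rises ws)"
proof -
  let ?c = "\<lambda>i. cyc_rep n (int i + (int k - 1))"
  have lw: "length ws = n" using ws(1) w(1) by auto
  have nth: "ws ! m = w ! (cyc_rep n (int k + int m) - 1)" if "m < n" for m
    unfolding ws(1)[symmetric] using rotate_nth_cyc_rep[OF w(1) n that] k by auto
  have surj: "\<exists>i\<in>{1..n}. ?c i = j" if "j \<in> {1..n}" for j
  proof
    show "cyc_rep n (int j - (int k - 1)) \<in> {1..n}" by (rule cyc_rep_in[OF n])
    show "?c (cyc_rep n (int j - (int k - 1))) = j" using cyc_rep_add[OF n] cyc_rep_id[OF that] by simp
  qed
  have inj: "i = i'" if "i \<in> {1..n}" "i' \<in> {1..n}" "?c i = ?c i'" for i i'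
  proof -
    have "cyc_rep n (int (?c l) - (int k - 1)) = l" if "l \<in> {1..n}" for l
      unfolding cyc_rep_diff[OF n] add_diff_cancel_right' by (rule cyc_rep_id[OF that])
    then show ?thesis using that by metis
  qed
  have cn: "?c n = cyc_rep n (int k - 1)" by (rule cyc_rep_cong) simp
  have step: "w ! (?c i - 1) < w ! (cyc_rep n (int (?c i) + 1) - 1) \<longleftrightarrow> ws ! (i - 1) < ws ! i"
    if i: "i \<in> {1..n}" "i \<noteq> n" for i
  proof -
    have e: "int k + int (i - 1) = int i + (int k - 1)" using i by auto
    moreover have "cyc_rep n (int (?c i) + 1) = cyc_rep n (int k + int i)"
      using cyc_rep_add[OF n, of "int i + (int k - 1)" 1] by (simp add: algebra_simps)
    moreover have "i - 1 < n" "i < n" using i by auto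
    ultimately show ?thesis using nth[of "i - 1", unfolded e] nth[of i] by simp
  qed
  have shift: "?c i \<in> cyc_shift n (int k - 1) (rises ws) \<longleftrightarrow> i \<in> rises ws" if "i \<in> {1..n}" for i
    using inj[OF that] rises_subset[OF lw n] unfolding cyc_shift_def by blast
  have "(w, k) \<in> P_cyc n J \<longleftrightarrow>
      (\<forall>j \<in> J - {cyc_rep n (int k - 1)}. w ! (j - 1) < w ! (cyc_rep n (int j + 1) - 1))"
    unfolding P_cyc_def using w ws k by auto
  also have "\<dots> \<longleftrightarrow> (\<forall>i\<in>{1..n}. ?c i \<in> J \<longrightarrow> i = n \<or> ws ! (i - 1) < ws ! i)"
  proof (intro iffI ballI impI)
    fix i assume h: "\<forall>j \<in> J - {cyc_rep n (int k - 1)}. w ! (j - 1) < w ! (cyc_rep n (int j + 1) - 1)"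
      and i: "i \<in> {1..n}" "?c i \<in> J"
    show "i = n \<or> ws ! (i - 1) < ws ! i"
    proof (cases "i = n")
      case False
      have "n \<in> {1..n}" using n by simp
      then have "?c i \<noteq> cyc_rep n (int k - 1)" using inj[OF i(1), of n] False cn by metis
      then have "w ! (?c i - 1) < w ! (cyc_rep n (int (?c i) + 1) - 1)" using h i(2) by blast
      then show ?thesis using step[OF i(1) False] by blast
    qed simp
  next
    fix j assume h: "\<forall>i\<in>{1..n}. ?c i \<in> J \<longrightarrow> i = n \<or> ws ! (i - 1) < ws ! i"
      and j: "j \<in> J - {cyc_rep n (int k - 1)}"
    obtain i where i: "i \<in> {1..n}" "?c i = j" using surj[of j] j J by blast
    then have "i \<noteq> n" using j cn by auto
    then show "w ! (j - 1) < w ! (cyc_rep n (int j + 1) - 1)" using h i j step[OF i(1)] by blast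
  qed
  also have "\<dots> \<longleftrightarrow> (\<forall>i\<in>{1..n}. ?c i \<in> J \<longrightarrow> i \<in> rises ws)"
    unfolding rises_def lw by auto
  also have "\<dots> \<longleftrightarrow> J \<subseteq> cyc_shift n (int k - 1) (rises ws)"
  proof (intro iffI subsetI ballI impI)
    fix j assume h: "\<forall>i\<in>{1..n}. ?c i \<in> J \<longrightarrow> i \<in> rises ws" and "j \<in> J"
    moreover obtain i where i: "i \<in> {1..n}" "?c i = j" using surj[of j] \<open>j \<in> J\<close> J by blast
    ultimately have "i \<in> rises ws" by blast
    then show "j \<in> cyc_shift n (int k - 1) (rises ws)" using shift[OF i(1)] i(2) by simp
  next
    fix i assume "J \<subseteq> cyc_shift n (int k - 1) (rises ws)" "i \<in> {1..n}" "?c i \<in> J"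
    then show "i \<in> rises ws" using shift[of i] by blast
  qed
  finally show ?thesis .
qed

text \<open>The sorted rotation of \<open>w\<close> has to be \<open>ws\<close>, so \<open>w\<close>
  is determined by \<open>k\<close> and only the admissible \<open>k\<close> remain to be
  counted.\<close>

lemma F_cyc_eq:
  assumes n: "n \<ge> 1" and J: "J \<subseteq> {1..n}" and ws: "length ws = n" "sorted ws" "\<forall>a\<in>set ws. 1 \<le> a"
  shows "F_cyc n J (mset ws) = of_nat (card {k \<in> {1..n}. J \<subseteq> cyc_shift n (int k - 1) (rises ws)})"
proof -
  let ?A = "{(w, k) \<in> P_cyc n J. mset w = mset ws}"
  have rot: "rotate (k - 1) w = ws" if "(w, k) \<in> ?A" for w k
  proof -
    have "sorted (rotate (k - 1) w)" "mset (rotate (k - 1) w) = mset ws"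
      using that unfolding P_cyc_def by (auto simp: mset_rotate_word)
    then show ?thesis using properties_for_sort[of "rotate (k - 1) w" ws] sorted_sort_id[OF ws(2)] by simp
  qed
  have P: "length w = n" "\<forall>a\<in>set w. 1 \<le> a" "k \<in> {1..n}" if "(w, k) \<in> ?A" for w k
    using that unfolding P_cyc_def by auto
  have "bij_betw snd ?A {k \<in> {1..n}. J \<subseteq> cyc_shift n (int k - 1) (rises ws)}"
  proof (rule bij_betw_imageI)
    show "inj_on snd ?A"
    proof (rule inj_onI)
      fix p q assume pq: "p \<in> ?A" "q \<in> ?A" "snd p = snd q"
      obtain w k where p1: "p = (w, k)" by (cases p)
      obtain w' where p2: "q = (w', k)" using pq(3) p1 by (cases q) simp
      note p = p1 p2
      have "rotate (k - 1) w = ws" "rotate (k - 1) w' = ws" using rot pq(1,2) unfolding p by blast+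
      then have "rotate (k - 1) w = rotate (k - 1) w'" by simp
      then show "p = q" unfolding p rotate_def using injD[OF inj_fn[OF inj_rotate1]] by blast
    qed
    show "snd ` ?A = {k \<in> {1..n}. J \<subseteq> cyc_shift n (int k - 1) (rises ws)}"
    proof
      show "snd ` ?A \<subseteq> {k \<in> {1..n}. J \<subseteq> cyc_shift n (int k - 1) (rises ws)}"
      proof
        fix k assume "k \<in> snd ` ?A"
        then obtain w where w: "(w, k) \<in> ?A" by force
        then show "k \<in> {k \<in> {1..n}. J \<subseteq> cyc_shift n (int k - 1) (rises ws)}"
          using P_cyc_iff[OF n J P(3)[OF w] P(1,2)[OF w] rot[OF w] ws(2)] P(3)[OF w] by simp
      qed
      show "{k \<in> {1..n}. J \<subseteq> cyc_shift n (int k - 1) (rises ws)} \<subseteq> snd ` ?A"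
      proof
        fix k assume k: "k \<in> {k \<in> {1..n}. J \<subseteq> cyc_shift n (int k - 1) (rises ws)}"
        define w where "w = rotate (n - (k - 1)) ws"
        have "rotate (k - 1) w = rotate (k - 1 + (n - (k - 1))) ws" unfolding w_def by (simp only: rotate_rotate)
        also have "\<dots> = ws" using k ws(1) by (intro rotate_id) auto
        finally have r: "rotate (k - 1) w = ws" .
        have "mset w = mset ws" "length w = n" "set w = set ws" unfolding w_def using ws(1) by (auto simp: mset_rotate_word)
        then have "(w, k) \<in> ?A" using P_cyc_iff[OF n J, of k w ws] r ws k by auto
        then show "k \<in> snd ` ?A" by force
      qed
    qed
  qed
  from bij_betw_same_card[OF this] show ?thesis unfolding F_cyc_def by (rule arg_cong)
qed

lemma F_cyc_zero:
  assumes "\<not> (size M = n \<and> (\<forall>a\<in>#M. 1 \<le> a))"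
  shows "F_cyc n J M = 0"
proof -
  have "{(w, k) \<in> P_cyc n J. mset w = M} = {}" using assms unfolding P_cyc_def by auto
  then show ?thesis unfolding F_cyc_def by (simp only: card.empty of_nat_0)
qed

section \<open>Sums over cyclic orbits\<close>

context
  fixes n :: nat
  assumes n: "n \<ge> 1"
begin

lemma cyc_orbit_self: "J \<subseteq> {1..n} \<Longrightarrow> J \<in> cyc_orbit n J"
  unfolding cyc_orbit_def using cyc_shift_0[of J n] n by (intro image_eqI[where x = 0]) auto

lemma cyc_shift_mod: "cyc_shift n (k mod int n) J = cyc_shift n k J"
proof -
  have "cyc_rep n (int j + k mod int n) = cyc_rep n (int j + k)" for j
    by (rule cyc_rep_cong) (simp add: mod_add_right_eq)
  then show ?thesis unfolding cyc_shift_def by simp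
qed

lemma cyc_shift_in_orbit: "cyc_shift n k J \<in> cyc_orbit n J"
  unfolding cyc_orbit_def using n cyc_shift_mod[of k J] by (intro image_eqI[where x = "k mod int n"]) auto

lemma cyc_orbit_shift:
  assumes J: "J \<subseteq> {1..n}"
  shows "cyc_orbit n (cyc_shift n k J) = cyc_orbit n J"
proof -
  have sub: "cyc_orbit n (cyc_shift n k J) \<subseteq> cyc_orbit n J" for k J
    unfolding cyc_orbit_def[of n "cyc_shift n k J"] using cyc_shift_in_orbit cyc_shift_shift[OF n] by auto
  have "cyc_shift n (- k) (cyc_shift n k J) = J" using cyc_shift_shift[OF n] cyc_shift_0[OF J] by simp
  then show ?thesis using sub[of k J] sub[of "- k" "cyc_shift n k J"] by auto
qed

lemma cyc_orbit_mem:
  assumes "J \<subseteq> {1..n}" "J' \<in> cyc_orbit n J"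
  shows "cyc_orbit n J' = cyc_orbit n J" "J' \<subseteq> {1..n}" "J = {} \<longleftrightarrow> J' = {}"
proof -
  obtain k where "J' = cyc_shift n k J" using assms(2) unfolding cyc_orbit_def by blast
  then show "cyc_orbit n J' = cyc_orbit n J" "J' \<subseteq> {1..n}" "J = {} \<longleftrightarrow> J' = {}"
    using cyc_orbit_shift[OF assms(1)] cyc_shift_subset[OF n] by auto
qed

text \<open>Orbit-stabilizer: all fibres of \<open>i \<mapsto> J + i\<close> are translates of the
  stabilizer.\<close>

lemma card_orbit:
  assumes J: "J \<subseteq> {1..n}"
  shows "card (cyc_orbit n J) * cyc_stab_order n J = n"
proof -
  let ?Z = "{0..<int n}" and ?f = "\<lambda>i. cyc_shift n i J"
  have fib: "card {i \<in> ?Z. ?f i = J'} = cyc_stab_order n J" if J': "J' \<in> ?f ` ?Z" for J'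
  proof -
    obtain k where k: "k \<in> ?Z" "J' = ?f k" using J' by blast
    have eq: "?f (i + k) = J' \<longleftrightarrow> ?f i = J" for i
    proof
      assume "?f (i + k) = J'"
      then have "cyc_shift n (- k) (?f (i + k)) = cyc_shift n (- k) (?f k)" using k by simp
      then show "?f i = J" using cyc_shift_shift[OF n] cyc_shift_0[OF J] by simp
    next
      assume "?f i = J"
      then have "cyc_shift n k (?f i) = ?f k" by simp
      then show "?f (i + k) = J'" using cyc_shift_shift[OF n] k by (simp add: add.commute)
    qed
    have "bij_betw (\<lambda>i. (i + k) mod int n) {i \<in> ?Z. ?f i = J} {i \<in> ?Z. ?f i = J'}"
    proof (rule bij_betw_byWitness[where f' = "\<lambda>i. (i - k) mod int n"])
      show "\<forall>i\<in>{i \<in> ?Z. ?f i = J}. ((i + k) mod int n - k) mod int n = i"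
        by (auto simp: mod_diff_left_eq)
      show "\<forall>i\<in>{i \<in> ?Z. ?f i = J'}. ((i - k) mod int n + k) mod int n = i"
        by (auto simp: mod_add_left_eq)
      show "(\<lambda>i. (i + k) mod int n) ` {i \<in> ?Z. ?f i = J} \<subseteq> {i \<in> ?Z. ?f i = J'}"
      proof (rule image_subsetI)
        fix i assume "i \<in> {i \<in> ?Z. ?f i = J}"
        then show "(i + k) mod int n \<in> {i \<in> ?Z. ?f i = J'}" using n eq[of i] by (simp add: cyc_shift_mod)
      qed
      show "(\<lambda>i. (i - k) mod int n) ` {i \<in> ?Z. ?f i = J'} \<subseteq> {i \<in> ?Z. ?f i = J}"
      proof (rule image_subsetI)
        fix i assume "i \<in> {i \<in> ?Z. ?f i = J'}"
        then show "(i - k) mod int n \<in> {i \<in> ?Z. ?f i = J}" using n eq[of "i - k"] by (simp add: cyc_shift_mod)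
      qed
    qed
    from bij_betw_same_card[OF this] show ?thesis unfolding cyc_stab_order_def by simp
  qed
  have "n = card ?Z" by simp
  also have "\<dots> = (\<Sum>J'\<in>?f ` ?Z. card {i \<in> ?Z. ?f i = J'})"
    using sum.image_gen[of ?Z "\<lambda>_. 1 :: nat" ?f] by simp
  also have "\<dots> = card (cyc_orbit n J) * cyc_stab_order n J"
    using fib unfolding cyc_orbit_def by simp
  finally show ?thesis by simp
qed

lemma Union_orbits: "\<Union> (nonempty_cyc_orbits n) = {J. J \<subseteq> {1..n} \<and> J \<noteq> {}}"
proof
  show "\<Union> (nonempty_cyc_orbits n) \<subseteq> {J. J \<subseteq> {1..n} \<and> J \<noteq> {}}"
  proof
    fix J assume "J \<in> \<Union> (nonempty_cyc_orbits n)"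
    then obtain J' where "J' \<subseteq> {1..n}" "J' \<noteq> {}" "J \<in> cyc_orbit n J'"
      unfolding nonempty_cyc_orbits_def by blast
    then show "J \<in> {J. J \<subseteq> {1..n} \<and> J \<noteq> {}}" using cyc_orbit_mem(2,3)[of J' J] by simp
  qed
  show "{J. J \<subseteq> {1..n} \<and> J \<noteq> {}} \<subseteq> \<Union> (nonempty_cyc_orbits n)"
    unfolding nonempty_cyc_orbits_def using cyc_orbit_self by blast
qed

text \<open>By \<open>card_orbit\<close>, dividing by the stabilizer order means multiplying by the
  size of the orbit and dividing by \<open>n\<close>, so a sum over orbits becomes a sum over
  subsets.\<close>

lemma sum_F_hat:
  fixes c :: "nat set set \<Rightarrow> int"
  shows "(\<Sum>A\<in>nonempty_cyc_orbits n. of_int (c A) * F_hat n A M) =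
     (\<Sum>J | J \<subseteq> {1..n} \<and> J \<noteq> {}. of_int (c (cyc_orbit n J)) * F_cyc n J M) / of_nat n"
proof -
  let ?g = "\<lambda>J. of_int (c (cyc_orbit n J)) * F_cyc n J M"
  have orb: "\<exists>J. J \<subseteq> {1..n} \<and> J \<noteq> {} \<and> A = cyc_orbit n J" if "A \<in> nonempty_cyc_orbits n" for A
    using that unfolding nonempty_cyc_orbits_def by blast
  have one: "(\<Sum>J\<in>A. ?g J) = of_nat n * (of_int (c A) * F_hat n A M)" if "A \<in> nonempty_cyc_orbits n" for A
  proof -
    obtain J where J: "J \<subseteq> {1..n}" and A: "A = cyc_orbit n J" using orb[OF \<open>A \<in> _\<close>] by blast
    have "F_cyc n J' M = F_cyc n J M" if "J' \<in> A" for J'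
      using that F_cyc_shift[OF n J] unfolding A cyc_orbit_def by auto
    then have "(\<Sum>J\<in>A. ?g J) = (\<Sum>J'\<in>A. ?g J)"
      using cyc_orbit_mem(1)[OF J] A by (intro sum.cong) auto
    also have "\<dots> = of_nat (card A) * ?g J" by simp
    also have "\<dots> = of_nat n * (of_int (c A) * F_hat n A M)"
    proof -
      have "of_nat (card A) * of_nat (cyc_stab_order n J) = (of_nat n :: rat)"
        unfolding A of_nat_mult[symmetric] card_orbit[OF J] ..
      moreover have "of_nat (cyc_stab_order n J) \<noteq> (0::rat)"
      proof
        assume "of_nat (cyc_stab_order n J) = (0::rat)"
        then have "cyc_stab_order n J = 0" by simp
        then show False using card_orbit[OF J] n by simp
      qed
      ultimately have "of_nat (card A) = (of_nat n :: rat) / of_nat (cyc_stab_order n J)"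
        by (simp add: field_simps)
      then show ?thesis unfolding A F_hat_cyc_orbit[OF n J] F_hat_set_def by simp
    qed
    finally show ?thesis .
  qed
  have "(\<Sum>J | J \<subseteq> {1..n} \<and> J \<noteq> {}. ?g J) = (\<Sum>A\<in>nonempty_cyc_orbits n. \<Sum>J\<in>A. ?g J)"
    unfolding Union_orbits[symmetric]
  proof (subst sum.Union_disjoint)
    show "\<forall>A\<in>nonempty_cyc_orbits n. finite A"
      unfolding nonempty_cyc_orbits_def cyc_orbit_def by auto
    show "\<forall>A\<in>nonempty_cyc_orbits n. \<forall>B\<in>nonempty_cyc_orbits n. A \<noteq> B \<longrightarrow> A \<inter> B = {}"
    proof (intro ballI impI)
      fix A B assume AB: "A \<in> nonempty_cyc_orbits n" "B \<in> nonempty_cyc_orbits n" "A \<noteq> B"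
      obtain J J' where "J \<subseteq> {1..n}" "A = cyc_orbit n J" "J' \<subseteq> {1..n}" "B = cyc_orbit n J'"
        using orb[OF AB(1)] orb[OF AB(2)] by blast
      then show "A \<inter> B = {}" using cyc_orbit_mem(1) AB(3) by blast
    qed
  qed simp
  also have "\<dots> = of_nat n * (\<Sum>A\<in>nonempty_cyc_orbits n. of_int (c A) * F_hat n A M)"
    unfolding sum_distrib_left using one by (rule sum.cong[OF refl])
  finally show ?thesis using n by simp
qed

text \<open>By \<open>F_cyc_eq\<close> each coefficient counts the rotations of
  \<open>rises ws\<close> that contain \<open>J\<close>. All \<open>n\<close> rotations contribute
  the same sum, since orbits are invariant under shifts, and this cancels the division by
  \<open>n\<close>.\<close>

lemma sum_F_hat_word:
  fixes c :: "nat set set \<Rightarrow> int"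
  assumes ws: "length ws = n" "sorted ws" "\<forall>a\<in>set ws. 1 \<le> a"
  shows "(\<Sum>A\<in>nonempty_cyc_orbits n. of_int (c A) * F_hat n A (mset ws)) =
     of_int (\<Sum>J | J \<subseteq> rises ws \<and> J \<noteq> {}. c (cyc_orbit n J))"
proof -
  let ?I = "rises ws" and ?A = "{J. J \<subseteq> {1..n} \<and> J \<noteq> {}}"
  let ?sh = "\<lambda>k. cyc_shift n (int k - 1) ?I"
  have I: "?I \<subseteq> {1..n}" by (rule rises_subset[OF ws(1) n])
  have "(\<Sum>J\<in>?A. of_int (c (cyc_orbit n J)) * F_cyc n J (mset ws)) =
      (\<Sum>J\<in>?A. \<Sum>k\<in>{1..n}. if J \<subseteq> ?sh k then of_int (c (cyc_orbit n J)) else 0 :: rat)"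
  proof (rule sum.cong[OF refl])
    fix J assume "J \<in> ?A"
    then show "of_int (c (cyc_orbit n J)) * F_cyc n J (mset ws) =
        (\<Sum>k\<in>{1..n}. if J \<subseteq> ?sh k then of_int (c (cyc_orbit n J)) else 0)"
      using F_cyc_eq[OF n _ ws, of J] by (simp add: sum.If_cases Int_def)
  qed
  also have "\<dots> = (\<Sum>k\<in>{1..n}. \<Sum>J\<in>?A. if J \<subseteq> ?sh k then of_int (c (cyc_orbit n J)) else 0 :: rat)"
    by (rule sum.swap)
  also have "\<dots> = (\<Sum>k\<in>{1..n}. of_int (\<Sum>J | J \<subseteq> ?I \<and> J \<noteq> {}. c (cyc_orbit n J)))"
  proof (rule sum.cong[OF refl])
    fix k
    have "(\<Sum>J\<in>?A. if J \<subseteq> ?sh k then of_int (c (cyc_orbit n J)) else 0 :: rat) =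
        (\<Sum>J | J \<subseteq> ?sh k \<and> J \<noteq> {}. of_int (c (cyc_orbit n J)))"
    proof -
      have "?A \<inter> {J. J \<subseteq> ?sh k} = {J. J \<subseteq> ?sh k \<and> J \<noteq> {}}"
        using cyc_shift_subset[OF n, of "int k - 1" ?I] by blast
      then show ?thesis by (subst sum.If_cases) auto
    qed
    also have "\<dots> = (\<Sum>J | J \<subseteq> ?I \<and> J \<noteq> {}. of_int (c (cyc_orbit n J)))"
      unfolding sum_shift[OF n I]
    proof (rule sum.cong[OF refl])
      fix J assume "J \<in> {J. J \<subseteq> ?I \<and> J \<noteq> {}}"
      then have "J \<subseteq> {1..n}" using I by blast
      then show "of_int (c (cyc_orbit n (cyc_shift n (int k - 1) J))) = (of_int (c (cyc_orbit n J)) :: rat)"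
        using cyc_orbit_shift by simp
    qed
    finally show "(\<Sum>J\<in>?A. if J \<subseteq> ?sh k then of_int (c (cyc_orbit n J)) else 0 :: rat) =
        of_int (\<Sum>J | J \<subseteq> ?I \<and> J \<noteq> {}. c (cyc_orbit n J))" by simp
  qed
  finally show ?thesis unfolding sum_F_hat using n by simp
qed

lemma F_hat_zero:
  assumes "\<not> (size M = n \<and> (\<forall>a\<in>#M. 1 \<le> a))"
  shows "F_hat n A M = 0"
  unfolding F_hat_def F_hat_set_def F_cyc_zero[OF assms] by simp

lemma ex_word_rises:
  assumes I: "I \<subseteq> {1..n}" "n \<in> I"
  obtains ws where "length ws = n" "sorted ws" "\<forall>a\<in>set ws. 1 \<le> a" "rises ws = I"
proof -
  define ws where "ws = map (\<lambda>m. Suc (card {i \<in> I. i \<le> m})) [0..<n]"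
  have fI: "finite I" using I(1) by (rule finite_subset) simp
  have len: "length ws = n" unfolding ws_def by simp
  have "sorted ws" unfolding ws_def sorted_iff_nth_mono using fI by (auto intro!: card_mono)
  moreover have "rises ws = I"
  proof -
    have "ws ! (i - 1) < ws ! i \<longleftrightarrow> i \<in> I" if i: "1 \<le> i" "i < n" for i
    proof -
      have "j \<le> i \<longleftrightarrow> j = i \<or> j \<le> i - 1" for j using i by auto
      then have "{j \<in> I. j \<le> i} = (if i \<in> I then insert i {j \<in> I. j \<le> i - 1} else {j \<in> I. j \<le> i - 1})"
        by auto
      moreover have "i \<notin> {j \<in> I. j \<le> i - 1}" using i by auto
      ultimately have "card {j \<in> I. j \<le> i} = (if i \<in> I then Suc (card {j \<in> I. j \<le> i - 1}) else card {j \<in> I. j \<le> i - 1})"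
        using fI by simp
      then show ?thesis using i unfolding ws_def by simp
    qed
    then show ?thesis unfolding rises_def len using I by (auto simp: le_less)
  qed
  moreover have "\<forall>a\<in>set ws. 1 \<le> a" unfolding ws_def by auto
  ultimately show ?thesis using that len by blast
qed

lemma F_hat_expansion_word:
  assumes "F_hat_expansion n f c" and ws: "length ws = n" "sorted ws" "\<forall>a\<in>set ws. 1 \<le> a"
  shows "f (mset ws) = of_int (\<Sum>J | J \<subseteq> rises ws \<and> J \<noteq> {}. c (cyc_orbit n J))"
proof -
  have "f = (\<lambda>M. \<Sum>A\<in>nonempty_cyc_orbits n. of_int (c A) * F_hat n A M)"
    using assms(1) unfolding F_hat_expansion_def by (rule conjunct2)
  then show ?thesis using sum_F_hat_word[OF ws] by (metis (mono_tags))
qed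

text \<open>The values at words determine the sums over nonempty subsets of \<open>I\<close>, first
  for \<open>n \<in> I\<close> and by rotation for every nonempty \<open>I\<close>. Induction on
  \<open>card I\<close> then isolates each coefficient.\<close>

lemma F_hat_expansion_unique:
  assumes "F_hat_expansion n f c" "F_hat_expansion n f c'"
  shows "c = c'"
proof -
  define d where "d A = c A - c' A" for A
  have sum0: "(\<Sum>J | J \<subseteq> I \<and> J \<noteq> {}. d (cyc_orbit n J)) = 0" if I: "I \<subseteq> {1..n}" "n \<in> I" for I
  proof -
    obtain ws where ws: "length ws = n" "sorted ws" "\<forall>a\<in>set ws. 1 \<le> a" and r: "rises ws = I"
      using ex_word_rises[OF I] .
    have "f (mset ws) = of_int (\<Sum>J | J \<subseteq> I \<and> J \<noteq> {}. c (cyc_orbit n J))"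
      "f (mset ws) = of_int (\<Sum>J | J \<subseteq> I \<and> J \<noteq> {}. c' (cyc_orbit n J))"
      using F_hat_expansion_word[OF _ ws] assms unfolding r by blast+
    then have "(\<Sum>J | J \<subseteq> I \<and> J \<noteq> {}. c (cyc_orbit n J)) = (\<Sum>J | J \<subseteq> I \<and> J \<noteq> {}. c' (cyc_orbit n J))"
      by (metis of_int_eq_iff)
    then show ?thesis unfolding d_def by (simp add: sum_subtractf)
  qed
  have sum0': "(\<Sum>J | J \<subseteq> I \<and> J \<noteq> {}. d (cyc_orbit n J)) = 0" if I: "I \<subseteq> {1..n}" "I \<noteq> {}" for I
  proof -
    obtain k where k: "n \<in> cyc_shift n (int k) I" using shift_to_last[OF I] .
    have "0 = (\<Sum>J | J \<subseteq> cyc_shift n (int k) I \<and> J \<noteq> {}. d (cyc_orbit n J))"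
      using sum0[OF cyc_shift_subset[OF n] k] by simp
    also have "\<dots> = (\<Sum>J | J \<subseteq> I \<and> J \<noteq> {}. d (cyc_orbit n J))"
      unfolding sum_shift[OF n I(1)] using I(1) by (intro sum.cong refl arg_cong[where f = d] cyc_orbit_shift) auto
    finally show ?thesis by simp
  qed
  have "d (cyc_orbit n I) = 0" if "I \<subseteq> {1..n}" "I \<noteq> {}" for I
    using that
  proof (induction "card I" arbitrary: I rule: less_induct)
    case less
    have fI: "finite I" using less.prems(1) by (rule finite_subset) simp
    have "{J. J \<subseteq> I \<and> J \<noteq> {}} = insert I {J. J \<subset> I \<and> J \<noteq> {}}" using less.prems by blast
    moreover have "finite {J. J \<subset> I \<and> J \<noteq> {}}" using fI by (rule finite_subset[rotated, OF finite_Pow_iff[THEN iffD2]]) auto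
    ultimately have "d (cyc_orbit n I) + (\<Sum>J | J \<subset> I \<and> J \<noteq> {}. d (cyc_orbit n J)) = 0"
      using sum0'[OF less.prems] by simp
    moreover have "(\<Sum>J | J \<subset> I \<and> J \<noteq> {}. d (cyc_orbit n J)) = 0"
      using less.hyps less.prems(1) psubset_card_mono[OF fI] by (intro sum.neutral) auto
    ultimately show ?case by simp
  qed
  then have "d A = 0" if "A \<in> nonempty_cyc_orbits n" for A
    using that unfolding nonempty_cyc_orbits_def by blast
  then show "c = c'"
    using assms unfolding F_hat_expansion_def d_def fun_eq_iff by (metis eq_iff_diff_eq_0)
qed

end

section \<open>Partial sums of compositions\<close>

fun psums :: "nat list \<Rightarrow> nat set" where
  "psums [] = {}"
| "psums (m # ms) = insert m ((+) m ` psums ms)"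

lemma psums_snoc: "psums (ms @ [m]) = insert (sum_list ms + m) (psums ms)"
  by (induction ms) (auto simp: add.assoc insert_commute)

lemma psums_iff: "psums ms = (\<lambda>l. sum_list (take (Suc l) ms)) ` {..<length ms}"
proof (induction ms)
  case (Cons m ms)
  have "{..<length (m # ms)} = insert 0 (Suc ` {..<length ms})" by (simp add: lessThan_Suc_eq_insert_0)
  then show ?case using Cons by (simp add: image_image)
qed simp

lemma psums_range: "\<forall>m\<in>set ms. 0 < m \<Longrightarrow> psums ms \<subseteq> {1..sum_list ms}"
  by (induction ms) force+

text \<open>Moving the first part \<open>m\<close> to the end lowers all partial sums by
  \<open>m\<close>; the first of them becomes 0 and is represented by the total.\<close>

lemma psums_rotate1:
  assumes "\<forall>m\<in>set ms. 0 < m"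
  shows "\<exists>k. psums ms = cyc_shift (sum_list ms) (int k) (psums (rotate1 ms))"
proof (cases ms)
  case (Cons m xs)
  let ?N = "m + sum_list xs"
  have m: "m \<in> {1..?N}" using assms Cons by auto
  have "(int (sum_list xs + m) + int m) mod int ?N = int m mod int ?N"
    by (simp only: add.commute[of m "sum_list xs"] mod_add_self1)
  then have "cyc_rep ?N (int (sum_list xs + m) + int m) = m"
    using cyc_rep_id[OF m] cyc_rep_cong by metis
  moreover have "cyc_rep ?N (int s + int m) = m + s" if "s \<in> psums xs" for s
  proof -
    have "m + s \<in> {1..?N}" using psums_range[of xs] that assms Cons by auto
    then show ?thesis using cyc_rep_id[of "m + s" ?N] by (simp add: add.commute)
  qed
  ultimately have "cyc_shift ?N (int m) (psums (xs @ [m])) = psums (m # xs)"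
    unfolding psums_snoc cyc_shift_def by (auto simp: image_iff)
  then show ?thesis unfolding Cons by (intro exI[of _ m]) simp
qed (simp add: cyc_shift_def)

lemma psums_rotate:
  assumes "\<forall>m\<in>set ms. 0 < m" "ms \<noteq> []"
  shows "\<exists>k. psums ms = cyc_shift (sum_list ms) (int k) (psums (rotate r ms))"
proof (induction r)
  case 0
  then show ?case using psums_range[OF assms(1)] cyc_shift_0 by (intro exI[of _ 0]) simp
next
  case (Suc r)
  have N: "sum_list ms \<ge> 1" using assms by (cases ms) auto
  have sum: "sum_list (rotate r ms) = sum_list ms" by (metis mset_rotate_word sum_mset_sum_list)
  obtain k where k: "psums ms = cyc_shift (sum_list ms) (int k) (psums (rotate r ms))" using Suc by blast
  obtain l where "psums (rotate r ms) = cyc_shift (sum_list ms) (int l) (psums (rotate (Suc r) ms))"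
    using psums_rotate1[of "rotate r ms"] assms(1) unfolding sum by auto
  then have "psums ms = cyc_shift (sum_list ms) (int (k + l)) (psums (rotate (Suc r) ms))"
    using k cyc_shift_shift[OF N] by simp
  then show ?case by blast
qed

text \<open>A sorted word rises, or ends, exactly after the last occurrence of each letter
  \<open>v\<close>, and the position reached there is the number of letters up to
  \<open>v\<close>.\<close>

lemma rises_sorted_list:
  assumes "M \<noteq> {#}"
  shows "rises (sorted_list_of_multiset M) = (\<lambda>v. size (filter_mset (\<lambda>x. x \<le> v) M)) ` set_mset M"
proof -
  define ws where "ws = sorted_list_of_multiset M"
  have ws: "sorted ws" "mset ws = M" unfolding ws_def by auto
  have "ws \<noteq> []" using assms ws(2) by auto
  have pre: "size (filter_mset (\<lambda>x. x \<le> v) M) = i"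
    if "1 \<le> i" "i \<le> length ws" "ws ! (i - 1) = v" "i < length ws \<Longrightarrow> v < ws ! i" for v i
  proof -
    have "filter (\<lambda>x. x \<le> v) (take i ws) = take i ws"
    proof (rule filter_True, rule ballI)
      fix x assume "x \<in> set (take i ws)"
      then obtain p where "p < i" "p < length ws" "x = ws ! p" by (auto simp: in_set_conv_nth)
      then show "x \<le> v" using that(1-3) ws(1) by (auto intro!: sorted_nth_mono)
    qed
    moreover have "filter (\<lambda>x. x \<le> v) (drop i ws) = []"
    proof (rule filter_False, rule ballI)
      fix x assume "x \<in> set (drop i ws)"
      then obtain p where "p < length (drop i ws)" "drop i ws ! p = x" by (metis in_set_conv_nth)
      then have p: "i + p < length ws" "x = ws ! (i + p)" by auto
      then have "ws ! i \<le> x" using ws(1) by (auto intro!: sorted_nth_mono)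
      then show "\<not> x \<le> v" using that(4) p by simp
    qed
    moreover have "filter (\<lambda>x. x \<le> v) ws = filter (\<lambda>x. x \<le> v) (take i ws) @ filter (\<lambda>x. x \<le> v) (drop i ws)"
      by (metis append_take_drop_id filter_append)
    ultimately have "filter (\<lambda>x. x \<le> v) ws = take i ws" by simp
    then have "filter_mset (\<lambda>x. x \<le> v) M = mset (take i ws)" unfolding ws(2)[symmetric] mset_filter[symmetric] by simp
    then show ?thesis using that(2) by simp
  qed
  show ?thesis
    unfolding ws_def[symmetric]
  proof
    show "rises ws \<subseteq> (\<lambda>v. size (filter_mset (\<lambda>x. x \<le> v) M)) ` set_mset M"
    proof
      fix i assume i: "i \<in> rises ws"
      then have b: "1 \<le> i" "i \<le> length ws" "i < length ws \<Longrightarrow> ws ! (i - 1) < ws ! i"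
        using \<open>ws \<noteq> []\<close> unfolding rises_def by (auto simp: Suc_le_eq)
      moreover have "ws ! (i - 1) \<in># M" unfolding ws(2)[symmetric] using b by simp
      ultimately show "i \<in> (\<lambda>v. size (filter_mset (\<lambda>x. x \<le> v) M)) ` set_mset M"
        using pre[OF b(1,2) refl b(3)] by (intro image_eqI) auto
    qed
    show "(\<lambda>v. size (filter_mset (\<lambda>x. x \<le> v) M)) ` set_mset M \<subseteq> rises ws"
    proof (rule image_subsetI)
      fix v assume "v \<in># M"
      define A where "A = {p. p < length ws \<and> ws ! p = v}"
      have A: "finite A" "A \<noteq> {}"
        using \<open>v \<in># M\<close> unfolding A_def ws(2)[symmetric] by (auto simp: in_set_conv_nth)
      define i where "i = Suc (Max A)"
      have "Max A \<in> A" using A by (rule Max_in)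
      then have b: "1 \<le> i" "i \<le> length ws" "ws ! (i - 1) = v" unfolding i_def A_def by auto
      have lt: "v < ws ! i" if "i < length ws"
      proof -
        have "i \<notin> A" using Max_ge[OF A(1), of i] unfolding i_def by auto
        then have "ws ! i \<noteq> v" using that unfolding A_def by blast
        moreover have "v \<le> ws ! i" using sorted_nth_mono[OF ws(1), of "i - 1" i] b that by simp
        ultimately show ?thesis by simp
      qed
      have "size (filter_mset (\<lambda>x. x \<le> v) M) = i" by (rule pre[OF b lt])
      moreover have "i \<in> rises ws" using b(1,2) lt unfolding rises_def b(3)[symmetric] by auto
      ultimately show "size (filter_mset (\<lambda>x. x \<le> v) M) \<in> rises ws" by simp
    qed
  qed
qed

lemma power_monomial_rises:
  assumes "length is = length ms" "ms \<noteq> []" "sorted_wrt (<) is" "\<forall>m\<in>set ms. 0 < m"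
  shows "rises (sorted_list_of_multiset (power_monomial is ms)) = psums ms"
    and "size (power_monomial is ms) = sum_list ms"
    and "set_mset (power_monomial is ms) = set is"
proof -
  let ?M = "power_monomial is ms"
  show size: "size ?M = sum_list ms"
    unfolding power_monomial_def using assms(1) by (simp add: sum_list_sum_nth atLeast0LessThan)
  have "set_mset ?M = (\<Union>l<length is. set_mset (replicate_mset (ms ! l) (is ! l)))"
    unfolding power_monomial_def by (simp add: set_mset_sum)
  also have "\<dots> = (\<Union>l<length is. {is ! l})"
    using assms(1,4) by (intro SUP_cong refl) auto
  also have "\<dots> = set is" by (auto simp: in_set_conv_nth)
  finally show set: "set_mset ?M = set is" .
  have fil: "size (filter_mset P (\<Sum>l\<in>A. g l)) = (\<Sum>l\<in>A. size (filter_mset P (g l)))"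
    for P and g :: "nat \<Rightarrow> nat multiset" and A
    by (induction A rule: infinite_finite_induct) auto
  have rep: "filter_mset P (replicate_mset k a) = (if P a then replicate_mset k a else {#})" for P k and a :: nat
    by (induction k) auto
  have cnt: "size (filter_mset (\<lambda>x. x \<le> is ! l) ?M) = sum_list (take (Suc l) ms)" if l: "l < length is" for l
  proof -
    have le: "is ! p \<le> is ! l \<longleftrightarrow> p \<le> l" if "p < length is" for p
      using assms(3) l that unfolding sorted_wrt_iff_nth_less by (metis le_less_linear less_imp_le order.order_iff_strict leD nat_neq_iff)
    have "size (filter_mset (\<lambda>x. x \<le> is ! l) ?M) = (\<Sum>p<length is. if p \<le> l then ms ! p else 0)"
      unfolding power_monomial_def fil rep using le by (intro sum.cong) auto
    also have "\<dots> = (\<Sum>p<Suc l. ms ! p)"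
    proof -
      have "{..<length is} \<inter> {p. p \<le> l} = {..<Suc l}" using l by auto
      then show ?thesis by (simp add: sum.If_cases del: sum.lessThan_Suc)
    qed
    also have "\<dots> = sum_list (take (Suc l) ms)"
    proof -
      have "min (length ms) (Suc l) = Suc l" using l assms(1) by simp
      then show ?thesis by (simp add: sum_list_sum_nth atLeast0LessThan del: sum.lessThan_Suc)
    qed
    finally show ?thesis .
  qed
  have nth: "set is = (!) is ` {..<length is}" unfolding set_conv_nth by auto
  have "?M \<noteq> {#}"
  proof
    assume "?M = {#}"
    then show False using set assms(1,2) by simp
  qed
  from rises_sorted_list[OF this]
  have "rises (sorted_list_of_multiset ?M) = (\<lambda>v. size (filter_mset (\<lambda>x. x \<le> v) ?M)) ` (!) is ` {..<length is}"
    unfolding set nth .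
  also have "\<dots> = psums ms"
    unfolding psums_iff image_image assms(1)[symmetric] using cnt by (intro image_cong) auto
  finally show "rises (sorted_list_of_multiset ?M) = psums ms" .
qed

section \<open>Skew Schur functions\<close>

theorem theorem4p1:
  fixes lam mu :: "nat \<Rightarrow> nat" and n :: nat
  assumes "is_skew_shape lam mu"
    and "card (skew_cells lam mu) = n"
    and "n \<ge> 1"
    and "\<not> (is_connected_shape (skew_cells lam mu) \<and> is_ribbon (skew_cells lam mu))"
  shows "skew_schur lam mu \<in> cQSym n \<and>
         (\<exists>!c. F_hat_expansion n (skew_schur lam mu) c) \<and>
         (\<forall>c. F_hat_expansion n (skew_schur lam mu) c \<longrightarrow>
              (\<forall>A \<in> nonempty_cyc_orbits n. 0 \<le> c A))"
proof -
  let ?D = "skew_cells lam mu" and ?f = "skew_schur lam mu"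
  have "finite ?D" using assms(2,3) by (intro card_ge_0_finite) simp
  then obtain eps K where shape: "coloured_shape ?D eps K" and ex: "exact_shape ?D eps"
    using exists_exact_colouring[OF assms(1) _ assms(4)] by blast
  interpret coloured_shape ?D eps K by (rule shape)
  have lower: lower_exact using ex unfolding exact_shape_def by blast
  note nD = assms(2) and n = assms(3)
  have val: "?f (mset ws) = of_nat (dim (Inv (rises ws)))"
    if "length ws = n" "sorted ws" "\<forall>a\<in>set ws. 1 \<le> a" for ws
    unfolding skew_schur_def using card_SSYT[of ws] that nD by simp
  have supp: "size M = n \<and> (\<forall>a\<in>#M. 1 \<le> a)" if M: "?f M \<noteq> 0" for M
  proof -
    have "{T \<in> SSYT ?D. image_mset T (mset_set ?D) = M} \<noteq> {}"
    proof
      assume "{T \<in> SSYT ?D. image_mset T (mset_set ?D) = M} = {}"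
      then show False using M unfolding skew_schur_def by (simp only: card.empty of_nat_0)
    qed
    then obtain T where T: "T \<in> SSYT ?D" "image_mset T (mset_set ?D) = M" by blast
    have "T \<in> ?D \<rightarrow> {1..}" using T(1) unfolding SSYT_def by auto
    then show ?thesis unfolding T(2)[symmetric] using nD finite by auto
  qed
  have word: "length (sorted_list_of_multiset M) = n" "sorted (sorted_list_of_multiset M)"
    "\<forall>a\<in>set (sorted_list_of_multiset M). 1 \<le> a"
    if "size M = n" "\<forall>a\<in>#M. 1 \<le> a" for M :: monomial
    using that by (auto simp flip: size_mset)
  \<comment> \<open>Any member of the orbit gives the same value by \<open>new_dim_shift\<close>.
    Off the index set the value is 0, as \<open>F_hat_expansion\<close> prescribes.\<close>
  define c where "c A = (if A \<in> nonempty_cyc_orbits n then int (new_dim (SOME J. J \<in> A)) else 0)" for A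
  have c: "c (cyc_orbit n J) = int (new_dim J)" if J: "J \<subseteq> {1..n}" "J \<noteq> {}" for J
  proof -
    have "J \<in> cyc_orbit n J" by (rule cyc_orbit_self[OF n J(1)])
    then have "(SOME J'. J' \<in> cyc_orbit n J) \<in> cyc_orbit n J" by (rule someI)
    then obtain i where i: "i \<in> {0..<int n}" "(SOME J'. J' \<in> cyc_orbit n J) = cyc_shift n i J"
      unfolding cyc_orbit_def by blast
    have "new_dim (cyc_shift n (int (nat i)) J) = new_dim J" using new_dim_shift[of J "nat i"] J nD by simp
    moreover have "cyc_orbit n J \<in> nonempty_cyc_orbits n" unfolding nonempty_cyc_orbits_def using J by blast
    ultimately show ?thesis unfolding c_def using i by simp
  qed
  have expansion: "F_hat_expansion n ?f c"
    unfolding F_hat_expansion_def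
  proof (intro conjI allI impI ext)
    show "c A = 0" if "A \<notin> nonempty_cyc_orbits n" for A using that unfolding c_def by simp
    fix M
    show "?f M = (\<Sum>A\<in>nonempty_cyc_orbits n. of_int (c A) * F_hat n A M)"
    proof (cases "size M = n \<and> (\<forall>a\<in>#M. 1 \<le> a)")
      case False
      then show ?thesis using supp[of M] F_hat_zero[OF n False] by auto
    next
      case True
      define ws where "ws = sorted_list_of_multiset M"
      have ws: "length ws = n" "sorted ws" "\<forall>a\<in>set ws. 1 \<le> a"
        unfolding ws_def using word[of M] True by blast+
      have M: "M = mset ws" unfolding ws_def by simp
      have I: "rises ws \<subseteq> {1..n}" by (rule rises_subset[OF ws(1) n])
      have "(\<Sum>J | J \<subseteq> rises ws \<and> J \<noteq> {}. c (cyc_orbit n J)) = (\<Sum>J | J \<subseteq> rises ws \<and> J \<noteq> {}. int (new_dim J))"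
        using c I by (intro sum.cong) auto
      also have "\<dots> = int (dim (Inv (rises ws)))"
        using sum_new_dim[OF lower, of "rises ws"] I nD unfolding of_nat_sum[symmetric] by (auto simp: rises_def)
      finally show ?thesis unfolding M sum_F_hat_word[OF n ws] val[OF ws] by simp
    qed
  qed
  \<comment> \<open>The defining symmetry of \<open>cQSym\<close>: rotating the exponents rotates
    the set of their partial sums, under which \<open>dim (Inv I)\<close> is invariant, and the
    variables enter only through their order.\<close>
  have shift: "?f (power_monomial is ms) = ?f (power_monomial is' (rotate r ms))"
    if h: "1 \<le> length ms" "length is = length ms" "length is' = length ms"
      "var_indices is" "var_indices is'" "\<forall>m\<in>set ms. 0 < m" for "is" is' ms r
  proof -
    let ?M = "power_monomial is ms" and ?M' = "power_monomial is' (rotate r ms)"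
    have ms: "ms \<noteq> []" using h(1) by auto
    have inc: "sorted_wrt (<) is" "sorted_wrt (<) is'" "\<forall>a\<in>set is. 1 \<le> a" "\<forall>a\<in>set is'. 1 \<le> a"
      using h(4,5) unfolding var_indices_def by auto
    note P = power_monomial_rises[OF h(2) ms inc(1) h(6)]
    have P': "rises (sorted_list_of_multiset ?M') = psums (rotate r ms)"
      "size ?M' = sum_list (rotate r ms)" "set_mset ?M' = set is'"
      using power_monomial_rises[of is' "rotate r ms"] h(3,6) ms inc(2) by auto
    have s: "sum_list (rotate r ms) = sum_list ms" by (metis mset_rotate_word sum_mset_sum_list)
    show ?thesis
    proof (cases "sum_list ms = n")
      case False
      then show ?thesis using supp[of ?M] supp[of ?M'] P(2) P'(2) s by metis
    next
      case True
      have M: "?f ?M = of_nat (dim (Inv (psums ms)))"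
        using val[of "sorted_list_of_multiset ?M"] word[of ?M] P inc(3) True by simp
      have M': "?f ?M' = of_nat (dim (Inv (psums (rotate r ms))))"
        using val[of "sorted_list_of_multiset ?M'"] word[of ?M'] P' inc(4) True s by simp
      obtain k where k: "psums ms = cyc_shift n (int k) (psums (rotate r ms))"
        using psums_rotate[OF h(6) ms, of r] True by blast
      have "psums (rotate r ms) \<subseteq> {1..n}" using psums_range[of "rotate r ms"] h(6) True s by simp
      moreover have "psums (rotate r ms) \<noteq> {}"
      proof
        assume "psums (rotate r ms) = {}"
        then have "psums ms = {}" using k by simp
        then show False using ms by (cases ms) auto
      qed
      ultimately show ?thesis
        unfolding M M' k using dim_Inv_shift[of "psums (rotate r ms)" k] nD by simp
    qed
  qed
  have "?f \<in> cQSym n"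
    unfolding cQSym_def
  proof (intro CollectI conjI allI impI)
    show "?f M \<in> \<int>" for M unfolding skew_schur_def by simp
  next
    fix M assume "?f M \<noteq> 0"
    then show "size M = n" "\<forall>i\<in>#M. 1 \<le> i" using supp by blast+
  next
    fix "is" is' ms ms' :: "nat list"
    assume h: "1 \<le> length ms \<and> length is = length ms \<and> length is' = length ms \<and>
        var_indices is \<and> var_indices is' \<and> (\<forall>m\<in>set ms. 0 < m) \<and> (\<exists>r. ms' = rotate r ms)"
    then obtain r where "ms' = rotate r ms" by blast
    then show "?f (power_monomial is ms) = ?f (power_monomial is' ms')" using shift[of ms "is" is' r] h by blast
  qed
  moreover have "0 \<le> c A" for A unfolding c_def by simp
  ultimately show ?thesis
    using expansion F_hat_expansion_unique[OF n] by blast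
qed

end
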